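(* Let $J$ be a smooth almost complex structure on $\mathbb{R}^{2n}\cong\mathbb{C}^n$ such that $\det(J(z)+J_{st})\neq 0$ for all $z$, and fix $0<\alpha<1$. Let $f\in\mathcal{C}^{1,\alpha}(\overline{\mathbb{D}})$ be a $J$-holomorphic disc and let $V\in\mathcal{C}^{1,\alpha}(\overline{\mathbb{D}})$ be a $J$-holomorphic variational vector field along $f$. Then there exist $t_0>0$ and a family $(f_t)_{|t|<t_0}\subset\mathcal{C}^{1,\alpha}(\overline{\mathbb{D}})$ of $J$-holomorphic discs such that $f_0=f$ and $\frac{d}{dt}\big|_{t=0}f_t=V$.
   Context: $\mathbb{D}\subset\mathbb{C}$ is the open unit disc, $\zeta=x+iy\in\mathbb{D}$. An almost complex structure $J$ on $\mathbb{R}^{2n}$ is a smooth matrix-valued function with $J^2=-\mathrm{id}$; $J_{st}$ denotes the standard structure (multiplication by $i$ under $\mathbb{R}^{2n}\cong\mathbb{C}^n$). A $\mathcal{C}^1$ map $f:\mathbb{D}\to\mathbb{R}^{2n}$ is a $J$-holomorphic disc if $f_x+J(f)f_y=0$ on $\mathbb{D}$ (equivalently $df\circ J_{st}=J(f)\circ df$). A $\mathcal{C}^1$ map $V:\mathbb{D}\to\mathbb{R}^{2n}$ is a $J$-holomorphic variational vector field along $f$ if $V_x+J(f)V_y+d_fJ(V)f_y=0$ on $\mathbb{D}$, where $d_fJ(V)$ denotes the derivative of $z\mapsto J(z)$ at $f(\zeta)$ applied to $V(\zeta)$. $\mathcal{C}^{k,\alpha}(\overline{\mathbb{D}})$ denotes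 the Hölder space of $\mathbb{R}^{2n}$-valued maps on $\overline{\mathbb{D}}$. *)

theory Defs
  imports "HOL-Analysis.Analysis"
begin

text \<open>We model \<open>\<real>\<^sup>2\<^sup>n \<cong> \<complex>\<^sup>n\<close> as \<open>real ^ ('n + 'n)\<close>: the coordinate \<open>Inl k\<close> is
  the real part \<open>x\<^sub>k\<close> and \<open>Inr k\<close> the imaginary part \<open>y\<^sub>k\<close> of \<open>z\<^sub>k\<close>.
  Almost complex structures are matrix-valued maps.\<close>

type_synonym 'n R2n = "real ^ ('n + 'n)"
type_synonym 'n mat2n = "real ^ ('n + 'n) ^ ('n + 'n)"

text \<open>The standard structure: multiplication by \<open>i\<close>, \<open>(x,y) \<mapsto> (-y,x)\<close>.\<close>
definition Jst :: "('n::finite) mat2n" where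
  "Jst = (\<chi> i j. (case (i, j) of
      (Inl k, Inr l) \<Rightarrow> (if k = l then -1 else 0)
    | (Inr k, Inl l) \<Rightarrow> (if k = l then 1 else 0)
    | _ \<Rightarrow> 0))"

definition pderiv_axis :: "'m::finite \<Rightarrow> (real ^ 'm \<Rightarrow> real) \<Rightarrow> real ^ 'm \<Rightarrow> real" where
  "pderiv_axis i h x = frechet_derivative h (at x) (axis i 1)"

inductive_set iter_partials :: "(real ^ ('m::finite) \<Rightarrow> real) \<Rightarrow> (real ^ 'm \<Rightarrow> real) set"
  for g where
  base: "g \<in> iter_partials g"
| step: "h \<in> iter_partials g \<Longrightarrow> pderiv_axis i h \<in> iter_partials g"

definition smooth_scalar :: "(real ^ ('m::finite) \<Rightarrow> real) \<Rightarrow> bool" where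
  "smooth_scalar g \<longleftrightarrow> (\<forall>h \<in> iter_partials g. \<forall>x. h differentiable (at x))"

definition smooth_matrix_fun :: "(real ^ ('m::finite) \<Rightarrow> real ^ 'm ^ 'm) \<Rightarrow> bool" where
  "smooth_matrix_fun J \<longleftrightarrow> (\<forall>i j. smooth_scalar (\<lambda>z. J z $ i $ j))"

definition almost_complex_structure :: "(('n::finite) R2n \<Rightarrow> 'n mat2n) \<Rightarrow> bool" where
  "almost_complex_structure J \<longleftrightarrow>
     smooth_matrix_fun J \<and> (\<forall>z. J z ** J z = - mat 1)"

definition px :: "(complex \<Rightarrow> 'a::real_normed_vector) \<Rightarrow> complex \<Rightarrow> 'a" where
  "px f z = frechet_derivative f (at z) 1"
definition py :: "(complex \<Rightarrow> 'a::real_normed_vector) \<Rightarrow> complex \<Rightarrow> 'a" where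
  "py f z = frechet_derivative f (at z) \<i>"

definition C1_disc :: "(complex \<Rightarrow> 'a::real_normed_vector) \<Rightarrow> bool" where
  "C1_disc f \<longleftrightarrow> f differentiable_on ball 0 1 \<and>
     continuous_on (ball 0 1) (px f) \<and> continuous_on (ball 0 1) (py f)"

definition holder_on :: "real \<Rightarrow> 'a::metric_space set \<Rightarrow> ('a \<Rightarrow> 'b::real_normed_vector) \<Rightarrow> bool" where
  "holder_on \<alpha> S g \<longleftrightarrow> (\<exists>C. \<forall>x\<in>S. \<forall>y\<in>S. norm (g x - g y) \<le> C * dist x y powr \<alpha>)"

definition C1alpha_closed_disc :: "real \<Rightarrow> (complex \<Rightarrow> 'a::real_normed_vector) \<Rightarrow> bool" where
  "C1alpha_closed_disc \<alpha> f \<longleftrightarrow>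
     (\<exists>fx fy. (\<forall>z\<in>cball 0 1.
                 (f has_derivative (\<lambda>h. Re h *\<^sub>R fx z + Im h *\<^sub>R fy z)) (at z within cball 0 1)) \<and>
             continuous_on (cball 0 1) fx \<and> continuous_on (cball 0 1) fy \<and>
             holder_on \<alpha> (cball 0 1) f \<and> holder_on \<alpha> (cball 0 1) fx \<and>
             holder_on \<alpha> (cball 0 1) fy)"

definition J_hol_disc :: "(('n::finite) R2n \<Rightarrow> 'n mat2n) \<Rightarrow> (complex \<Rightarrow> 'n R2n) \<Rightarrow> bool" where
  "J_hol_disc J f \<longleftrightarrow> C1_disc f \<and>
     (\<forall>\<zeta>\<in>ball 0 1. px f \<zeta> + J (f \<zeta>) *v py f \<zeta> = 0)"

definition J_hol_variation ::
  "(('n::finite) R2n \<Rightarrow> 'n mat2n) \<Rightarrow> (complex \<Rightarrow> 'n R2n) \<Rightarrow> (complex \<Rightarrow> 'n R2n) \<Rightarrow> bool" where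
  "J_hol_variation J f V \<longleftrightarrow> C1_disc V \<and>
     (\<forall>\<zeta>\<in>ball 0 1. px V \<zeta> + J (f \<zeta>) *v py V \<zeta>
        + frechet_derivative J (at (f \<zeta>)) (V \<zeta>) *v py f \<zeta> = 0)"

end

theory Submission
  imports Defs
begin

text \<open>
  Each \<open>f\<^sub>t = f + t V + O(t\<^sup>2)\<close> is found separately, by a Newton iteration in \<open>C\<^sup>1\<^sup>,\<^sup>\<alpha>\<close>. It needs
  a bounded right inverse, from \<open>C\<^sup>\<alpha>\<close> to \<open>C\<^sup>1\<^sup>,\<^sup>\<alpha>\<close>, of the linearised operator
  \<open>W \<mapsto> W\<^sub>x + J(f) W\<^sub>y + dJ(W) f\<^sub>y\<close>. The substitution \<open>W = (1 - J(f) J\<^sub>s\<^sub>t) U\<close>, invertible because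
  \<open>1 - J J\<^sub>s\<^sub>t = - J (J + J\<^sub>s\<^sub>t)\<close>, turns it into \<open>U\<^sub>x + J\<^sub>s\<^sub>t U\<^sub>y + B U\<close> with \<open>B\<close> of class \<open>C\<^sup>\<alpha>\<close>.

  Neither Fredholm theory nor unique continuation is needed to invert this operator. The Cauchy kernel
  \<open>1 / (z - w)\<close> may be multiplied by \<open>q\<^sup>2\<^sup>m\<close>, where \<open>q = (1 + z cnj w) / (1 + |w|\<^sup>2)\<close>: this factor is
  holomorphic in \<open>z\<close> and equal to \<open>1\<close> for \<open>z = w\<close>, so the new kernel still inverts the Cauchy-Riemann
  operator. Because of
  \<open>|q|\<^sup>2 (1 + |w|\<^sup>2) = (1 + |z|\<^sup>2) - |z - w|\<^sup>2 / (1 + |w|\<^sup>2)\<close>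
  its norm in the supremum norm with weight \<open>(1 + |z|\<^sup>2)\<^sup>-\<^sup>m\<close> tends to \<open>0\<close> as \<open>m\<close> grows, so that the
  Neumann series for the perturbation \<open>B\<close> converges.
\<close>

section \<open>Integrals over the plane\<close>

text \<open>The zeroth-order term B is the obstacle: composed with the Cauchy transform it is
  compact but need not be small, and the disc cannot be shrunk. What removes it is the freedom in
  the choice of the right inverse: no boundary condition is imposed, so holomorphic terms may be
  added to the kernel. The weight is the Fubini-Study weight. Away from the diagonal the multiplied
  kernel is damped geometrically in m, and near the diagonal 1/|z - w| already has a small integral.

  Derivatives of the transform would normally call for singular integrals and an analysis at the
  boundary. Here the data are extended to the plane by nearest-point projection and cut off, and the
  transform is expanded to first order at each point of the closed disc, with an error of order |z'
  - z|^(1+\<alpha>); a Campanato argument turns this into Hoelder derivatives.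

  The Newton linearisation stays frozen at f, so a single right inverse serves all steps and all t.
  The distance from the limit to f + tV is of order t^2, and this alone yields the derivative at t =
  0; no regularity in t is involved elsewhere.\<close>

lemma emeasure_ball_complex_le:
  assumes "0 \<le> r"
  shows "emeasure lborel (ball (a::complex) r) \<le> ennreal (4 * r\<^sup>2)"
proof (cases "r = 0")
  case False
  then have r: "r > 0" using assms by simp
  have "unit_ball_vol 2 \<le> 4"
    using pi_less_4 by (simp add: unit_ball_vol_2)
  then show ?thesis using r
    by (auto simp: emeasure_ball intro!: ennreal_leI mult_right_mono)
qed simp

text \<open>A dyadic replacement for polar coordinates: at every point \<open>F\<close> is dominated
  by one summand \<open>c j\<close> on the ball of radius \<open>\<rho> j\<close>, hence by the
  whole series. Its integral is bounded by a geometric series because \<open>c j\<close> times the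
  area bound \<open>4 * (\<rho> j)\<^sup>2\<close> equals \<open>K * q ^ j\<close>.\<close>

lemma nn_integral_dyadic_bound:
  fixes a :: complex and F :: "complex \<Rightarrow> ennreal"
  assumes c: "\<And>j. 0 \<le> c j" and \<rho>: "\<And>j. 0 \<le> \<rho> j"
    and eq: "\<And>j. c j * (4 * (\<rho> j)\<^sup>2) = K * q ^ j" and q: "0 \<le> q" "q < 1"
    and pw: "\<And>w. F w = 0 \<or> (\<exists>j. w \<in> ball a (\<rho> j) \<and> F w \<le> ennreal (c j))"
  shows "(\<integral>\<^sup>+w. F w \<partial>lborel) \<le> ennreal (K / (1 - q))"
proof -
  have K: "0 \<le> K" using eq[of 0] c[of 0] by (metis mult_nonneg_nonneg mult.right_neutral power_0 zero_le_numeral zero_le_power2)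
  have "F w \<le> (\<Sum>j. ennreal (c j) * indicator (ball a (\<rho> j)) w)" for w
  proof -
    consider "F w = 0" | j where "w \<in> ball a (\<rho> j)" "F w \<le> ennreal (c j)" using pw by blast
    then show ?thesis
    proof cases
      case 2
      then have "F w \<le> (\<Sum>i\<in>{j}. ennreal (c i) * indicator (ball a (\<rho> i)) w)" by simp
      also have "\<dots> \<le> (\<Sum>i. ennreal (c i) * indicator (ball a (\<rho> i)) w)"
        by (rule sum_le_suminf) auto
      finally show ?thesis .
    qed simp
  qed
  then have "(\<integral>\<^sup>+w. F w \<partial>lborel) \<le> (\<integral>\<^sup>+w. (\<Sum>j. ennreal (c j) * indicator (ball a (\<rho> j)) w) \<partial>lborel)"
    by (intro nn_integral_mono) auto
  also have "\<dots> = (\<Sum>j. ennreal (c j) * emeasure lborel (ball a (\<rho> j)))"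
    by (subst nn_integral_suminf) (auto intro!: borel_measurable_times_ennreal borel_measurable_indicator simp: nn_integral_cmult_indicator)
  also have "\<dots> \<le> (\<Sum>j. ennreal (K * q ^ j))"
  proof (intro suminf_le allI)
    fix j
    have "ennreal (c j) * emeasure lborel (ball a (\<rho> j)) \<le> ennreal (c j) * ennreal (4 * (\<rho> j)\<^sup>2)"
      by (intro mult_left_mono emeasure_ball_complex_le \<rho>) auto
    also have "\<dots> = ennreal (K * q ^ j)" by (simp add: ennreal_mult' c flip: eq)
    finally show "ennreal (c j) * emeasure lborel (ball a (\<rho> j)) \<le> ennreal (K * q ^ j)" .
  qed auto
  also have "\<dots> = ennreal (K / (1 - q))"
  proof (rule suminf_ennreal_eq)
    show "(\<lambda>j. K * q ^ j) sums (K / (1 - q))"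
      using geometric_sums[of q] q sums_mult[of "\<lambda>j. q ^ j" "1 / (1 - q)" K] by simp
  qed (use K q in auto)
  finally show ?thesis .
qed

lemma two_powr_double: "(2::real) powr (2 * real j) = (2 ^ j)\<^sup>2"
  using powr_realpow[of 2 "2 * j"] by (simp add: power_mult mult.commute)

text \<open>The shells are \<open>r / 2^(j+1) \<le> |w - a| < r / 2^j\<close>. Value times area
  scales like \<open>2 powr ((\<beta> - 2) * j)\<close>, which is summable because \<beta> <
  2.\<close>

lemma nn_integral_powr_near:
  assumes \<beta>: "\<beta> < 2" "0 \<le> \<beta>"
  obtains C where "C > 0"
    "\<And>r (a::complex). r > 0 \<Longrightarrow> (\<integral>\<^sup>+w. indicator (ball a r) w * ennreal (norm (w - a) powr -\<beta>) \<partial>lborel)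
        \<le> ennreal (C * r powr (2 - \<beta>))"
proof
  define q where "q = 2 powr (\<beta> - 2)"
  have q: "0 < q" "q < 1" using \<beta> by (auto simp: q_def powr_less_one)
  show "4 * 2 powr \<beta> / (1 - q) > 0" using q by simp
  fix r :: real and a :: complex assume r: "r > 0"
  have eq: "(r / 2 ^ (j + 1)) powr -\<beta> * (4 * (r / 2 ^ j)\<^sup>2) = (4 * 2 powr \<beta> * r powr (2 - \<beta>)) * q ^ j" for j
  proof -
    have "r / 2 ^ (j + 1) = r * 2 powr (-(real j + 1))"
      by (simp add: powr_minus powr_diff powr_realpow field_simps)
    then have 1: "(r / 2 ^ (j + 1)) powr -\<beta> = r powr -\<beta> * 2 powr (\<beta> * (real j + 1))"
      using r by (simp only: powr_mult powr_powr powr_ge_zero) (simp add: algebra_simps)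
    have 2: "(r / 2 ^ j)\<^sup>2 = r\<^sup>2 * 2 powr (-(2 * real j))"
      using two_powr_double[of j] by (simp add: powr_minus power_divide power_mult_distrib divide_inverse power_inverse)
    have 3: "q ^ j = 2 powr ((\<beta> - 2) * j)"
      by (simp add: q_def powr_powr flip: powr_realpow)
    have 4: "2 powr (\<beta> * (real j + 1)) * 2 powr (-(2 * real j)) = 2 powr \<beta> * (2::real) powr ((\<beta> - 2) * j)"
      by (simp add: algebra_simps flip: powr_add)
    have 5: "r powr -\<beta> * r\<^sup>2 = r powr (2 - \<beta>)"
      using r by (simp add: powr_diff powr_minus divide_inverse)
    show ?thesis unfolding 1 2 3 5[symmetric] using 4 by (simp add: ac_simps) 
  qed
  have "(\<integral>\<^sup>+w. indicator (ball a r) w * ennreal (norm (w - a) powr -\<beta>) \<partial>lborel) \<le> ennreal ((4 * 2 powr \<beta> * r powr (2 - \<beta>)) / (1 - q))"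
  proof (rule nn_integral_dyadic_bound[where c = "\<lambda>j. (r / 2 ^ (j + 1)) powr -\<beta>" and \<rho> = "\<lambda>j. r / 2 ^ j" and a = a])
    fix w
    show "indicator (ball a r) w * ennreal (norm (w - a) powr -\<beta>) = 0 \<or> (\<exists>j. w \<in> ball a (r / 2 ^ j) \<and>
       indicator (ball a r) w * ennreal (norm (w - a) powr -\<beta>) \<le> ennreal ((r / 2 ^ (j + 1)) powr -\<beta>))"
    \<comment> \<open>At \<open>w = a\<close> the integrand is \<open>0\<close>, since
      \<open>0 powr x = 0\<close>; the centre therefore falls under the trivial alternative.\<close>
    proof (cases "w \<in> ball a r \<and> w \<noteq> a")
      case True
      then have n: "0 < norm (w - a)" "norm (w - a) < r" by (auto simp: dist_norm norm_minus_commute)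
      obtain k where k: "r / 2 ^ k \<le> norm (w - a)"
      proof -
        obtain k where "(1/2) ^ k < norm (w - a) / r"
          using real_arch_pow_inv[of "norm (w - a) / r" "1/2"] n r by auto
        then have "r / 2 ^ k \<le> norm (w - a)" using r by (simp add: field_simps power_divide)
        then show ?thesis by (rule that)
      qed
      \<comment> \<open>This least index is positive, and its predecessor numbers the shell that
        contains \<open>w\<close>.\<close>
      define l where "l = (LEAST k. r / 2 ^ k \<le> norm (w - a))"
      have l: "r / 2 ^ l \<le> norm (w - a)" unfolding l_def by (rule LeastI) (rule k)
      have "l \<noteq> 0" using l n by (cases l) auto
      then obtain j where j: "l = Suc j" using not0_implies_Suc by blast
      then have "\<not> r / 2 ^ j \<le> norm (w - a)" using not_less_Least[of j "\<lambda>k. r / 2 ^ k \<le> norm (w - a)"] by (auto simp: l_def)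
      then have "w \<in> ball a (r / 2 ^ j)" by (auto simp: dist_norm norm_minus_commute)
      moreover have "norm (w - a) powr -\<beta> \<le> (r / 2 ^ (j + 1)) powr -\<beta>"
        using l j r \<beta> by (intro powr_mono2') auto
      ultimately show ?thesis using True by (intro disjI2 exI[of _ j]) (auto intro: ennreal_leI)
    qed (auto simp: indicator_def)
  qed (use r q eq in auto)
  then show "(\<integral>\<^sup>+w. indicator (ball a r) w * ennreal (norm (w - a) powr -\<beta>) \<partial>lborel) \<le> ennreal (4 * 2 powr \<beta> / (1 - q) * r powr (2 - \<beta>))"
    by simp
qed

text \<open>The same decomposition outward: the shells
  \<open>r * 2^j \<le> |w - a| < r * 2^(j+1)\<close> carry masses of ratio
  \<open>2 powr (2 - \<beta>)\<close>, which is below 1 because 2 < \<beta>.\<close>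

lemma nn_integral_powr_far:
  assumes \<beta>: "2 < \<beta>"
  obtains C where "C > 0"
    "\<And>r (a::complex). r > 0 \<Longrightarrow> (\<integral>\<^sup>+w. indicator (- ball a r) w * ennreal (norm (w - a) powr -\<beta>) \<partial>lborel)
        \<le> ennreal (C * r powr (2 - \<beta>))"
proof
  define q where "q = 2 powr (2 - \<beta>)"
  have q: "0 < q" "q < 1" using \<beta> by (auto simp: q_def powr_less_one)
  show "16 / (1 - q) > 0" using q by simp
  fix r :: real and a :: complex assume r: "r > 0"
  have eq: "(r * 2 ^ j) powr -\<beta> * (4 * (r * 2 ^ (j + 1))\<^sup>2) = (16 * r powr (2 - \<beta>)) * q ^ j" for j
  proof -
    have "r * 2 ^ j = r * 2 powr (real j)"
      by (simp add: powr_realpow)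
    then have 1: "(r * 2 ^ j) powr -\<beta> = r powr -\<beta> * 2 powr (- \<beta> * real j)"
      using r by (simp only: powr_mult powr_powr powr_ge_zero) (simp add: algebra_simps)
    have 2: "(r * 2 ^ (j + 1))\<^sup>2 = 4 * (r\<^sup>2 * 2 powr (2 * real j))"
      using two_powr_double[of j] by (simp add: power_mult_distrib)
    have 3: "q ^ j = 2 powr ((2 - \<beta>) * j)"
      by (simp add: q_def powr_powr flip: powr_realpow)
    have 4: "2 powr (- \<beta> * real j) * 2 powr (2 * real j) = (2::real) powr ((2 - \<beta>) * j)"
      by (simp add: algebra_simps flip: powr_add)
    have 5: "r powr -\<beta> * r\<^sup>2 = r powr (2 - \<beta>)"
      using r by (simp add: powr_diff powr_minus divide_inverse)
    show ?thesis unfolding 1 2 3 5[symmetric] 4[symmetric] by simp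
  qed
  have "(\<integral>\<^sup>+w. indicator (- ball a r) w * ennreal (norm (w - a) powr -\<beta>) \<partial>lborel) \<le> ennreal ((16 * r powr (2 - \<beta>)) / (1 - q))"
  proof (rule nn_integral_dyadic_bound[where c = "\<lambda>j. (r * 2 ^ j) powr -\<beta>" and \<rho> = "\<lambda>j. r * 2 ^ (j + 1)" and a = a])
    fix w
    show "indicator (- ball a r) w * ennreal (norm (w - a) powr -\<beta>) = 0 \<or> (\<exists>j. w \<in> ball a (r * 2 ^ (j + 1)) \<and>
       indicator (- ball a r) w * ennreal (norm (w - a) powr -\<beta>) \<le> ennreal ((r * 2 ^ j) powr -\<beta>))"
    proof (cases "w \<in> - ball a r")
      case True
      then have n: "r \<le> norm (w - a)" by (auto simp: dist_norm norm_minus_commute)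
      obtain k where k: "norm (w - a) < r * 2 ^ k"
      proof -
        obtain k where "norm (w - a) / r < 2 ^ k"
          using real_arch_pow[of 2 "norm (w - a) / r"] by auto
        then have "norm (w - a) < r * 2 ^ k" using r by (simp add: field_simps)
        then show ?thesis by (rule that)
      qed
      define l where "l = (LEAST k. norm (w - a) < r * 2 ^ k)"
      have l: "norm (w - a) < r * 2 ^ l" unfolding l_def by (rule LeastI) (rule k)
      have "l \<noteq> 0" using l n by (cases l) auto
      then obtain j where j: "l = Suc j" using not0_implies_Suc by blast
      then have "\<not> norm (w - a) < r * 2 ^ j" using not_less_Least[of j "\<lambda>k. norm (w - a) < r * 2 ^ k"] by (auto simp: l_def)
      then have "norm (w - a) powr -\<beta> \<le> (r * 2 ^ j) powr -\<beta>"
        using r \<beta> by (intro powr_mono2') auto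
      moreover have "w \<in> ball a (r * 2 ^ (j + 1))" using l j by (auto simp: dist_norm norm_minus_commute)
      ultimately show ?thesis using True by (intro disjI2 exI[of _ j]) (auto intro: ennreal_leI)
    qed (auto simp: indicator_def)
  qed (use r q eq in auto)
  then show "(\<integral>\<^sup>+w. indicator (- ball a r) w * ennreal (norm (w - a) powr -\<beta>) \<partial>lborel) \<le> ennreal (16 / (1 - q) * r powr (2 - \<beta>))"
    by simp
qed

lemma integrable_norm_bound:
  fixes f :: "'a \<Rightarrow> 'b::{banach, second_countable_topology}"
  assumes [measurable]: "f \<in> borel_measurable M"
    and g: "AE x in M. ennreal (norm (f x)) \<le> g x" and C: "(\<integral>\<^sup>+x. g x \<partial>M) \<le> ennreal C" "0 \<le> C"
  shows "integrable M f" "norm (integral\<^sup>L M f) \<le> C"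
proof -
  have le: "(\<integral>\<^sup>+x. ennreal (norm (f x)) \<partial>M) \<le> ennreal C"
    using nn_integral_mono_AE[OF g] C(1) by (rule order_trans)
  show int: "integrable M f"
    by (rule integrableI_bounded) (auto intro: le_less_trans[OF le])
  have "ennreal (norm (integral\<^sup>L M f)) \<le> ennreal C"
    using integral_norm_bound_ennreal[OF int] le by (rule order_trans)
  then show "norm (integral\<^sup>L M f) \<le> C" using C(2) by simp
qed

section \<open>Change of variables and the vanishing integral of a derivative\<close>

lemma lborel_integral_affine:
  fixes f :: "'a::euclidean_space \<Rightarrow> 'b::{banach, second_countable_topology}"
  assumes [measurable]: "f \<in> borel_measurable borel" and c: "c \<noteq> 0"
  shows "(\<integral>x. f x \<partial>lborel) = \<bar>c\<bar> ^ DIM('a) *\<^sub>R (\<integral>x. f (t + c *\<^sub>R x) \<partial>lborel)"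
  by (subst lborel_affine[OF c, of t]) (simp add: integral_density integral_distr)

lemma lborel_integral_translation:
  fixes f :: "'a::euclidean_space \<Rightarrow> 'b::{banach, second_countable_topology}"
  assumes "f \<in> borel_measurable borel"
  shows "(\<integral>x. f (x + t) \<partial>lborel) = (\<integral>x. f x \<partial>lborel)"
  using lborel_integral_affine[of f 1 t] assms by (simp add: add.commute)

lemma lborel_integrable_translation:
  fixes f :: "'a::euclidean_space \<Rightarrow> 'b::{banach, second_countable_topology}"
  assumes [measurable]: "f \<in> borel_measurable borel"
  shows "integrable lborel (\<lambda>x. f (x + t)) \<longleftrightarrow> integrable lborel f"
  by (subst (2) lborel_affine[of 1 t]) (simp_all add: integrable_distr_eq density_1 add.commute)

text \<open>Difference quotients in the direction \<open>e\<close> have integral zero by translation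
  invariance and converge pointwise to \<open>F' w e\<close>. The Lipschitz bound and the bounded
  support provide a common majorant, so the limit passes under the integral.\<close>

lemma lborel_integral_derivative_zero:
  fixes F :: "complex \<Rightarrow> complex"
  assumes der: "\<And>w. (F has_derivative F' w) (at w)"
    and L: "\<And>w h. norm (F' w h) \<le> L * norm h"
    and supp: "\<And>w. R \<le> norm w \<Longrightarrow> F w = 0"
  shows "integrable lborel (\<lambda>w. F' w e)" "(\<integral>w. F' w e \<partial>lborel) = 0"
proof -
  have cont: "continuous_on UNIV F"
    using der by (meson UNIV_I continuous_at_imp_continuous_on has_derivative_continuous)
  then have [measurable]: "F \<in> borel_measurable borel" by (rule borel_measurable_continuous_onI)
  have Lip: "norm (F x - F y) \<le> L * norm (x - y)" for x y
  proof (rule differentiable_bound[where S = UNIV and f' = F'])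
    show "onorm (F' w) \<le> L" for w
      by (intro onorm_bound) (use L[of w] L[of w 1] in \<open>auto intro: order_trans[OF norm_ge_zero]\<close>)
  qed (use der in auto)
  have L0: "0 \<le> L" using L[of 0 1] by (auto intro: order_trans[OF norm_ge_zero])
  define t where "t n = 1 / (real n + 1)" for n :: nat
  have t0: "t n > 0" for n by (simp add: t_def)
  have t1: "t n \<le> 1" for n by (simp add: t_def)
  define s where "s n w = (F (w + t n *\<^sub>R e) - F w) /\<^sub>R t n" for n w
  have [measurable]: "s n \<in> borel_measurable lborel" for n unfolding s_def by measurable
  have lim: "(\<lambda>n. s n w) \<longlonglongrightarrow> F' w e" for w
  proof -
    have "((\<lambda>\<tau>. F (w + \<tau> *\<^sub>R e)) has_derivative (\<lambda>\<tau>. F' w (\<tau> *\<^sub>R e))) (at 0)"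
      by (rule has_derivative_compose[of "\<lambda>\<tau>. w + \<tau> *\<^sub>R e" "\<lambda>\<tau>. \<tau> *\<^sub>R e" 0 UNIV F "F' w", simplified])
         (use der[of w] in \<open>auto intro!: derivative_eq_intros\<close>)
    moreover have "F' w (\<tau> *\<^sub>R e) = \<tau> *\<^sub>R F' w e" for \<tau>
      using der[of w] by (simp add: has_derivative_def bounded_linear_def linear_cmul)
    ultimately have "((\<lambda>\<tau>. F (w + \<tau> *\<^sub>R e)) has_vector_derivative F' w e) (at 0)"
      by (simp add: has_vector_derivative_def)
    then have lim0: "((\<lambda>\<tau>. norm (F (w + \<tau> *\<^sub>R e) - F w - \<tau> *\<^sub>R F' w e) / norm \<tau>) \<longlongrightarrow> 0) (at 0)"
      by (simp add: has_vector_derivative_def has_derivative_at)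
    have eq: "norm (F (w + \<tau> *\<^sub>R e) - F w - \<tau> *\<^sub>R F' w e) / norm \<tau> = norm ((F (w + \<tau> *\<^sub>R e) - F w) /\<^sub>R \<tau> - F' w e)"
      if "\<tau> \<noteq> 0" for \<tau>
    proof -
      have "(F (w + \<tau> *\<^sub>R e) - F w) /\<^sub>R \<tau> - F' w e = (F (w + \<tau> *\<^sub>R e) - F w - \<tau> *\<^sub>R F' w e) /\<^sub>R \<tau>"
        using that by (simp add: scaleR_diff_right)
      then show ?thesis by (simp add: divide_inverse mult.commute)
    qed
    have "((\<lambda>\<tau>. norm ((F (w + \<tau> *\<^sub>R e) - F w) /\<^sub>R \<tau> - F' w e)) \<longlongrightarrow> 0) (at 0)"
      by (rule Lim_transform_eventually[OF lim0]) (simp add: eventually_at_filter eq del: real_norm_def)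
    then have "((\<lambda>\<tau>. (F (w + \<tau> *\<^sub>R e) - F w) /\<^sub>R \<tau>) \<longlongrightarrow> F' w e) (at 0)"
      by (simp add: tendsto_norm_zero_iff LIM_zero_iff)
    moreover have "t \<longlonglongrightarrow> 0"
      using LIMSEQ_inverse_real_of_nat by (simp add: t_def[abs_def] inverse_eq_divide add.commute)
    ultimately show ?thesis unfolding s_def
      using t0 by (simp add: tendsto_at_iff_sequentially comp_def) (metis order_less_irrefl)
  qed
  \<comment> \<open>The step lengths \<open>t n\<close> are at most \<open>1\<close>, so every
    quotient vanishes outside the ball of radius \<open>R + norm e\<close>.\<close>
  let ?G = "\<lambda>w. (L * norm e) * indicator (cball (0::complex) (R + norm e)) w"
  have intG: "integrable lborel ?G"
    by (intro integrable_mult_right integrable_real_indicator) (auto intro!: emeasure_bounded_finite[unfolded infinity_ennreal_def])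
  have bnd: "norm (s n w) \<le> ?G w" for n w
  proof (cases "w \<in> cball 0 (R + norm e)")
    case True
    have "norm (s n w) \<le> L * norm (t n *\<^sub>R e) / t n"
      using Lip[of "w + t n *\<^sub>R e" w] t0[of n] by (simp add: s_def divide_inverse mult.commute)
    then show ?thesis using True t0[of n] by simp
  next
    case False
    then have "norm w > R + norm e" by simp
    moreover have "norm (t n *\<^sub>R e) \<le> norm e" using t0[of n] t1[of n] by (simp add: mult_left_le_one_le)
    moreover have "norm w \<le> norm (w + t n *\<^sub>R e) + norm (t n *\<^sub>R e)"
      by (metis add_diff_cancel norm_triangle_ineq4)
    ultimately have "F (w + t n *\<^sub>R e) = 0" "F w = 0" using supp by (auto intro!: supp simp del: norm_scaleR) (meson norm_ge_zero order.strict_implies_order add_nonneg_nonneg le_add_same_cancel1 order_trans)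
    then show ?thesis using False by (simp add: s_def)
  qed
  have intF: "integrable lborel F"
  proof (rule Bochner_Integration.integrable_bound[where f="\<lambda>w. (L * (2 * \<bar>R\<bar> + 1)) * indicator (cball (0::complex) \<bar>R\<bar>) w"])
    show "AE w in lborel. norm (F w) \<le> norm ((L * (2 * \<bar>R\<bar> + 1)) * indicator (cball (0::complex) \<bar>R\<bar>) w)"
    proof (intro AE_I2)
      fix w :: complex
      show "norm (F w) \<le> norm ((L * (2 * \<bar>R\<bar> + 1)) * indicator (cball (0::complex) \<bar>R\<bar>) w)"
      proof (cases "norm w \<le> \<bar>R\<bar>")
        case True
        \<comment> \<open>The real point \<open>|R|\<close> lies where \<open>F\<close> vanishes;
          the Lipschitz estimate measured from it bounds \<open>F\<close> on the ball.\<close>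
        have "F (complex_of_real \<bar>R\<bar>) = 0" by (rule supp) simp
        then have "norm (F w) \<le> L * norm (w - complex_of_real \<bar>R\<bar>)" using Lip[of w "complex_of_real \<bar>R\<bar>"] by simp
        also have "norm (w - complex_of_real \<bar>R\<bar>) \<le> 2 * \<bar>R\<bar> + 1" using norm_triangle_ineq4[of w "complex_of_real \<bar>R\<bar>"] True by simp
        finally show ?thesis using True L0 by (simp add: mult_left_mono abs_mult)
      next
        case False
        then show ?thesis using supp[of w] by auto
      qed
    qed
    show "integrable lborel (\<lambda>w. (L * (2 * \<bar>R\<bar> + 1)) * indicator (cball (0::complex) \<bar>R\<bar>) w)"
      by (intro integrable_mult_right integrable_real_indicator) (auto intro!: emeasure_bounded_finite[unfolded infinity_ennreal_def])
  qed auto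
  have F'm: "(\<lambda>w. F' w e) \<in> borel_measurable lborel"
    by (rule borel_measurable_LIMSEQ_metric[where f = s]) (use lim in auto)
  note dct = integral_dominated_convergence[where s = s and f = "\<lambda>w. F' w e" and w = ?G and M = lborel, OF F'm _ intG]
  show "integrable lborel (\<lambda>w. F' w e)"
    by (rule integrable_dominated_convergence[where s = s and f = "\<lambda>w. F' w e" and w = ?G and M = lborel, OF F'm _ intG])
       (use lim bnd in auto)
  have "(\<integral>w. s n w \<partial>lborel) = 0" for n
  proof -
    have "integrable lborel (\<lambda>w. F (w + t n *\<^sub>R e))"
      using intF by (subst (asm) lborel_integrable_translation[symmetric, of _ "t n *\<^sub>R e"]) auto
    then show ?thesis
      using intF by (simp add: s_def lborel_integral_translation)
  qed
  then have "(\<lambda>n. 0) \<longlonglongrightarrow> (\<integral>w. F' w e \<partial>lborel)"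
    using dct lim bnd by simp
  then show "(\<integral>w. F' w e \<partial>lborel) = 0" by (simp add: LIMSEQ_const_iff)
qed

section \<open>A cutoff with explicit Cauchy transform\<close>

text \<open>The squared positive part is once continuously differentiable, which is all that the
  cutoff has to provide: one derivative for the integration by parts, and continuity of
  \<open>chi\<close>.\<close>

definition sq_pos :: "real \<Rightarrow> real" where "sq_pos y = (max 0 y)\<^sup>2"

lemma DERIV_sq_pos: "(sq_pos has_real_derivative 2 * max 0 y) (at y)"
proof -
  consider "y > 0" | "y < 0" | "y = 0" by linarith
  then show ?thesis
  proof cases
    case 1
    have "((\<lambda>y. y\<^sup>2) has_real_derivative 2 * max 0 y) (at y)"
      using 1 by (auto intro!: derivative_eq_intros)
    then show ?thesis
      by (rule has_field_derivative_transform_within_open[where S = "{0<..}"]) (use 1 in \<open>auto simp: sq_pos_def\<close>)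
  next
    case 2
    have "((\<lambda>y. 0) has_real_derivative 2 * max 0 y) (at y)"
      using 2 by simp
    then show ?thesis
      by (rule has_field_derivative_transform_within_open[where S = "{..<0}"]) (use 2 in \<open>auto simp: sq_pos_def\<close>)
  next
    case 3
    have "((\<lambda>h. sq_pos h / h) \<longlongrightarrow> 0) (at 0)"
    proof (rule Lim_null_comparison)
      show "\<forall>\<^sub>F h in at 0. norm (sq_pos h / h) \<le> \<bar>h\<bar>"
        by (auto simp: eventually_at_filter sq_pos_def max_def power2_eq_square)
    qed (auto intro!: tendsto_eq_intros)
    then show ?thesis using 3 by (simp add: has_field_derivative_iff sq_pos_def)
  qed
qed

text \<open>Nesting two squared positive parts flattens the transition at both ends: the inner one
  makes the derivative vanish at 1, the outer one at 2. The argument will be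
  \<open>|w|\<^sup>2\<close>, so the plateau is the closed unit disc.\<close>

definition cutoff :: "real \<Rightarrow> real" where "cutoff x = sq_pos (1 - sq_pos (x - 1))"
definition cutoff' :: "real \<Rightarrow> real" where
  "cutoff' x = - (4 * max 0 (1 - sq_pos (x - 1)) * max 0 (x - 1))"

lemma DERIV_cutoff: "(cutoff has_real_derivative cutoff' x) (at x)"
proof -
  have "((\<lambda>x. 1 - sq_pos (x - 1)) has_real_derivative - (2 * max 0 (x - 1))) (at x)"
    by (auto intro!: derivative_eq_intros DERIV_chain2[OF DERIV_sq_pos])
  from DERIV_chain2[OF DERIV_sq_pos this] show ?thesis
    by (simp add: cutoff_def[abs_def] cutoff'_def mult.assoc)
qed

lemma cutoff_inner [simp]: "x \<le> 1 \<Longrightarrow> cutoff x = 1" "x \<le> 1 \<Longrightarrow> cutoff' x = 0"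
  by (auto simp: cutoff_def cutoff'_def sq_pos_def)

lemma cutoff_outer [simp]:
  assumes "2 \<le> x" shows "cutoff x = 0" "cutoff' x = 0"
proof -
  have "1 \<le> sq_pos (x - 1)" using assms by (simp add: sq_pos_def)
  then show "cutoff x = 0" "cutoff' x = 0"
    by (auto simp: cutoff_def cutoff'_def sq_pos_def[of "1 - sq_pos _"])
qed

lemma cutoff_bounds: "0 \<le> cutoff x" "cutoff x \<le> 1" "\<bar>cutoff' x\<bar> \<le> 4"
proof -
  have s: "0 \<le> sq_pos y" for y by (simp add: sq_pos_def)
  show "0 \<le> cutoff x" by (simp add: cutoff_def s)
  have "max 0 (1 - sq_pos (x - 1)) \<le> 1" using s[of "x - 1"] by auto
  then show "cutoff x \<le> 1" by (simp add: cutoff_def sq_pos_def[of "1 - _"] power_le_one)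
  show "\<bar>cutoff' x\<bar> \<le> 4"
  proof (cases "x \<le> 2")
    case True
    have "max 0 (1 - sq_pos (x - 1)) * max 0 (x - 1) \<le> 1 * 1"
      by (rule mult_mono) (use s[of "x - 1"] True in auto)
    then show ?thesis by (simp add: cutoff'_def abs_mult)
  qed simp
qed

lemma continuous_cutoff: "continuous_on A cutoff" "continuous_on A cutoff'"
  unfolding cutoff_def cutoff'_def sq_pos_def by (intro continuous_intros)+

text \<open>\<open>chi\<close> is the \<open>\<partial>/\<partial>cnj z\<close> derivative of \<open>bar_cut\<close>. Hence the Cauchy transform of \<open>chi\<close> is a multiple of
  \<open>cnj z\<close> on the unit disc, which avoids computing the transform of an indicator function in polar
  coordinates.\<close>

definition bar_cut :: "complex \<Rightarrow> complex" where
  "bar_cut w = cnj w * of_real (cutoff ((Re w)\<^sup>2 + (Im w)\<^sup>2))"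
definition bar_cut' :: "complex \<Rightarrow> complex \<Rightarrow> complex" where
  "bar_cut' w h = cnj h * of_real (cutoff ((Re w)\<^sup>2 + (Im w)\<^sup>2))
     + cnj w * of_real (cutoff' ((Re w)\<^sup>2 + (Im w)\<^sup>2) * (2 * (Re w * Re h + Im w * Im h)))"
definition chi :: "complex \<Rightarrow> real" where
  "chi w = cutoff ((Re w)\<^sup>2 + (Im w)\<^sup>2) + ((Re w)\<^sup>2 + (Im w)\<^sup>2) * cutoff' ((Re w)\<^sup>2 + (Im w)\<^sup>2)"

lemma bar_cut_inner: "norm w \<le> 1 \<Longrightarrow> bar_cut w = cnj w"
  by (simp add: bar_cut_def power_le_one flip: cmod_power2)

lemma norm_ge_2_power: "2 \<le> norm w \<Longrightarrow> 2 \<le> (cmod w)\<^sup>2"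
  using power_mono[of 2 "norm w" 2] by simp

lemma chi_outer: "2 \<le> norm w \<Longrightarrow> chi w = 0" and bar_cut_outer: "2 \<le> norm w \<Longrightarrow> bar_cut w = 0"
  using norm_ge_2_power[of w] by (simp_all add: chi_def bar_cut_def flip: cmod_power2)

lemma bar_cut_bound: "norm (bar_cut w) \<le> 2"
proof (cases "norm w \<le> 2")
  case True
  have "norm (bar_cut w) \<le> 2 * 1" unfolding bar_cut_def norm_mult
    by (rule mult_mono) (use True cutoff_bounds in auto)
  then show ?thesis by simp
qed (simp add: bar_cut_outer)

lemma chi_bound: "\<bar>chi w\<bar> \<le> 9"
proof (cases "(cmod w)\<^sup>2 \<le> 2")
  case True
  have "\<bar>(cmod w)\<^sup>2 * cutoff' ((cmod w)\<^sup>2)\<bar> \<le> 2 * 4"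
    unfolding abs_mult by (rule mult_mono) (use True cutoff_bounds in auto)
  moreover have "\<bar>chi w\<bar> \<le> \<bar>cutoff ((cmod w)\<^sup>2)\<bar> + \<bar>(cmod w)\<^sup>2 * cutoff' ((cmod w)\<^sup>2)\<bar>"
    unfolding chi_def cmod_power2 by (rule abs_triangle_ineq)
  ultimately show ?thesis using cutoff_bounds[of "(cmod w)\<^sup>2"] by linarith
qed (simp add: chi_def flip: cmod_power2)

lemma continuous_chi: "continuous_on A chi"
  unfolding chi_def
  by (intro continuous_intros continuous_on_compose2[OF continuous_cutoff(1)[of UNIV]]
      continuous_on_compose2[OF continuous_cutoff(2)[of UNIV]]) auto

lemma chi_measurable [measurable]: "chi \<in> borel_measurable borel"
  by (rule borel_measurable_continuous_onI[OF continuous_chi])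

lemma bar_cut_derivative: "(bar_cut has_derivative bar_cut' w) (at w)"
proof -
  have "((\<lambda>w. cutoff ((Re w)\<^sup>2 + (Im w)\<^sup>2)) has_derivative
      (\<lambda>h. cutoff' ((Re w)\<^sup>2 + (Im w)\<^sup>2) * (2 * (Re w * Re h + Im w * Im h)))) (at w)"
    by (rule has_derivative_eq_rhs[OF has_derivative_compose[OF _ DERIV_cutoff[unfolded has_field_derivative_def]]])
       (auto intro!: derivative_eq_intros simp: fun_eq_iff algebra_simps)
  then show ?thesis unfolding bar_cut_def[abs_def] bar_cut'_def
    by (auto intro!: derivative_eq_intros simp: fun_eq_iff)
qed

lemma continuous_bar_cut: "continuous_on A bar_cut"
  using bar_cut_derivative by (meson continuous_at_imp_continuous_on has_derivative_continuous)

lemma bar_cut_measurable [measurable]: "bar_cut \<in> borel_measurable borel"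
  by (rule borel_measurable_continuous_onI[OF continuous_bar_cut])

lemma Re_Im_le: "\<bar>Re w * Re h + Im w * Im h\<bar> \<le> norm w * norm h"
  using Cauchy_Schwarz_ineq2[of w h] by (simp add: inner_complex_def)

lemma bar_cut'_bound: "norm (bar_cut' w h) \<le> 17 * norm h"
proof (cases "(cmod w)\<^sup>2 \<le> 2")
  case True
  have "norm (bar_cut' w h) \<le> norm h * \<bar>cutoff ((cmod w)\<^sup>2)\<bar> + norm w * (\<bar>cutoff' ((cmod w)\<^sup>2)\<bar> * (2 * \<bar>Re w * Re h + Im w * Im h\<bar>))"
    unfolding bar_cut'_def cmod_power2
    by (rule order_trans[OF norm_triangle_ineq]) (simp only: norm_mult norm_of_real abs_mult complex_mod_cnj abs_numeral order_refl)
  also have "\<dots> \<le> norm h * 1 + norm w * (4 * (2 * (norm w * norm h)))"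
    using cutoff_bounds[of "(cmod w)\<^sup>2"] Re_Im_le[of w h] by (intro add_mono mult_mono mult_left_mono) auto
  also have "\<dots> = norm h * (1 + 8 * (cmod w)\<^sup>2)" by (simp add: power2_eq_square algebra_simps)
  also have "\<dots> \<le> norm h * 17" using True by (intro mult_left_mono) auto
  finally show ?thesis by simp
qed (simp add: bar_cut'_def flip: cmod_power2)

lemma bar_cut'_dbar: "bar_cut' w 1 + \<i> * bar_cut' w \<i> = 2 * of_real (chi w)"
  by (simp add: bar_cut'_def chi_def complex_eq_iff power2_eq_square algebra_simps)

text \<open>A regularisation of \<open>1 / w\<close> whose \<open>\<partial>/\<partial>cnj w\<close> derivative is an approximate identity.\<close>

definition cauchy_reg :: "real \<Rightarrow> complex \<Rightarrow> complex" where
  "cauchy_reg s w = cnj w * of_real (inverse ((Re w)\<^sup>2 + (Im w)\<^sup>2 + s\<^sup>2))"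
definition cauchy_reg' :: "real \<Rightarrow> complex \<Rightarrow> complex \<Rightarrow> complex" where
  "cauchy_reg' s w h = cnj h * of_real (inverse ((Re w)\<^sup>2 + (Im w)\<^sup>2 + s\<^sup>2))
     - cnj w * of_real (2 * (Re w * Re h + Im w * Im h) * (inverse ((Re w)\<^sup>2 + (Im w)\<^sup>2 + s\<^sup>2))\<^sup>2)"

lemma cauchy_reg_derivative:
  assumes "s > 0" shows "(cauchy_reg s has_derivative cauchy_reg' s w) (at w)"
proof -
  have "(Re w)\<^sup>2 + (Im w)\<^sup>2 + s\<^sup>2 \<noteq> 0"
    using assms by (metis add_nonneg_pos zero_le_power2 sum_power2_ge_zero zero_less_power less_irrefl)
  then have "((\<lambda>w. inverse ((Re w)\<^sup>2 + (Im w)\<^sup>2 + s\<^sup>2)) has_derivative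
      (\<lambda>h. - (2 * (Re w * Re h + Im w * Im h) * (inverse ((Re w)\<^sup>2 + (Im w)\<^sup>2 + s\<^sup>2))\<^sup>2))) (at w)"
    by (auto intro!: derivative_eq_intros simp: fun_eq_iff power2_eq_square)
  then have "((\<lambda>w. complex_of_real (inverse ((Re w)\<^sup>2 + (Im w)\<^sup>2 + s\<^sup>2))) has_derivative
      (\<lambda>h. complex_of_real (- (2 * (Re w * Re h + Im w * Im h) * (inverse ((Re w)\<^sup>2 + (Im w)\<^sup>2 + s\<^sup>2))\<^sup>2)))) (at w)"
    by (rule bounded_linear.has_derivative[OF bounded_linear_of_real])
  from has_derivative_mult[OF bounded_linear.has_derivative[OF bounded_linear_cnj has_derivative_ident] this]
  show ?thesis unfolding cauchy_reg_def[abs_def] cauchy_reg'_def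
    by (rule has_derivative_eq_rhs) (simp only: fun_eq_iff of_real_minus mult_minus_right add.commute diff_conv_add_uminus mult.commute simp_thms)
qed

text \<open>The first bound enters the Lipschitz and integrability estimates for fixed
  \<open>s\<close>; the second is free of \<open>s\<close> and serves as majorant in the
  limit.\<close>

lemma cauchy_reg_bound:
  assumes "s > 0" shows "norm (cauchy_reg s w) \<le> 1 / s" "norm (cauchy_reg s w) \<le> inverse (norm w)"
proof -
  let ?d = "(cmod w)\<^sup>2 + s\<^sup>2"
  have d: "?d > 0" using assms by (simp add: add_nonneg_pos)
  have eq: "norm (cauchy_reg s w) = norm w / ?d"
    unfolding cauchy_reg_def cmod_power2[symmetric] norm_mult norm_of_real complex_mod_cnj
    using d by (simp add: divide_inverse)
  have "0 \<le> norm w * s" using assms by simp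
  then have "norm w * s \<le> ?d" using sum_squares_bound[of "norm w" s] by linarith
  then show "norm (cauchy_reg s w) \<le> 1 / s" unfolding eq using d assms by (simp add: field_simps)
  show "norm (cauchy_reg s w) \<le> inverse (norm w)" unfolding eq
    using d by (cases "w = 0") (simp_all add: field_simps power2_eq_square)
qed

lemma cauchy_reg'_bound:
  assumes "s > 0" shows "norm (cauchy_reg' s w h) \<le> 3 / s\<^sup>2 * norm h"
proof -
  let ?d = "(cmod w)\<^sup>2 + s\<^sup>2"
  have d: "?d > 0" using assms by (simp add: add_nonneg_pos)
  have i: "0 \<le> inverse ?d" "inverse ?d \<le> 1 / s\<^sup>2" using d assms by (auto simp: field_simps)
  have "norm (cauchy_reg' s w h) \<le> norm h * inverse ?d + norm w * (2 * \<bar>Re w * Re h + Im w * Im h\<bar> * (inverse ?d)\<^sup>2)"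
    unfolding cauchy_reg'_def cmod_power2[symmetric]
    by (rule order_trans[OF norm_triangle_ineq4]) (use i in \<open>simp only: norm_mult norm_of_real abs_mult complex_mod_cnj abs_numeral abs_power2 abs_of_nonneg order_refl\<close>)
  also have "\<dots> \<le> norm h * inverse ?d + norm w * (2 * (norm w * norm h) * (inverse ?d)\<^sup>2)"
    using Re_Im_le[of w h] by (intro add_mono mult_left_mono mult_right_mono) auto
  also have "\<dots> = norm h * inverse ?d * (1 + 2 * ((cmod w)\<^sup>2 * inverse ?d))" by (simp add: power2_eq_square algebra_simps)
  also have "\<dots> \<le> norm h * (1 / s\<^sup>2) * (1 + 2 * 1)"
    using i d by (intro mult_mono mult_left_mono add_mono) (auto simp: field_simps)
  finally show ?thesis by (simp add: mult.commute)
qed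

text \<open>With \<open>w = s v\<close> the right-hand side is \<open>2 / s\<^sup>2\<close> times
  \<open>1 / (|v|\<^sup>2 + 1)\<^sup>2\<close>: a mass independent of \<open>s\<close> that
  concentrates at \<open>0\<close>.\<close>

lemma cauchy_reg'_dbar:
  assumes "s > 0"
  shows "cauchy_reg' s w 1 + \<i> * cauchy_reg' s w \<i> = of_real (2 * s\<^sup>2 / ((cmod w)\<^sup>2 + s\<^sup>2)\<^sup>2)"
proof -
  let ?d = "(Re w)\<^sup>2 + (Im w)\<^sup>2 + s\<^sup>2"
  have d: "?d > 0" using assms by (metis add_nonneg_pos sum_power2_ge_zero zero_less_power)
  have "cauchy_reg' s w 1 + \<i> * cauchy_reg' s w \<i> = of_real (2 * inverse ?d - 2 * ((Re w)\<^sup>2 + (Im w)\<^sup>2) * (inverse ?d)\<^sup>2)"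
    by (simp add: cauchy_reg'_def complex_eq_iff power2_eq_square algebra_simps)
  also have "2 * inverse ?d - 2 * ((Re w)\<^sup>2 + (Im w)\<^sup>2) * (inverse ?d)\<^sup>2 = 2 * s\<^sup>2 / ?d\<^sup>2"
  proof -
    have "2 * inverse D = 2 * D * (inverse D)\<^sup>2" if "D > 0" for D :: real
      using that by (simp add: power2_eq_square)
    from this[OF d] show ?thesis by (simp add: algebra_simps divide_inverse power_inverse)
  qed
  finally show ?thesis by (simp add: cmod_power2)
qed

text \<open>Stokes' formula with compact support: the d-bar derivative of
  \<open>bar_cut w * cauchy_reg s (z - w)\<close> in \<open>w\<close> has integral zero, so the two
  halves of the product rule balance. The substitution \<open>w = z + s v\<close> then moves the
  parameter into the argument of \<open>bar_cut\<close>.\<close>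

lemma cauchy_reg_integral:
  assumes s: "s > 0"
  shows "(\<integral>w. of_real (chi w) * cauchy_reg s (z - w) \<partial>lborel)
       = (\<integral>v. bar_cut (z + s *\<^sub>R v) * of_real (1 / ((cmod v)\<^sup>2 + 1)\<^sup>2) \<partial>lborel)"
proof -
  define F where "F w = bar_cut w * cauchy_reg s (z - w)" for w
  define F' where "F' w h = bar_cut w * (- cauchy_reg' s (z - w) h) + bar_cut' w h * cauchy_reg s (z - w)" for w h
  have der: "(F has_derivative F' w) (at w)" for w
  proof -
    have "((\<lambda>w. cauchy_reg s (z - w)) has_derivative (\<lambda>h. cauchy_reg' s (z - w) (- h))) (at w)"
      by (rule has_derivative_compose[OF _ cauchy_reg_derivative[OF s]]) (auto intro!: derivative_eq_intros)
    moreover have "cauchy_reg' s (z - w) (- h) = - cauchy_reg' s (z - w) h" for h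
      by (simp add: cauchy_reg'_def complex_eq_iff algebra_simps)
    ultimately show ?thesis unfolding F_def[abs_def] F'_def
      by (intro has_derivative_mult bar_cut_derivative) simp
  qed
  have L: "norm (F' w h) \<le> (2 * (3 / s\<^sup>2) + 17 / s) * norm h" for w h
  proof -
    have "norm (F' w h) \<le> norm (bar_cut w) * norm (cauchy_reg' s (z - w) h) + norm (bar_cut' w h) * norm (cauchy_reg s (z - w))"
      unfolding F'_def by (rule order_trans[OF norm_triangle_ineq]) (simp add: norm_mult)
    also have "\<dots> \<le> 2 * (3 / s\<^sup>2 * norm h) + 17 * norm h * (1 / s)"
      using s by (intro add_mono mult_mono bar_cut_bound bar_cut'_bound cauchy_reg_bound cauchy_reg'_bound) auto
    finally show ?thesis by (simp add: algebra_simps)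
  qed
  have supp: "2 \<le> norm w \<Longrightarrow> F w = 0" for w by (simp add: F_def bar_cut_outer)
  note Z = lborel_integral_derivative_zero[where F = F and F' = F', OF der L supp]
  have [measurable]: "cauchy_reg s \<in> borel_measurable borel"
    using cauchy_reg_derivative[OF s]
    by (intro borel_measurable_continuous_onI) (meson continuous_at_imp_continuous_on has_derivative_continuous)
  have dbar: "F' w 1 + \<i> * F' w \<i> = 2 * (of_real (chi w) * cauchy_reg s (z - w)) - 2 * (bar_cut w * of_real (s\<^sup>2 / ((cmod (z - w))\<^sup>2 + s\<^sup>2)\<^sup>2))" for w
  proof -
    have "F' w 1 + \<i> * F' w \<i> = - bar_cut w * (cauchy_reg' s (z - w) 1 + \<i> * cauchy_reg' s (z - w) \<i>)
        + (bar_cut' w 1 + \<i> * bar_cut' w \<i>) * cauchy_reg s (z - w)"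
      by (simp add: F'_def algebra_simps)
    then show ?thesis unfolding cauchy_reg'_dbar[OF s] bar_cut'_dbar by simp
  qed
  have int1: "integrable lborel (\<lambda>w. of_real (chi w) * cauchy_reg s (z - w))"
  proof (rule Bochner_Integration.integrable_bound[where f = "\<lambda>w. (9 / s) * indicator (cball (0::complex) 2) w"])
    show "integrable lborel (\<lambda>w. (9 / s) * indicator (cball (0::complex) 2) w :: real)"
      by (intro integrable_mult_right integrable_real_indicator) (auto intro!: emeasure_bounded_finite[unfolded infinity_ennreal_def])
    show "AE w in lborel. norm (of_real (chi w) * cauchy_reg s (z - w)) \<le> norm ((9 / s) * indicator (cball (0::complex) 2) w :: real)"
    proof (intro AE_I2)
      fix w
      have "norm (of_real (chi w) * cauchy_reg s (z - w)) \<le> 9 * (1 / s)"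
        unfolding norm_mult norm_of_real by (intro mult_mono chi_bound cauchy_reg_bound s) auto
      then show "norm (of_real (chi w) * cauchy_reg s (z - w)) \<le> norm ((9 / s) * indicator (cball (0::complex) 2) w :: real)"
        using s by (cases "norm w \<le> 2") (auto simp: chi_outer)
    qed
  qed measurable
  have "(\<integral>w. F' w 1 + \<i> * F' w \<i> \<partial>lborel) = 0"
    using Z[where e = 1] Z[where e = "\<i>"] by simp
  moreover have "integrable lborel (\<lambda>w. F' w 1 + \<i> * F' w \<i>)" using Z(1) by simp
  then have int2: "integrable lborel (\<lambda>w. 2 * (of_real (chi w) * cauchy_reg s (z - w)) - (F' w 1 + \<i> * F' w \<i>))"
    using int1 by simp
  ultimately have "(\<integral>w. 2 * (of_real (chi w) * cauchy_reg s (z - w)) \<partial>lborel) =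
     (\<integral>w. 2 * (of_real (chi w) * cauchy_reg s (z - w)) - (F' w 1 + \<i> * F' w \<i>) \<partial>lborel)"
    using int1 \<open>integrable lborel (\<lambda>w. F' w 1 + \<i> * F' w \<i>)\<close> by simp
  also have "\<dots> = (\<integral>w. 2 * (bar_cut w * of_real (s\<^sup>2 / ((cmod (z - w))\<^sup>2 + s\<^sup>2)\<^sup>2)) \<partial>lborel)"
    by (simp add: dbar)
  finally have "(\<integral>w. of_real (chi w) * cauchy_reg s (z - w) \<partial>lborel) = (\<integral>w. bar_cut w * of_real (s\<^sup>2 / ((cmod (z - w))\<^sup>2 + s\<^sup>2)\<^sup>2) \<partial>lborel)"
    unfolding integral_mult_right_zero by (simp only: mult_cancel_left) simp
  also have "\<dots> = s\<^sup>2 *\<^sub>R (\<integral>v. bar_cut (z + s *\<^sub>R v) * of_real (s\<^sup>2 / ((cmod (z - (z + s *\<^sub>R v)))\<^sup>2 + s\<^sup>2)\<^sup>2) \<partial>lborel)"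
    using s by (subst lborel_integral_affine[of _ s z]) (auto simp del: of_real_divide)
  also have "\<dots> = (\<integral>v. bar_cut (z + s *\<^sub>R v) * of_real (s\<^sup>2 * (s\<^sup>2 / ((cmod (z - (z + s *\<^sub>R v)))\<^sup>2 + s\<^sup>2)\<^sup>2)) \<partial>lborel)"
    by (subst integral_scaleR_right[symmetric]) (simp add: scaleR_conv_of_real algebra_simps)
  also have "\<dots> = (\<integral>v. bar_cut (z + s *\<^sub>R v) * of_real (1 / ((cmod v)\<^sup>2 + 1)\<^sup>2) \<partial>lborel)"
  proof -
    have "s\<^sup>2 * (s\<^sup>2 / ((cmod (z - (z + s *\<^sub>R v)))\<^sup>2 + s\<^sup>2)\<^sup>2) = 1 / ((cmod v)\<^sup>2 + 1)\<^sup>2" for v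
    proof -
      have "(cmod (z - (z + s *\<^sub>R v)))\<^sup>2 + s\<^sup>2 = s\<^sup>2 * ((cmod v)\<^sup>2 + 1)" by (simp add: algebra_simps power_mult_distrib)
      then show ?thesis using s by (simp add: power_mult_distrib power2_eq_square)
    qed
    then show ?thesis by simp
  qed
  finally show ?thesis .
qed

text \<open>The value is pi. Since \<open>dbar_inv\<close> divides by this constant, it can stay
  symbolic, and positivity suffices.\<close>

definition cauchy_const :: real where
  "cauchy_const = (\<integral>v. 1 / ((cmod v)\<^sup>2 + 1)\<^sup>2 \<partial>lborel)"

text \<open>The majorant is 1 on the unit ball and \<open>|w|\<close> to the power -4 outside
  it.\<close>

lemma cauchy_const_integrable: "integrable lborel (\<lambda>v. 1 / ((cmod v)\<^sup>2 + 1)\<^sup>2)"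
proof -
  obtain C where C: "C > 0" "\<And>r (a::complex). r > 0 \<Longrightarrow> (\<integral>\<^sup>+w. indicator (- ball a r) w * ennreal (norm (w - a) powr -4) \<partial>lborel)
        \<le> ennreal (C * r powr (2 - 4))"
    using nn_integral_powr_far[of 4] by auto
  show ?thesis
  proof (rule integrable_norm_bound(1)[where g = "\<lambda>w. indicator (ball 0 1) w + indicator (- ball 0 1) w * ennreal (norm (w - 0) powr -4)" and C = "4 + C"])
    have "1 / ((cmod w)\<^sup>2 + 1)\<^sup>2 \<le> cmod w powr -4" if "1 \<le> norm w" for w
    proof -
      have "norm w ^ 4 = ((cmod w)\<^sup>2)\<^sup>2" by simp
      also have "\<dots> \<le> ((cmod w)\<^sup>2 + 1)\<^sup>2" by (intro power_mono) auto
      finally have "1 / ((cmod w)\<^sup>2 + 1)\<^sup>2 \<le> 1 / norm w ^ 4"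
        by (intro frac_le) (use that in auto)
      then show ?thesis using that by (simp add: powr_minus_divide)
    qed
    then show "AE w in lborel. ennreal (norm (1 / ((cmod w)\<^sup>2 + 1)\<^sup>2)) \<le> indicator (ball 0 1) w + indicator (- ball 0 1) w * ennreal (norm (w - 0) powr -4)"
      by (auto simp: indicator_def divide_le_eq_1 add_nonneg_pos intro!: ennreal_leI)
    have "(\<integral>\<^sup>+w. indicator (ball 0 1) w + indicator (- ball 0 1) w * ennreal (norm (w - 0::complex) powr -4) \<partial>lborel)
      = emeasure lborel (ball (0::complex) 1) + (\<integral>\<^sup>+w. indicator (- ball (0::complex) 1) w * ennreal (norm (w - 0) powr -4) \<partial>lborel)"
      by (subst nn_integral_add) (auto intro!: borel_measurable_times_ennreal borel_measurable_indicator)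
    also have "\<dots> \<le> ennreal (4 * 1\<^sup>2) + ennreal (C * 1 powr (2 - 4))"
      by (intro add_mono emeasure_ball_complex_le C) auto
    also have "\<dots> = ennreal (4 + C)" using C(1) by (subst ennreal_plus) auto
    finally show "(\<integral>\<^sup>+w. indicator (ball 0 1) w + indicator (- ball 0 1) w * ennreal (norm (w - 0::complex) powr -4) \<partial>lborel) \<le> ennreal (4 + C)" .
  qed (use C in auto)
qed

text \<open>The integrand is at least \<open>1/4\<close> on the unit ball, which gives the lower
  bound pi/4.\<close>

lemma cauchy_const_pos: "cauchy_const > 0"
proof -
  have "(\<integral>v. 1/4 * indicator (ball (0::complex) 1) v \<partial>lborel) \<le> cauchy_const"
    unfolding cauchy_const_def
  proof (rule integral_mono[OF _ cauchy_const_integrable])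
    show "1/4 * indicator (ball 0 1) v \<le> 1 / ((cmod v)\<^sup>2 + 1)\<^sup>2" for v
    proof (cases "norm v < 1")
      case True
      then have "((cmod v)\<^sup>2 + 1)\<^sup>2 \<le> 2\<^sup>2" by (intro power_mono) (auto simp: power_le_one)
      moreover have "0 < ((cmod v)\<^sup>2 + 1)\<^sup>2" by (intro zero_less_power add_nonneg_pos) auto
      ultimately show ?thesis using True by (simp add: field_simps)
    qed auto
  qed (intro integrable_mult_right integrable_real_indicator, auto intro!: emeasure_bounded_finite[unfolded infinity_ennreal_def])
  moreover have "(\<integral>v. 1/4 * indicator (ball (0::complex) 1) v \<partial>lborel) = pi / 4"
    by (simp add: content_ball unit_ball_vol_2)
  ultimately show ?thesis using pi_gt_zero by linarith
qed

lemma chi_cauchy_integrable: "integrable lborel (\<lambda>w. chi w / norm (z - w))"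
proof -
  obtain C where C: "C > 0" "\<And>r (a::complex). r > 0 \<Longrightarrow> (\<integral>\<^sup>+w. indicator (ball a r) w * ennreal (norm (w - a) powr -1) \<partial>lborel)
        \<le> ennreal (C * r powr (2 - 1))"
    using nn_integral_powr_near[of 1] by auto
  let ?r = "norm z + 3"
  have r: "?r > 0" using norm_ge_zero[of z] by linarith
  show ?thesis
  proof (rule integrable_norm_bound(1)[where g = "\<lambda>w. ennreal 9 * (indicator (ball z ?r) w * ennreal (norm (w - z) powr -1))" and C = "9 * (C * ?r powr (2 - 1))"])
    show "AE w in lborel. ennreal (norm (chi w / norm (z - w))) \<le> ennreal 9 * (indicator (ball z ?r) w * ennreal (norm (w - z) powr -1))"
    proof (intro AE_I2)
      fix w
      show "ennreal (norm (chi w / norm (z - w))) \<le> ennreal 9 * (indicator (ball z ?r) w * ennreal (norm (w - z) powr -1))"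
      proof (cases "norm w < 2")
        case True
        then have "w \<in> ball z ?r" using norm_triangle_ineq4[of z w] by (simp add: dist_norm)
        moreover have "norm (chi w / norm (z - w)) \<le> 9 * (norm (w - z) powr -1)"
          using chi_bound[of w] by (simp add: powr_minus_divide norm_minus_commute divide_right_mono)
        then have "ennreal (norm (chi w / norm (z - w))) \<le> ennreal 9 * ennreal (norm (w - z) powr -1)"
          by (subst ennreal_mult'[symmetric]) (auto intro: ennreal_leI)
        ultimately show ?thesis by simp
      qed (simp add: chi_outer)
    qed
    have "(\<integral>\<^sup>+w. ennreal 9 * (indicator (ball z ?r) w * ennreal (norm (w - z) powr -1)) \<partial>lborel) \<le> ennreal 9 * ennreal (C * ?r powr (2 - 1))"
    proof (subst nn_integral_cmult)
      show "(\<lambda>w. indicator (ball z ?r) w * ennreal (norm (w - z) powr -1)) \<in> borel_measurable lborel"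
        by (intro borel_measurable_times_ennreal borel_measurable_indicator) auto
    qed (rule mult_left_mono[OF C(2)[OF r]], simp)
    then show "(\<integral>\<^sup>+w. ennreal 9 * (indicator (ball z ?r) w * ennreal (norm (w - z) powr -1)) \<partial>lborel) \<le> ennreal (9 * (C * ?r powr (2 - 1)))"
      by (simp add: ennreal_mult' del: ennreal_numeral)
  qed (use C r in auto)
qed

text \<open>The limit \<open>s \<longlonglongrightarrow> 0\<close> in
  \<open>cauchy_reg_integral\<close>. On the left the majorant is \<open>|chi w| / |z - w|\<close>,
  on the right \<open>2 / (|v|\<^sup>2 + 1)\<^sup>2\<close>; the limits are the Cauchy transform of
  \<open>chi\<close> and \<open>bar_cut z\<close> times the total mass.\<close>

theorem chi_cauchy_integral:
  "(\<integral>w. of_real (chi w) / (z - w) \<partial>lborel) = of_real cauchy_const * bar_cut z"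
proof -
  define s where "s n = inverse (real (Suc n))" for n
  have s: "s n > 0" for n by (simp add: s_def)
  have slim: "s \<longlonglongrightarrow> 0" unfolding s_def[abs_def] by (rule LIMSEQ_inverse_real_of_nat)
  have [measurable]: "cauchy_reg (s n) \<in> borel_measurable borel" for n
    using cauchy_reg_derivative[OF s]
    by (intro borel_measurable_continuous_onI) (meson continuous_at_imp_continuous_on has_derivative_continuous)
  have "(\<lambda>n. \<integral>w. of_real (chi w) * cauchy_reg (s n) (z - w) \<partial>lborel) \<longlonglongrightarrow> (\<integral>w. of_real (chi w) / (z - w) \<partial>lborel)"
  proof (rule integral_dominated_convergence[where w = "\<lambda>w. norm (chi w / norm (z - w))"])
    show "AE w in lborel. (\<lambda>n. of_real (chi w) * cauchy_reg (s n) (z - w)) \<longlonglongrightarrow> of_real (chi w) / (z - w)"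
      using AE_lborel_singleton[of z]
    proof eventually_elim
      case (elim w)
      let ?a = "z - w"
      have a: "(Re ?a)\<^sup>2 + (Im ?a)\<^sup>2 \<noteq> 0" using elim by (metis cmod_power2 right_minus_eq norm_eq_zero power_eq_0_iff)
      have "(\<lambda>n. cauchy_reg (s n) ?a) \<longlonglongrightarrow> cnj ?a * of_real (inverse ((Re ?a)\<^sup>2 + (Im ?a)\<^sup>2 + 0\<^sup>2))"
        unfolding cauchy_reg_def by (intro tendsto_intros slim) (use a in auto)
      moreover have "cnj ?a * of_real (inverse ((Re ?a)\<^sup>2 + (Im ?a)\<^sup>2 + 0\<^sup>2)) = 1 / ?a"
      proof -
        have "?a * (cnj ?a * of_real (inverse ((Re ?a)\<^sup>2 + (Im ?a)\<^sup>2 + 0\<^sup>2))) = of_real (((Re ?a)\<^sup>2 + (Im ?a)\<^sup>2) * inverse ((Re ?a)\<^sup>2 + (Im ?a)\<^sup>2))"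
          unfolding of_real_mult complex_mult_cnj[symmetric] by (simp only: mult.assoc zero_power2 add_0_right)
        also have "\<dots> = 1" by (subst right_inverse[OF a]) (rule of_real_1)
        finally show ?thesis using elim by (simp only: eq_divide_eq mult.commute) simp
      qed
      ultimately have "(\<lambda>n. of_real (chi w) * cauchy_reg (s n) ?a) \<longlonglongrightarrow> of_real (chi w) * (1 / ?a)"
        by (intro tendsto_mult_left) simp
      then show ?case by simp
    qed
    show "AE w in lborel. norm (of_real (chi w) * cauchy_reg (s n) (z - w)) \<le> norm (chi w / norm (z - w))" for n
    proof (intro AE_I2)
      fix w
      have "\<bar>chi w\<bar> * norm (cauchy_reg (s n) (z - w)) \<le> \<bar>chi w\<bar> * inverse (norm (z - w))"
        by (rule mult_left_mono[OF cauchy_reg_bound(2)[OF s]]) simp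
      then show "norm (of_real (chi w) * cauchy_reg (s n) (z - w)) \<le> norm (chi w / norm (z - w))"
        by (simp add: norm_mult abs_mult divide_inverse)
    qed
    show "integrable lborel (\<lambda>w. norm (chi w / norm (z - w)))" using chi_cauchy_integrable by (rule integrable_norm)
  qed measurable
  moreover have "(\<lambda>n. \<integral>v. bar_cut (z + s n *\<^sub>R v) * of_real (1 / ((cmod v)\<^sup>2 + 1)\<^sup>2) \<partial>lborel) \<longlonglongrightarrow>
     (\<integral>v. bar_cut z * of_real (1 / ((cmod v)\<^sup>2 + 1)\<^sup>2) \<partial>lborel)"
  proof (rule integral_dominated_convergence[where w = "\<lambda>v. 2 * (1 / ((cmod v)\<^sup>2 + 1)\<^sup>2)"])
    show "AE v in lborel. (\<lambda>n. bar_cut (z + s n *\<^sub>R v) * of_real (1 / ((cmod v)\<^sup>2 + 1)\<^sup>2)) \<longlonglongrightarrow> bar_cut z * of_real (1 / ((cmod v)\<^sup>2 + 1)\<^sup>2)"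
    proof (intro AE_I2 tendsto_mult_right)
      fix v
      have "(\<lambda>n. z + s n *\<^sub>R v) \<longlonglongrightarrow> z + 0 *\<^sub>R v" by (intro tendsto_intros slim)
      then show "(\<lambda>n. bar_cut (z + s n *\<^sub>R v)) \<longlonglongrightarrow> bar_cut z"
        using continuous_bar_cut[of UNIV] by (intro isCont_tendsto_compose[of z bar_cut]) (auto simp: continuous_on_eq_continuous_at)
    qed
    show "AE v in lborel. norm (bar_cut (z + s n *\<^sub>R v) * of_real (1 / ((cmod v)\<^sup>2 + 1)\<^sup>2)) \<le> 2 * (1 / ((cmod v)\<^sup>2 + 1)\<^sup>2)" for n
      unfolding norm_mult norm_of_real by (intro AE_I2 mult_mono bar_cut_bound) auto
    show "integrable lborel (\<lambda>v. 2 * (1 / ((cmod v)\<^sup>2 + 1)\<^sup>2))" by (intro integrable_mult_right cauchy_const_integrable)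
  qed measurable
  ultimately have "(\<integral>w. of_real (chi w) / (z - w) \<partial>lborel) = (\<integral>v. bar_cut z * of_real (1 / ((cmod v)\<^sup>2 + 1)\<^sup>2) \<partial>lborel)"
    unfolding cauchy_reg_integral[OF s] by (rule LIMSEQ_unique)
  also have "\<dots> = bar_cut z * of_real cauchy_const"
    unfolding cauchy_const_def by (subst integral_mult_right_zero, subst integral_complex_of_real) (rule refl)
  finally show ?thesis by simp
qed

section \<open>Kernel estimates\<close>

text \<open>Truncated powers of the distance, with value \<open>0\<close> at the centre because
  \<open>0 powr x = 0\<close>. Comparisons with the singular kernel are therefore made off the
  centre, that is, almost everywhere.\<close>

definition near_kernel :: "real \<Rightarrow> complex \<Rightarrow> real \<Rightarrow> complex \<Rightarrow> real" where
  "near_kernel \<beta> a r w = indicator (ball a r) w * norm (w - a) powr -\<beta>"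
definition far_kernel :: "real \<Rightarrow> complex \<Rightarrow> real \<Rightarrow> complex \<Rightarrow> real" where
  "far_kernel \<beta> a r w = indicator (- ball a r) w * norm (w - a) powr -\<beta>"

lemma near_far_nonneg: "0 \<le> near_kernel \<beta> a r w" "0 \<le> far_kernel \<beta> a r w"
  by (auto simp: near_kernel_def far_kernel_def)

lemma near_far_measurable [measurable]:
  "near_kernel \<beta> a r \<in> borel_measurable borel" "far_kernel \<beta> a r \<in> borel_measurable borel"
  unfolding near_kernel_def far_kernel_def by (auto intro!: borel_measurable_times borel_measurable_indicator)

lemma integrable_nn_integral_le:
  fixes f :: "'a \<Rightarrow> real"
  assumes "f \<in> borel_measurable M" "\<And>x. 0 \<le> f x" "(\<integral>\<^sup>+x. ennreal (f x) \<partial>M) \<le> ennreal C" "0 \<le> C"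
  shows "integrable M f" "integral\<^sup>L M f \<le> C"
  using integrable_norm_bound[of f M "\<lambda>x. ennreal (f x)" C] assms by auto

lemma near_kernel_integral:
  assumes "0 \<le> \<beta>" "\<beta> < 2"
  obtains C where "C > 0" "\<And>r a. r > 0 \<Longrightarrow> integrable lborel (near_kernel \<beta> a r)"
    "\<And>r a. r > 0 \<Longrightarrow> integral\<^sup>L lborel (near_kernel \<beta> a r) \<le> C * r powr (2 - \<beta>)"
proof -
  obtain C where C: "C > 0" "\<And>r (a::complex). r > 0 \<Longrightarrow> (\<integral>\<^sup>+w. indicator (ball a r) w * ennreal (norm (w - a) powr -\<beta>) \<partial>lborel)
        \<le> ennreal (C * r powr (2 - \<beta>))"
    using nn_integral_powr_near[OF assms(2,1)] by metis
  have eq: "ennreal (near_kernel \<beta> a r w) = indicator (ball a r) w * ennreal (norm (w - a) powr -\<beta>)" for a r w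
    by (auto simp: near_kernel_def indicator_def)
  show ?thesis
    by (rule that[OF C(1)]; rule integrable_nn_integral_le)
       (use C(1) C(2)[folded eq] in \<open>auto simp: near_far_nonneg\<close>)
qed

lemma far_kernel_integral:
  assumes "2 < \<beta>"
  obtains C where "C > 0" "\<And>r a. r > 0 \<Longrightarrow> integrable lborel (far_kernel \<beta> a r)"
    "\<And>r a. r > 0 \<Longrightarrow> integral\<^sup>L lborel (far_kernel \<beta> a r) \<le> C * r powr (2 - \<beta>)"
proof -
  obtain C where C: "C > 0" "\<And>r (a::complex). r > 0 \<Longrightarrow> (\<integral>\<^sup>+w. indicator (- ball a r) w * ennreal (norm (w - a) powr -\<beta>) \<partial>lborel)
        \<le> ennreal (C * r powr (2 - \<beta>))"
    using nn_integral_powr_far[OF assms] by metis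
  have eq: "ennreal (far_kernel \<beta> a r w) = indicator (- ball a r) w * ennreal (norm (w - a) powr -\<beta>)" for a r w
    by (auto simp: far_kernel_def indicator_def)
  show ?thesis
    by (rule that[OF C(1)]; rule integrable_nn_integral_le)
       (use C(1) C(2)[folded eq] in \<open>auto simp: near_far_nonneg\<close>)
qed

section \<open>Pointwise bounds for the Cauchy kernel on the support of the cutoff\<close>

lemma chi_support: "chi w \<noteq> 0 \<Longrightarrow> norm z \<le> 1 \<Longrightarrow> w \<in> ball z 3"
  using chi_outer[of w] norm_triangle_ineq4[of z w] by (force simp: dist_norm)

text \<open>For \<open>z\<close> in the unit disc the support of \<open>chi\<close> lies within
  distance 3 of \<open>z\<close>, and 9 bounds \<open>chi\<close>. A bound by a power of the
  distance thus becomes a bound by a truncated kernel.\<close>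

lemma chi_over_bound:
  assumes "norm z \<le> 1" "0 \<le> K" "w \<noteq> z \<Longrightarrow> X \<le> K * norm (w - z) powr -\<beta>" "w \<noteq> z"
  shows "\<bar>chi w\<bar> * X \<le> 9 * K * near_kernel \<beta> z 3 w"
proof (cases "chi w = 0")
  case True
  then show ?thesis using near_far_nonneg assms by simp
next
  case False
  then have "w \<in> ball z 3" by (rule chi_support) fact
  moreover have "\<bar>chi w\<bar> * X \<le> \<bar>chi w\<bar> * (K * norm (w - z) powr -\<beta>)"
    using assms by (intro mult_left_mono) auto
  moreover have "\<bar>chi w\<bar> * (K * norm (w - z) powr -\<beta>) \<le> 9 * (K * norm (w - z) powr -\<beta>)"
    using assms by (intro mult_right_mono chi_bound) auto
  ultimately show ?thesis by (simp add: near_kernel_def)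
qed

text \<open>Interpolation: \<open>|a - b|\<close> is split into its powers \<alpha> and 1 -
  \<alpha>, and the latter is at most twice the power 1 - \<alpha> of the larger modulus. Against
  the inverse of the larger modulus this leaves its power -\<alpha>, which the smaller modulus
  dominates.\<close>

lemma inverse_diff_bound:
  fixes a b :: complex
  assumes \<alpha>: "0 < \<alpha>" "\<alpha> < 1" and nz: "a \<noteq> 0" "b \<noteq> 0"
  shows "norm (1 / a - 1 / b) \<le> 2 * norm (a - b) powr \<alpha> * (norm a powr -(1 + \<alpha>) + norm b powr -(1 + \<alpha>))"
proof -
  have *: "norm (1 / a - 1 / b) \<le> 2 * norm (a - b) powr \<alpha> * (norm a powr -(1 + \<alpha>))"
    if le: "norm a \<le> norm b" and nz: "a \<noteq> 0" "b \<noteq> 0" for a b :: complex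
  proof -
    have "norm (a - b) = norm (a - b) powr \<alpha> * norm (a - b) powr (1 - \<alpha>)"
      by (cases "a = b") (simp_all flip: powr_add)
    also have "\<dots> \<le> norm (a - b) powr \<alpha> * (2 * norm b) powr (1 - \<alpha>)"
      using norm_triangle_ineq4[of a b] le \<alpha> by (intro mult_left_mono powr_mono2) auto
    also have "(2 * norm b) powr (1 - \<alpha>) \<le> 2 * norm b powr (1 - \<alpha>)"
    proof -
      have "(2::real) powr (1 - \<alpha>) \<le> 2 powr 1" using \<alpha> by (intro powr_mono) auto
      then show ?thesis by (simp add: powr_mult mult_right_mono)
    qed
    finally have d: "norm (a - b) \<le> 2 * norm (a - b) powr \<alpha> * norm b powr (1 - \<alpha>)" by (simp add: mult_left_mono)
    have "norm (1 / a - 1 / b) = norm (a - b) * inverse (norm a) * inverse (norm b)"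
    proof -
      have "1 / a - 1 / b = (b - a) / (a * b)" using nz by (simp add: field_simps)
      then show ?thesis by (simp add: norm_mult norm_divide norm_inverse divide_inverse norm_minus_commute)
    qed
    also have "\<dots> \<le> (2 * norm (a - b) powr \<alpha> * norm b powr (1 - \<alpha>)) * inverse (norm a) * inverse (norm b)"
      using d by (intro mult_right_mono) auto
    also have "\<dots> = (2 * norm (a - b) powr \<alpha> * inverse (norm a)) * norm b powr -\<alpha>"
      using nz by (simp add: powr_diff powr_minus divide_inverse)
    also have "\<dots> \<le> (2 * norm (a - b) powr \<alpha> * inverse (norm a)) * norm a powr -\<alpha>"
      using le nz \<alpha> by (intro mult_left_mono powr_mono2') auto
    also have "\<dots> = 2 * norm (a - b) powr \<alpha> * norm a powr -(1 + \<alpha>)"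
      using nz by (simp add: powr_diff powr_minus divide_inverse)
    finally show ?thesis .
  qed
  show ?thesis
  proof (cases "norm a \<le> norm b")
    case True
    have "norm (1 / a - 1 / b) \<le> 2 * norm (a - b) powr \<alpha> * (norm a powr -(1 + \<alpha>))"
      by (rule *) (use True nz in auto)
    also have "\<dots> \<le> 2 * norm (a - b) powr \<alpha> * (norm a powr -(1 + \<alpha>) + norm b powr -(1 + \<alpha>))"
      by (intro mult_left_mono) auto
    finally show ?thesis .
  next
    case False
    have "norm (1 / b - 1 / a) \<le> 2 * norm (b - a) powr \<alpha> * (norm b powr -(1 + \<alpha>))"
      by (rule *) (use False nz in auto)
    also have "\<dots> \<le> 2 * norm (b - a) powr \<alpha> * (norm a powr -(1 + \<alpha>) + norm b powr -(1 + \<alpha>))"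
      by (intro mult_left_mono) auto
    finally show ?thesis by (simp add: norm_minus_commute)
  qed
qed

text \<open>The Taylor remainder is exactly
  \<open>h\<^sup>2 / ((z - w)\<^sup>2 (z + h - w))\<close>. The factor \<open>|w - z|\<close> to the
  power \<alpha> will come from the Hoelder continuity of the data; it makes each of the three
  majorants integrate to a multiple of \<open>|h|\<close> to the power 1 + \<alpha>.\<close>

lemma inverse_taylor_bound:
  fixes z h w :: complex
  assumes \<alpha>: "0 < \<alpha>" "\<alpha> < 1" and nz: "w \<noteq> z" "w \<noteq> z + h" "h \<noteq> 0"
  shows "norm (1 / (z + h - w) - 1 / (z - w) + h / (z - w)\<^sup>2) * norm (w - z) powr \<alpha>
     \<le> 4 * norm h powr \<alpha> * near_kernel 1 (z + h) (3 * norm h) w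
       + 2 * norm h * near_kernel (2 - \<alpha>) z (2 * norm h) w
       + 2 * (norm h)\<^sup>2 * far_kernel (3 - \<alpha>) z (2 * norm h) w" (is "?L \<le> ?R1 + ?R2 + ?R3")
proof -
  let ?a = "norm (w - z)" and ?b = "norm (w - (z + h))" and ?h = "norm h"
  have pos: "?a > 0" "?b > 0" "?h > 0" using nz by auto
  have R: "0 \<le> ?R1" "0 \<le> ?R2" "0 \<le> ?R3" by (auto intro!: mult_nonneg_nonneg near_far_nonneg)
  have "1 / (z + h - w) - 1 / (z - w) + h / (z - w)\<^sup>2 = h\<^sup>2 / ((z - w)\<^sup>2 * (z + h - w))"
  proof -
    have "z - w \<noteq> 0" "z + h - w \<noteq> 0" using nz by auto
    then show ?thesis by (simp add: divide_simps) (simp add: power2_eq_square algebra_simps)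
  qed
  then have "?L = ?h\<^sup>2 * ?a powr \<alpha> / (?a\<^sup>2 * ?b)"
    by (simp add: norm_divide norm_mult norm_power norm_minus_commute)
  also have "\<dots> = ?h\<^sup>2 * ?a powr (\<alpha> - 2) / ?b"
    using pos by (simp add: powr_diff)
  finally have L: "?L = ?h\<^sup>2 * ?a powr (\<alpha> - 2) / ?b" .
  have tri: "?h \<le> ?a + ?b" "?a \<le> ?b + ?h" "?b \<le> ?a + ?h"
    using norm_triangle_ineq4[of "w - z" "w - (z + h)"] norm_triangle_ineq[of "w - (z + h)" h] norm_triangle_ineq4[of "w - z" h]
    by (simp_all add: algebra_simps)
  \<comment> \<open>The far zone; the zone comparable with \<open>|h|\<close>, which contains the
    pole \<open>z + h\<close> and lies within \<open>3 |h|\<close> of it; and a neighbourhood of the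
    pole \<open>z\<close>.\<close>
  consider "2 * ?h \<le> ?a" | "?a < 2 * ?h" "?h / 2 \<le> ?a" | "?a < ?h / 2" by linarith
  then have "?L \<le> ?R1 \<or> ?L \<le> ?R2 \<or> ?L \<le> ?R3"
  proof cases
    case 1
    then have b: "?a / 2 \<le> ?b" using tri by linarith
    have "?L \<le> ?h\<^sup>2 * ?a powr (\<alpha> - 2) / (?a / 2)"
      unfolding L using b pos by (intro divide_left_mono) auto
    also have "\<dots> = 2 * ?h\<^sup>2 * ?a powr -(3 - \<alpha>)"
    proof -
      have "?a powr -(3 - \<alpha>) = ?a powr ((\<alpha> - 2) - 1)" by (simp add: algebra_simps)
      also have "\<dots> = ?a powr (\<alpha> - 2) / ?a" using pos by (subst powr_diff) simp
      finally show ?thesis by simp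
    qed
    also have "\<dots> = ?R3" using 1 by (simp add: far_kernel_def dist_norm norm_minus_commute)
    finally show ?thesis by blast
  next
    case 2
    have "?L = ?h\<^sup>2 * ?a powr (\<alpha> - 2) * inverse ?b" unfolding L by (simp add: divide_inverse)
    also have "\<dots> \<le> ?h\<^sup>2 * (?h / 2) powr (\<alpha> - 2) * inverse ?b"
      using 2 pos \<alpha> by (intro mult_right_mono mult_left_mono powr_mono2') auto
    also have "?h\<^sup>2 * (?h / 2) powr (\<alpha> - 2) = 2 powr (2 - \<alpha>) * ?h powr \<alpha>"
      using pos by (simp add: powr_divide powr_diff divide_simps)
    also have "2 powr (2 - \<alpha>) * ?h powr \<alpha> * inverse ?b \<le> 4 * ?h powr \<alpha> * inverse ?b"
    proof -
      have "(2::real) powr (2 - \<alpha>) \<le> 2 powr 2" using \<alpha> by (intro powr_mono) auto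
      then show ?thesis by (intro mult_right_mono) auto
    qed
    also have "\<dots> = ?R1"
      using 2 tri pos by (simp add: near_kernel_def dist_norm norm_minus_commute powr_minus)
    finally show ?thesis by blast
  next
    case 3
    then have b: "?h / 2 \<le> ?b" using tri by linarith
    have "?L \<le> ?h\<^sup>2 * ?a powr (\<alpha> - 2) / (?h / 2)"
      unfolding L using b pos by (intro divide_left_mono) auto
    also have "\<dots> = 2 * ?h * ?a powr -(2 - \<alpha>)"
      using pos by (simp add: power2_eq_square)
    also have "\<dots> = ?R2"
    proof -
      have "norm (w - z) < 2 * ?h" using 3 pos by linarith
      then show ?thesis by (simp add: near_kernel_def dist_norm norm_minus_commute)
    qed
    finally show ?thesis by blast
  qed
  then show ?thesis using R by linarith
qed

section \<open>The holomorphic multiplier and the modified Cauchy kernel\<close>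

definition fs_ratio :: "complex \<Rightarrow> complex \<Rightarrow> complex" where
  "fs_ratio z w = (1 + cnj w * z) / of_real (1 + (cmod w)\<^sup>2)"
definition fs_slope :: "complex \<Rightarrow> complex" where
  "fs_slope w = cnj w / of_real (1 + (cmod w)\<^sup>2)"

lemma one_plus_norm_sq: "0 < 1 + (cmod w)\<^sup>2" "1 + (cmod w)\<^sup>2 \<noteq> 0" "of_real (1 + (cmod w)\<^sup>2) \<noteq> (0::complex)"
proof -
  show "0 < 1 + (cmod w)\<^sup>2" by (simp add: add_pos_nonneg)
  then show *: "1 + (cmod w)\<^sup>2 \<noteq> 0" by simp
  then show "of_real (1 + (cmod w)\<^sup>2) \<noteq> (0::complex)" by (simp only: of_real_eq_0_iff not_False_eq_True)
qed

lemma fs_ratio_diff: "fs_ratio z' w - fs_ratio z w = fs_slope w * (z' - z)"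
  by (simp add: fs_ratio_def fs_slope_def add_divide_distrib diff_divide_distrib algebra_simps)

lemma fs_ratio_minus_one: "fs_ratio z w - 1 = fs_slope w * (z - w)"
proof -
  have "fs_ratio w w = 1"
    using one_plus_norm_sq(3)[of w] by (simp add: fs_ratio_def mult.commute complex_norm_square[symmetric] del: of_real_power)
  then show ?thesis using fs_ratio_diff[of z w w] by simp
qed

lemma norm_fs_slope: "norm (fs_slope w) \<le> 1"
proof -
  have "norm (fs_slope w) = norm w / (1 + (cmod w)\<^sup>2)"
    unfolding fs_slope_def norm_divide norm_of_real using one_plus_norm_sq(1)[of w] by simp
  moreover have "norm w \<le> 1 + (cmod w)\<^sup>2" using sum_squares_bound[of "norm w" 1, simplified] norm_ge_zero[of w] by linarith
  ultimately show ?thesis using one_plus_norm_sq(1)[of w] by simp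
qed

text \<open>The ratio differs from 1 by at most \<open>|z - w| \<le> 3\<close>; this fixes the
  radius \<open>4\<close> on which \<open>geom_sum\<close> is estimated.\<close>

lemma norm_fs_ratio: "norm z \<le> 1 \<Longrightarrow> norm w \<le> 2 \<Longrightarrow> norm (fs_ratio z w) \<le> 4"
proof -
  assume a: "norm z \<le> 1" "norm w \<le> 2"
  have "norm (fs_ratio z w) \<le> norm (fs_ratio z w - 1) + 1"
    using norm_triangle_ineq[of "fs_ratio z w - 1" 1] by simp
  also have "norm (fs_ratio z w - 1) \<le> 1 * norm (z - w)"
    unfolding fs_ratio_minus_one norm_mult by (intro mult_right_mono norm_fs_slope) auto
  finally show ?thesis using a norm_triangle_ineq4[of z w] by simp
qed

text \<open>Lagrange's identity \<open>|1 + cnj w z|\<^sup>2 + |z - w|\<^sup>2 = (1 + |z|\<^sup>2)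
  (1 + |w|\<^sup>2)\<close> for the vectors \<open>(1, z)\<close> and \<open>(1, w)\<close>, divided
  by \<open>1 + |w|\<^sup>2\<close>.\<close>

lemma norm_fs_ratio_sq:
  "(norm (fs_ratio z w))\<^sup>2 * (1 + (cmod w)\<^sup>2) = (1 + (cmod z)\<^sup>2) - (cmod (z - w))\<^sup>2 / (1 + (cmod w)\<^sup>2)"
proof -
  let ?d = "1 + (cmod w)\<^sup>2"
  have d: "?d > 0" "?d \<noteq> 0" by (rule one_plus_norm_sq)+
  have "(norm (fs_ratio z w))\<^sup>2 = (norm (1 + cnj w * z))\<^sup>2 / ?d\<^sup>2"
    unfolding fs_ratio_def norm_divide norm_of_real power_divide by simp
  also have "(norm (1 + cnj w * z))\<^sup>2 = (1 + (cmod z)\<^sup>2) * ?d - (cmod (z - w))\<^sup>2"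
    unfolding cmod_power2 by (simp add: power2_eq_square algebra_simps)
  finally have "(norm (fs_ratio z w))\<^sup>2 = ((1 + (cmod z)\<^sup>2) * ?d - (cmod (z - w))\<^sup>2) / ?d\<^sup>2" .
  moreover have "(X * D - Y) / D\<^sup>2 * D = X - Y / D" if "D > 0" for X Y D :: real
    using that by (simp add: field_simps power2_eq_square)
  ultimately show ?thesis using d by (simp only:)
qed

text \<open>The quotient \<open>(q ^ n - 1) / (q - 1)\<close>, written as a polynomial so that it
  stays smooth at \<open>q = 1\<close>, in particular on the diagonal \<open>z = w\<close>.\<close>

definition geom_sum :: "nat \<Rightarrow> complex \<Rightarrow> complex" where "geom_sum n q = (\<Sum>j<n. q ^ j)"

text \<open>Horner's recursion: the sum for \<open>Suc n\<close> is \<open>1 + q\<close> times the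
  sum for \<open>n\<close>, its derivative follows from the product rule, and on the ball of radius
  4 each of the four bounds grows at most from \<open>C\<close> to \<open>1 + 5 * C\<close>.\<close>

lemma geom_sum_taylor:
  "\<exists>C\<ge>0. \<exists>p'. continuous_on UNIV p' \<and> (\<forall>a b. norm a \<le> 4 \<longrightarrow> norm b \<le> 4 \<longrightarrow>
     norm (geom_sum n b) \<le> C \<and> norm (p' b) \<le> C \<and> norm (geom_sum n b - geom_sum n a) \<le> C * norm (b - a) \<and>
     norm (geom_sum n b - geom_sum n a - p' a * (b - a)) \<le> C * (norm (b - a))\<^sup>2)"
proof (induction n)
  case 0
  show ?case by (rule exI[of _ 0], simp add: geom_sum_def, rule exI[of _ "\<lambda>_. 0"], simp)
next
  case (Suc n)
  then obtain C p' where C: "C \<ge> 0" "continuous_on UNIV p'" and *: "\<And>a b. norm a \<le> 4 \<Longrightarrow> norm b \<le> 4 \<Longrightarrow>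
     norm (geom_sum n b) \<le> C \<and> norm (p' b) \<le> C \<and> norm (geom_sum n b - geom_sum n a) \<le> C * norm (b - a) \<and>
     norm (geom_sum n b - geom_sum n a - p' a * (b - a)) \<le> C * (norm (b - a))\<^sup>2" by blast
  have S: "geom_sum (Suc n) q = 1 + q * geom_sum n q" for q
    unfolding geom_sum_def by (subst sum.lessThan_Suc_shift) (simp add: sum_distrib_left)
  have cont: "continuous_on UNIV (\<lambda>a. geom_sum n a + a * p' a)"
    unfolding geom_sum_def by (intro continuous_intros C)
  have "norm (geom_sum (Suc n) b) \<le> 1 + 5 * C \<and> norm (geom_sum n b + b * p' b) \<le> 1 + 5 * C \<and>
      norm (geom_sum (Suc n) b - geom_sum (Suc n) a) \<le> (1 + 5 * C) * norm (b - a) \<and>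
     norm (geom_sum (Suc n) b - geom_sum (Suc n) a - (geom_sum n a + a * p' a) * (b - a)) \<le> (1 + 5 * C) * (norm (b - a))\<^sup>2"
    if ab: "norm a \<le> 4" "norm b \<le> 4" for a b
  proof (intro conjI)
    have m: "norm (b * x) \<le> 4 * y" if "norm x \<le> y" for x y
      unfolding norm_mult using that ab by (intro mult_mono) auto
    show "norm (geom_sum (Suc n) b) \<le> 1 + 5 * C" unfolding S
      using norm_triangle_ineq[of 1 "b * geom_sum n b"] m[of "geom_sum n b" C] *[OF ab] C(1) by simp
    show "norm (geom_sum n b + b * p' b) \<le> 1 + 5 * C"
      using norm_triangle_ineq[of "geom_sum n b" "b * p' b"] m[of "p' b" C] *[OF ab] C(1) by simp
    have "geom_sum (Suc n) b - geom_sum (Suc n) a = b * (geom_sum n b - geom_sum n a) + (b - a) * geom_sum n a" by (simp add: S algebra_simps)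
    then have "norm (geom_sum (Suc n) b - geom_sum (Suc n) a) \<le> 4 * (C * norm (b - a)) + norm (b - a) * C"
      using *[OF ab] *[OF ab(2,1)] m[of "geom_sum n b - geom_sum n a" "C * norm (b - a)"]
      by (simp only:) (rule order_trans[OF norm_triangle_ineq], rule add_mono, blast, simp add: norm_mult mult_left_mono)
    also have "\<dots> \<le> (1 + 5 * C) * norm (b - a)" by (simp add: algebra_simps)
    finally show "norm (geom_sum (Suc n) b - geom_sum (Suc n) a) \<le> (1 + 5 * C) * norm (b - a)" .
    have "geom_sum (Suc n) b - geom_sum (Suc n) a - (geom_sum n a + a * p' a) * (b - a)
       = b * (geom_sum n b - geom_sum n a - p' a * (b - a)) + (b - a)\<^sup>2 * p' a" by (simp add: S power2_eq_square algebra_simps)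
    then have "norm (geom_sum (Suc n) b - geom_sum (Suc n) a - (geom_sum n a + a * p' a) * (b - a)) \<le> 4 * (C * (norm (b - a))\<^sup>2) + (norm (b - a))\<^sup>2 * C"
      using *[OF ab] *[OF ab(2,1)] m[of "geom_sum n b - geom_sum n a - p' a * (b - a)" "C * (norm (b - a))\<^sup>2"]
      by (simp only:) (rule order_trans[OF norm_triangle_ineq], rule add_mono, blast, simp add: norm_mult norm_power mult_left_mono)
    also have "\<dots> \<le> (1 + 5 * C) * (norm (b - a))\<^sup>2" by (simp add: algebra_simps)
    finally show "norm (geom_sum (Suc n) b - geom_sum (Suc n) a - (geom_sum n a + a * p' a) * (b - a)) \<le> (1 + 5 * C) * (norm (b - a))\<^sup>2" .
  qed
  then show ?case using cont C(1) by (intro exI[of _ "1 + 5 * C"] conjI exI[of _ "\<lambda>a. geom_sum n a + a * p' a"]) auto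
qed

text \<open>The multiplied kernel minus \<open>1 / (z - w)\<close>. It is polynomial in
  \<open>z\<close>, so the singular estimates concern the plain Cauchy kernel only.\<close>

definition fs_correction :: "nat \<Rightarrow> complex \<Rightarrow> complex \<Rightarrow> complex" where
  "fs_correction m z w = fs_slope w * geom_sum (2 * m) (fs_ratio z w)"

lemma continuous_fs: "continuous_on UNIV fs_slope" "continuous_on UNIV (fs_ratio z)"
  unfolding fs_slope_def fs_ratio_def
  by (rule continuous_on_divide; intro continuous_intros ballI one_plus_norm_sq(3))+

lemma measurable_fs [measurable]: "fs_slope \<in> borel_measurable borel" "fs_ratio z \<in> borel_measurable borel"
  "fs_correction m z \<in> borel_measurable borel"
proof -
  show [measurable]: "fs_slope \<in> borel_measurable borel" "fs_ratio z \<in> borel_measurable borel"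
    by (intro borel_measurable_continuous_onI continuous_fs)+
  show "fs_correction m z \<in> borel_measurable borel" unfolding fs_correction_def geom_sum_def by measurable
qed

text \<open>The ratio is affine in \<open>z\<close> with slope of norm at most 1, so the bounds for
  \<open>geom_sum\<close> carry over with the same constant; \<open>d z w\<close> is the complex
  derivative of the correction in \<open>z\<close>.\<close>

lemma fs_correction_taylor:
  obtains C d where "C \<ge> 0" "\<And>z. d z \<in> borel_measurable borel"
    "\<And>z z' w. norm z \<le> 1 \<Longrightarrow> norm z' \<le> 1 \<Longrightarrow> norm w \<le> 2 \<Longrightarrow> norm (fs_correction m z w) \<le> C"
    "\<And>z z' w. norm z \<le> 1 \<Longrightarrow> norm w \<le> 2 \<Longrightarrow> norm (d z w) \<le> C"
    "\<And>z z' w. norm z \<le> 1 \<Longrightarrow> norm z' \<le> 1 \<Longrightarrow> norm w \<le> 2 \<Longrightarrow> norm (fs_correction m z' w - fs_correction m z w) \<le> C * norm (z' - z)"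
    "\<And>z z' w. norm z \<le> 1 \<Longrightarrow> norm z' \<le> 1 \<Longrightarrow> norm w \<le> 2 \<Longrightarrow>
       norm (fs_correction m z' w - fs_correction m z w - d z w * (z' - z)) \<le> C * (norm (z' - z))\<^sup>2"
proof -
  obtain C p' where C: "C \<ge> 0" and p': "continuous_on UNIV p'" and *: "\<And>a b. norm a \<le> 4 \<Longrightarrow> norm b \<le> 4 \<Longrightarrow>
     norm (geom_sum (2 * m) b) \<le> C \<and> norm (p' b) \<le> C \<and> norm (geom_sum (2 * m) b - geom_sum (2 * m) a) \<le> C * norm (b - a) \<and>
     norm (geom_sum (2 * m) b - geom_sum (2 * m) a - p' a * (b - a)) \<le> C * (norm (b - a))\<^sup>2" using geom_sum_taylor[of "2 * m"] by blast
  define d where "d z w = fs_slope w * p' (fs_ratio z w) * fs_slope w" for z w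
  have sl: "norm (fs_slope w * x) \<le> norm x" for w x
    unfolding norm_mult using norm_fs_slope[of w] by (simp add: mult_left_le_one_le)
  show ?thesis
  proof (rule that[of C d])
    have [measurable]: "p' \<in> borel_measurable borel" by (rule borel_measurable_continuous_onI[OF p'])
    show "d z \<in> borel_measurable borel" for z unfolding d_def by measurable
    fix z w :: complex assume zw: "norm z \<le> 1" "norm w \<le> 2"
    note r = norm_fs_ratio[OF zw]
    have "d z w = fs_slope w * (fs_slope w * p' (fs_ratio z w))" by (simp add: d_def)
    then show "norm (d z w) \<le> C"
      using order_trans[OF sl[of w "fs_slope w * p' (fs_ratio z w)"] sl[of w "p' (fs_ratio z w)"]] *[OF r r] by simp
    fix z' :: complex assume z': "norm z' \<le> 1"
    note r' = norm_fs_ratio[OF z' zw(2)]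
    show "norm (fs_correction m z w) \<le> C" using sl[of w "geom_sum (2 * m) (fs_ratio z w)"] *[OF r r] by (simp add: fs_correction_def)
    let ?G = "geom_sum (2 * m) (fs_ratio z' w) - geom_sum (2 * m) (fs_ratio z w)"
    have e: "fs_correction m z' w - fs_correction m z w = fs_slope w * ?G" by (simp add: fs_correction_def algebra_simps)
    have "norm (fs_correction m z' w - fs_correction m z w) \<le> C * norm (fs_slope w * (z' - z))"
      unfolding e using sl[of w ?G] *[OF r r'] by (simp add: fs_ratio_diff)
    also have "\<dots> \<le> C * norm (z' - z)" by (intro mult_left_mono sl C)
    finally show "norm (fs_correction m z' w - fs_correction m z w) \<le> C * norm (z' - z)" .
    have "fs_correction m z' w - fs_correction m z w - d z w * (z' - z) = fs_slope w * (?G - p' (fs_ratio z w) * (fs_ratio z' w - fs_ratio z w))"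
      unfolding e d_def fs_ratio_diff by (simp add: algebra_simps)
    then have "norm (fs_correction m z' w - fs_correction m z w - d z w * (z' - z)) \<le> C * (norm (fs_slope w * (z' - z)))\<^sup>2"
      using sl[of w "?G - p' (fs_ratio z w) * (fs_ratio z' w - fs_ratio z w)"] *[OF r r'] by (simp add: fs_ratio_diff)
    also have "\<dots> \<le> C * (norm (z' - z))\<^sup>2" by (intro mult_left_mono power_mono sl C) auto
    finally show "norm (fs_correction m z' w - fs_correction m z w - d z w * (z' - z)) \<le> C * (norm (z' - z))\<^sup>2" .
  qed (use C in auto)
qed

definition fs_kernel :: "nat \<Rightarrow> complex \<Rightarrow> complex \<Rightarrow> complex" where
  "fs_kernel m z w = of_real (chi w) * (1 / (z - w) + fs_correction m z w)"

lemma fs_kernel_eq: "w \<noteq> z \<Longrightarrow> fs_kernel m z w = of_real (chi w) * (fs_ratio z w ^ (2 * m) / (z - w))"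
proof -
  assume "w \<noteq> z"
  then have nz: "z - w \<noteq> 0" by simp
  have "fs_ratio z w ^ (2 * m) - 1 = (fs_ratio z w - 1) * geom_sum (2 * m) (fs_ratio z w)"
    unfolding geom_sum_def by (rule power_diff_1_eq)
  also have "\<dots> = (z - w) * fs_correction m z w" by (simp add: fs_ratio_minus_one fs_correction_def)
  finally have "fs_ratio z w ^ (2 * m) = 1 + (z - w) * fs_correction m z w" by (simp add: algebra_simps)
  then show ?thesis using nz by (simp add: fs_kernel_def add_divide_distrib)
qed

lemma fs_kernel_measurable [measurable]: "fs_kernel m z \<in> borel_measurable borel"
  unfolding fs_kernel_def by measurable

text \<open>The \<open>m\<close>-th power of \<open>norm_fs_ratio_sq\<close>. The \<open>10\<close>
  is \<open>2 * 5\<close>, a bound for \<open>(1 + |z|\<^sup>2) (1 + |w|\<^sup>2)\<close> when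
  \<open>|z| \<le> 1\<close> and \<open>|w| \<le> 2\<close>: the subtracted term is then at least
  \<open>(1 + |z|\<^sup>2) |z - w|\<^sup>2 / 10\<close>.\<close>

lemma fs_kernel_weighted_bound:
  assumes z: "norm z \<le> 1" and nz: "w \<noteq> z"
  shows "norm (fs_kernel m z w) * (1 + (cmod w)\<^sup>2) ^ m
     \<le> 9 * (1 + (cmod z)\<^sup>2) ^ m * ((1 - (cmod (w - z))\<^sup>2 / 10) ^ m * near_kernel 1 z 3 w)"
proof (cases "norm w < 2")
  case False
  have "0 \<le> (1 - (cmod (w - z))\<^sup>2 / 10) ^ m * near_kernel 1 z 3 w"
  proof (cases "w \<in> ball z 3")
    case True
    then have "(cmod (w - z))\<^sup>2 \<le> 3\<^sup>2" by (intro power_mono) (auto simp: dist_norm norm_minus_commute)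
    then show ?thesis by (intro mult_nonneg_nonneg zero_le_power near_far_nonneg) auto
  qed (simp add: near_kernel_def)
  moreover have "0 \<le> 9 * (1 + (cmod z)\<^sup>2) ^ m" by (intro mult_nonneg_nonneg zero_le_power) auto
  ultimately have "0 \<le> 9 * (1 + (cmod z)\<^sup>2) ^ m * ((1 - (cmod (w - z))\<^sup>2 / 10) ^ m * near_kernel 1 z 3 w)"
    by (rule mult_nonneg_nonneg[rotated])
  then show ?thesis using False by (simp add: fs_kernel_def chi_outer)
next
  case True
  have w3: "norm (w - z) < 3" using True z norm_triangle_ineq4[of w z] by simp
  have "(norm (fs_ratio z w))\<^sup>2 * (1 + (cmod w)\<^sup>2) \<le> (1 + (cmod z)\<^sup>2) * (1 - (cmod (w - z))\<^sup>2 / 10)"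
  proof -
    have "(1 + (cmod z)\<^sup>2) * (1 + (cmod w)\<^sup>2) \<le> 2 * 5"
      using z True power_mono[of "norm w" 2 2] by (intro mult_mono) (auto simp: power_le_one)
    then have "(cmod (w - z))\<^sup>2 * ((1 + (cmod z)\<^sup>2) * (1 + (cmod w)\<^sup>2)) \<le> (cmod (w - z))\<^sup>2 * 10"
      by (intro mult_left_mono) auto
    then have "(1 + (cmod z)\<^sup>2) * ((cmod (w - z))\<^sup>2 / 10) \<le> (cmod (w - z))\<^sup>2 / (1 + (cmod w)\<^sup>2)"
      using one_plus_norm_sq(1)[of w] by (simp add: field_simps)
    then show ?thesis unfolding norm_fs_ratio_sq by (simp add: norm_minus_commute right_diff_distrib)
  qed
  then have "((norm (fs_ratio z w))\<^sup>2 * (1 + (cmod w)\<^sup>2)) ^ m \<le> ((1 + (cmod z)\<^sup>2) * (1 - (cmod (w - z))\<^sup>2 / 10)) ^ m"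
    by (intro power_mono) auto
  then have le: "norm (fs_ratio z w) ^ (2 * m) * (1 + (cmod w)\<^sup>2) ^ m \<le> (1 + (cmod z)\<^sup>2) ^ m * (1 - (cmod (w - z))\<^sup>2 / 10) ^ m"
    by (simp add: power_mult_distrib power_mult)
  have "norm (fs_kernel m z w) * (1 + (cmod w)\<^sup>2) ^ m = \<bar>chi w\<bar> * (norm (fs_ratio z w) ^ (2 * m) * (1 + (cmod w)\<^sup>2) ^ m) * inverse (norm (w - z))"
    unfolding fs_kernel_eq[OF nz] norm_mult norm_divide norm_power norm_of_real by (simp add: norm_minus_commute divide_inverse)
  also have "\<dots> \<le> 9 * ((1 + (cmod z)\<^sup>2) ^ m * (1 - (cmod (w - z))\<^sup>2 / 10) ^ m) * inverse (norm (w - z))"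
    by (intro mult_right_mono mult_mono[OF chi_bound le]) auto
  also have "\<dots> = 9 * (1 + (cmod z)\<^sup>2) ^ m * ((1 - (cmod (w - z))\<^sup>2 / 10) ^ m * near_kernel 1 z 3 w)"
    using w3 by (simp add: near_kernel_def dist_norm norm_minus_commute powr_minus)
  finally show ?thesis .
qed

section \<open>Hoelder bounds on the closed disc\<close>

text \<open>These balls of \<open>C\<^sup>\<alpha>\<close> and \<open>C\<^sup>1\<^sup>,\<^sup>\<alpha>\<close> are closed under convergent series with summable bounds, which is all
  the completeness that the iterations below use.\<close>

definition hoelder_le :: "real \<Rightarrow> real \<Rightarrow> (complex \<Rightarrow> 'a::real_normed_vector) \<Rightarrow> bool" where
  "hoelder_le \<alpha> M g \<longleftrightarrow> (\<forall>z\<in>cball 0 1. norm (g z) \<le> M) \<and>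
     (\<forall>z\<in>cball 0 1. \<forall>z'\<in>cball 0 1. norm (g z - g z') \<le> M * norm (z - z') powr \<alpha>)"

definition c1_le :: "real \<Rightarrow> real \<Rightarrow> (complex \<Rightarrow> 'a::real_normed_vector) \<Rightarrow> (complex \<Rightarrow> 'a) \<Rightarrow> (complex \<Rightarrow> 'a) \<Rightarrow> bool" where
  "c1_le \<alpha> M U Ux Uy \<longleftrightarrow> hoelder_le \<alpha> M U \<and> hoelder_le \<alpha> M Ux \<and> hoelder_le \<alpha> M Uy \<and>
     (\<forall>z\<in>cball 0 1. (U has_derivative (\<lambda>h. Re h *\<^sub>R Ux z + Im h *\<^sub>R Uy z)) (at z within cball 0 1))"

lemma hoelder_leD:
  assumes "hoelder_le \<alpha> M g"
  shows "z \<in> cball 0 1 \<Longrightarrow> norm (g z) \<le> M"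
    "z \<in> cball 0 1 \<Longrightarrow> z' \<in> cball 0 1 \<Longrightarrow> norm (g z - g z') \<le> M * norm (z - z') powr \<alpha>"
  using assms by (auto simp: hoelder_le_def)

lemma hoelder_leI:
  assumes "\<And>z. z \<in> cball 0 1 \<Longrightarrow> norm (g z) \<le> M"
    "\<And>z z'. z \<in> cball 0 1 \<Longrightarrow> z' \<in> cball 0 1 \<Longrightarrow> norm (g z - g z') \<le> M * norm (z - z') powr \<alpha>"
  shows "hoelder_le \<alpha> M g"
  using assms by (auto simp: hoelder_le_def)

lemma hoelder_le_nonneg: "hoelder_le \<alpha> M g \<Longrightarrow> 0 \<le> M"
  by (rule order_trans[OF norm_ge_zero hoelder_leD(1)[of \<alpha> M g 0]]) auto

lemma hoelder_le_mono: "hoelder_le \<alpha> M g \<Longrightarrow> M \<le> M' \<Longrightarrow> hoelder_le \<alpha> M' g"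
  by (rule hoelder_leI; rule order_trans[OF hoelder_leD(1)] order_trans[OF hoelder_leD(2)])
     (auto intro: mult_right_mono)

lemma hoelder_le_add:
  assumes "hoelder_le \<alpha> M f" "hoelder_le \<alpha> N g"
  shows "hoelder_le \<alpha> (M + N) (\<lambda>z. f z + g z)"
proof (rule hoelder_leI)
  fix z z' :: complex assume z: "z \<in> cball 0 1" and z': "z' \<in> cball 0 1"
  have "f z + g z - (f z' + g z') = (f z - f z') + (g z - g z')" by simp
  then show "norm (f z + g z - (f z' + g z')) \<le> (M + N) * norm (z - z') powr \<alpha>"
    using norm_triangle_ineq[of "f z - f z'" "g z - g z'"] hoelder_leD(2)[OF assms(1) z z'] hoelder_leD(2)[OF assms(2) z z']
    by (simp only: distrib_right)
next
  fix z :: complex assume z: "z \<in> cball 0 1"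
  show "norm (f z + g z) \<le> M + N"
    using norm_triangle_ineq[of "f z" "g z"] hoelder_leD(1)[OF assms(1) z] hoelder_leD(1)[OF assms(2) z] by linarith
qed

lemma hoelder_le_continuous:
  assumes "hoelder_le \<alpha> M g" "0 < \<alpha>" shows "continuous_on (cball 0 1) g"
  unfolding continuous_on_def
proof
  fix z :: complex assume z: "z \<in> cball 0 1"
  have "((\<lambda>z'. M * norm (z' - z) powr \<alpha>) \<longlongrightarrow> M * norm (z - z) powr \<alpha>) (at z within cball 0 1)"
    using assms(2) by (intro tendsto_intros) auto
  then have lim: "((\<lambda>z'. M * norm (z' - z) powr \<alpha>) \<longlongrightarrow> 0) (at z within cball 0 1)" by simp
  have "((\<lambda>z'. g z' - g z) \<longlongrightarrow> 0) (at z within cball 0 1)"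
    by (rule Lim_null_comparison[OF _ lim]) (use hoelder_leD(2)[OF assms(1) _ z] in \<open>auto simp: eventually_at_filter\<close>)
  then show "(g \<longlongrightarrow> g z) (at z within cball 0 1)" by (simp add: LIM_zero_iff)
qed

text \<open>Absorbs Lipschitz terms into Hoelder terms: the disc has diameter 2, so the left-over
  power 1 - \<alpha> of the distance is at most 2.\<close>

lemma norm_le_two_powr:
  assumes "0 < \<alpha>" "\<alpha> < 1" "norm (z::complex) \<le> 1" "norm z' \<le> 1"
  shows "norm (z - z') \<le> 2 * norm (z - z') powr \<alpha>"
proof (cases "z = z'")
  case False
  have "norm (z - z') = norm (z - z') powr \<alpha> * norm (z - z') powr (1 - \<alpha>)"
    using False by (simp flip: powr_add)
  also have "\<dots> \<le> norm (z - z') powr \<alpha> * 2"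
  proof (rule mult_left_mono)
    have "norm (z - z') powr (1 - \<alpha>) \<le> 2 powr (1 - \<alpha>)"
      using norm_triangle_ineq4[of z z'] assms by (intro powr_mono2) auto
    also have "\<dots> \<le> 2 powr 1" using assms by (intro powr_mono) auto
    finally show "norm (z - z') powr (1 - \<alpha>) \<le> 2" by simp
  qed simp
  finally show ?thesis by (simp add: mult.commute)
qed simp

text \<open>Campanato's characterisation: an affine approximation of order \<open>1 + \<alpha>\<close> at every point
  already forces the linear parts to depend Hoelder continuously on the point, since two
  approximations can be compared on a ball of comparable size inside the disc.\<close>

lemma campanato_one_direction:
  fixes F A B :: "complex \<Rightarrow> 'b::real_normed_vector"
  assumes \<alpha>: "0 < \<alpha>" "\<alpha> < 1" and K: "0 \<le> K"
    and app: "\<And>z z'. norm z \<le> 1 \<Longrightarrow> norm z' \<le> 1 \<Longrightarrow>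
      norm (F z' - F z - Re (z' - z) *\<^sub>R A z - Im (z' - z) *\<^sub>R B z) \<le> K * norm (z' - z) powr (1 + \<alpha>)"
    and z: "norm z \<le> 1" and z': "norm z' \<le> 1" and \<theta>: "norm \<theta> = 1"
  shows "norm (Re \<theta> *\<^sub>R (A z - A z') + Im \<theta> *\<^sub>R (B z - B z')) \<le> 64 * K * norm (z - z') powr \<alpha>"
proof (cases "z = z'")
  case False
  define r where "r = norm (z - z')"
  have r: "0 < r" "r \<le> 2" using False norm_triangle_ineq4[of z z'] z z' by (auto simp: r_def)
  \<comment> \<open>The point \<open>z\<close> is pulled towards the centre by at most
    \<open>r / 4\<close>. The ball of radius \<open>r / 4\<close> about \<open>p\<close> then lies
    in the unit disc, so \<open>y\<close> can be chosen in any direction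
    \<open>\<theta>\<close>.\<close>
  define p where "p = (1 - r / 4) *\<^sub>R z"
  define y where "y = p + (r / 4) *\<^sub>R \<theta>"
  have pz: "norm (p - z) \<le> r / 4"
  proof -
    have "p - z = - ((r / 4) *\<^sub>R z)" by (simp add: p_def algebra_simps)
    then show ?thesis using z r by (simp add: mult_left_le)
  qed
  have p1: "norm p \<le> 1 - r / 4" using z r by (simp add: p_def mult_left_le)
  have yp: "norm (y - p) \<le> r / 4" using r \<theta> by (simp add: y_def)
  have y1: "norm y \<le> 1" using p1 norm_triangle_ineq[of p "(r / 4) *\<^sub>R \<theta>"] r \<theta> by (simp add: y_def)
  have p1': "norm p \<le> 1" using p1 r by simp
  have bnd: "norm (F u - F v - Re (u - v) *\<^sub>R A v - Im (u - v) *\<^sub>R B v) \<le> K * (4 * r powr (1 + \<alpha>))"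
    if "norm u \<le> 1" "norm v \<le> 1" "norm (u - v) \<le> 2 * r" for u v
  proof -
    have "norm (u - v) powr (1 + \<alpha>) \<le> (2 * r) powr (1 + \<alpha>)"
      using that \<alpha> by (intro powr_mono2) auto
    also have "\<dots> = 2 powr (1 + \<alpha>) * r powr (1 + \<alpha>)" using r by (simp add: powr_mult)
    also have "\<dots> \<le> 2 powr 2 * r powr (1 + \<alpha>)" using \<alpha> by (intro mult_right_mono powr_mono) auto
    finally have "norm (u - v) powr (1 + \<alpha>) \<le> 4 * r powr (1 + \<alpha>)" by simp
    then show ?thesis using app[OF that(2,1)] K by (meson mult_left_mono order_trans)
  qed
  let ?L = "\<lambda>v u. Re u *\<^sub>R A v + Im u *\<^sub>R B v"
  \<comment> \<open>Subtracting the expansions at \<open>y\<close> and at \<open>p\<close> cancels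
    the value at the base point \<open>v\<close>; the linear parts at \<open>z\<close> and
    \<open>z'\<close> can then be compared through the same increment
    \<open>F y - F p\<close>.\<close>
  have step: "norm (F y - F p - ?L v (y - p)) \<le> 8 * K * r powr (1 + \<alpha>)" if v: "norm v \<le> 1" "norm (p - v) \<le> 5 / 4 * r" for v
  proof -
    have yv: "norm (y - v) \<le> 2 * r" "norm (p - v) \<le> 2 * r"
      using norm_triangle_ineq[of "y - p" "p - v"] v yp r by auto
    have "F y - F p - ?L v (y - p) = (F y - F v - Re (y - v) *\<^sub>R A v - Im (y - v) *\<^sub>R B v) - (F p - F v - Re (p - v) *\<^sub>R A v - Im (p - v) *\<^sub>R B v)"
      by (simp add: algebra_simps)
    then have "norm (F y - F p - ?L v (y - p)) \<le> norm (F y - F v - Re (y - v) *\<^sub>R A v - Im (y - v) *\<^sub>R B v) + norm (F p - F v - Re (p - v) *\<^sub>R A v - Im (p - v) *\<^sub>R B v)"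
      by (simp only: norm_triangle_ineq4)
    also have "\<dots> \<le> K * (4 * r powr (1 + \<alpha>)) + K * (4 * r powr (1 + \<alpha>))"
      by (intro add_mono bnd y1 p1' v yv)
    finally show ?thesis by simp
  qed
  have s1: "norm (F y - F p - ?L z (y - p)) \<le> 8 * K * r powr (1 + \<alpha>)"
    by (rule step) (use z pz r in auto)
  have s2: "norm (F y - F p - ?L z' (y - p)) \<le> 8 * K * r powr (1 + \<alpha>)"
    by (rule step) (use z' pz norm_triangle_ineq[of "p - z" "z - z'"] in \<open>auto simp: r_def\<close>)
  have "?L z (y - p) - ?L z' (y - p) = (F y - F p - ?L z' (y - p)) - (F y - F p - ?L z (y - p))" by simp
  then have "norm (?L z (y - p) - ?L z' (y - p)) \<le> 16 * K * r powr (1 + \<alpha>)"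
    using norm_triangle_ineq4[of "F y - F p - ?L z' (y - p)" "F y - F p - ?L z (y - p)"] s1 s2 by (simp only:)
  moreover have "?L z (y - p) - ?L z' (y - p) = (r / 4) *\<^sub>R (Re \<theta> *\<^sub>R (A z - A z') + Im \<theta> *\<^sub>R (B z - B z'))"
    by (simp add: y_def algebra_simps)
  ultimately have "r / 4 * norm (Re \<theta> *\<^sub>R (A z - A z') + Im \<theta> *\<^sub>R (B z - B z')) \<le> 16 * K * (r * r powr \<alpha>)"
    using r by (simp add: powr_add)
  then have "r * norm (Re \<theta> *\<^sub>R (A z - A z') + Im \<theta> *\<^sub>R (B z - B z')) \<le> r * (64 * K * r powr \<alpha>)" by (simp add: mult_ac)
  then show ?thesis using r by (simp add: r_def)
qed simp

lemma campanato:
  fixes F A B :: "complex \<Rightarrow> 'b::real_normed_vector"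
  assumes \<alpha>: "0 < \<alpha>" "\<alpha> < 1" and K: "0 \<le> K"
    and app: "\<And>z z'. norm z \<le> 1 \<Longrightarrow> norm z' \<le> 1 \<Longrightarrow>
      norm (F z' - F z - Re (z' - z) *\<^sub>R A z - Im (z' - z) *\<^sub>R B z) \<le> K * norm (z' - z) powr (1 + \<alpha>)"
    and z: "norm z \<le> 1" 
  shows "norm z' \<le> 1 \<Longrightarrow> norm (A z - A z') \<le> 64 * K * norm (z - z') powr \<alpha>"
    "norm z' \<le> 1 \<Longrightarrow> norm (B z - B z') \<le> 64 * K * norm (z - z') powr \<alpha>"
    "(F has_derivative (\<lambda>h. Re h *\<^sub>R A z + Im h *\<^sub>R B z)) (at z within cball 0 1)"
proof -
  show "norm (A z - A z') \<le> 64 * K * norm (z - z') powr \<alpha>" if "norm z' \<le> 1"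
    using campanato_one_direction[OF \<alpha> K app z that, of 1] by simp
  show "norm (B z - B z') \<le> 64 * K * norm (z - z') powr \<alpha>" if "norm z' \<le> 1"
    using campanato_one_direction[OF \<alpha> K app z that, of \<i>] by simp
  let ?L = "\<lambda>h. Re h *\<^sub>R A z + Im h *\<^sub>R B z"
  have bl: "bounded_linear ?L"
    by (rule bounded_linear_add[OF bounded_linear_compose[OF bounded_linear_scaleR_left bounded_linear_Re]
       bounded_linear_compose[OF bounded_linear_scaleR_left bounded_linear_Im]])
  have "((\<lambda>z'. K * norm (z' - z) powr \<alpha>) \<longlongrightarrow> K * norm (z - z) powr \<alpha>) (at z within cball 0 1)"
    using \<alpha> by (intro tendsto_intros) auto
  then have lim: "((\<lambda>z'. K * norm (z' - z) powr \<alpha>) \<longlongrightarrow> 0) (at z within cball 0 1)" by simp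
  show "(F has_derivative ?L) (at z within cball 0 1)"
    unfolding has_derivative_iff_norm
  proof (intro conjI bl Lim_null_comparison[OF _ lim])
    have "norm (norm (F y - F z - ?L (y - z)) / norm (y - z)) \<le> K * norm (y - z) powr \<alpha>" if "y \<in> cball 0 1" "y \<noteq> z" for y
    proof -
      have "norm (F y - F z - ?L (y - z)) \<le> K * norm (y - z) powr (1 + \<alpha>)"
        using app[of z y] z that by (simp add: diff_diff_eq add.assoc)
      also have "\<dots> = K * norm (y - z) powr \<alpha> * norm (y - z)" using that by (simp add: powr_add)
      finally show ?thesis using that by (simp add: pos_divide_le_eq)
    qed
    then show "\<forall>\<^sub>F y in at z within cball 0 1. norm (norm (F y - F z - ?L (y - z)) / norm (y - z)) \<le> K * norm (y - z) powr \<alpha>"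
      by (simp add: eventually_at_filter)
  qed
qed

section \<open>A right inverse of the Cauchy-Riemann operator\<close>

text \<open>Composition with the nearest-point projection extends Hoelder data from the disc to the
  plane with the same bounds. Since it does not increase the modulus, growth bounds by
  \<open>(1 + |w|\<^sup>2) ^ m\<close> survive as well.\<close>

definition disc_retract :: "complex \<Rightarrow> complex" where "disc_retract = closest_point (cball 0 1)"

lemma disc_retract:
  "disc_retract z \<in> cball 0 1" "z \<in> cball 0 1 \<Longrightarrow> disc_retract z = z"
  "norm (disc_retract z - disc_retract z') \<le> norm (z - z')" "norm (disc_retract z) \<le> norm z"
proof -
  show "disc_retract z \<in> cball 0 1" unfolding disc_retract_def by (rule closest_point_in_set) auto
  show "z \<in> cball 0 1 \<Longrightarrow> disc_retract z = z" for z unfolding disc_retract_def by (rule closest_point_self)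
  from this[of 0] have 0: "disc_retract 0 = 0" by simp
  show L: "norm (disc_retract z - disc_retract z') \<le> norm (z - z')" for z z'
    using closest_point_lipschitz[of "cball (0::complex) 1" z z'] by (simp add: disc_retract_def dist_norm)
  show "norm (disc_retract z) \<le> norm z" using L[of z 0] 0 by simp
qed

lemma retract_measurable:
  fixes g :: "complex \<Rightarrow> 'a::euclidean_space"
  assumes "continuous_on (cball 0 1) g"
  shows "(\<lambda>w. g (disc_retract w)) \<in> borel_measurable borel"
proof (rule borel_measurable_continuous_onI)
  have "continuous_on UNIV disc_retract" unfolding disc_retract_def by (rule continuous_on_closest_point) auto
  then show "continuous_on UNIV (\<lambda>w. g (disc_retract w))"
    by (rule continuous_on_compose2[OF assms]) (use disc_retract(1) in blast)
qed

text \<open>Isolates what the integral operators use of \<open>Jst\<close>: a norm-nonincreasing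
  linear map with square \<open>-1\<close>, through which complex kernels act on real
  vectors.\<close>

locale linear_complex_structure =
  fixes J0 :: "'a::euclidean_space \<Rightarrow> 'a"
  assumes linear_J0: "linear J0" and J0_J0: "J0 (J0 v) = - v" and norm_J0: "norm (J0 v) \<le> norm v"
begin

definition act :: "complex \<Rightarrow> 'a \<Rightarrow> 'a" where "act c v = Re c *\<^sub>R v + Im c *\<^sub>R J0 v"

lemma norm_act: "norm (act c v) \<le> 2 * norm c * norm v"
proof -
  have "norm (act c v) \<le> \<bar>Re c\<bar> * norm v + \<bar>Im c\<bar> * norm (J0 v)"
    unfolding act_def by (rule order_trans[OF norm_triangle_ineq]) simp
  also have "\<dots> \<le> norm c * norm v + norm c * norm v"
    using abs_Re_le_cmod[of c] abs_Im_le_cmod[of c] norm_J0[of v] by (intro add_mono mult_mono) auto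
  finally show ?thesis by (simp add: mult_ac)
qed

lemma bilinear_act: "bounded_bilinear act"
proof
  note J = linear_add[OF linear_J0] linear_cmul[OF linear_J0]
  show "\<exists>K. \<forall>a b. norm (act a b) \<le> norm a * norm b * K"
    by (rule exI[of _ 2]) (use norm_act in \<open>auto simp: mult_ac\<close>)
qed (auto simp: act_def linear_add[OF linear_J0] linear_cmul[OF linear_J0] algebra_simps)

sublocale act: bounded_bilinear act by (rule bilinear_act)

lemma act_mult: "act (c * d) v = act c (act d v)"
  by (simp add: act_def linear_add[OF linear_J0] linear_cmul[OF linear_J0] J0_J0 algebra_simps)

lemma act_of_real: "act (of_real r) v = r *\<^sub>R v" by (simp add: act_def)

lemma measurable_act [measurable (raw)]:
  assumes [measurable]: "\<kappa> \<in> borel_measurable M" "v \<in> borel_measurable M"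
  shows "(\<lambda>w. act (\<kappa> w) (v w)) \<in> borel_measurable M"
proof -
  have [measurable]: "J0 \<in> borel_measurable borel"
    by (intro borel_measurable_continuous_onI linear_continuous_on) (use linear_J0 in \<open>simp add: linear_conv_bounded_linear\<close>)
  show ?thesis unfolding act_def by measurable
qed

text \<open>Reduces the vector-valued estimates to the integral of a scalar majorant; the
  \<open>2\<close> is the constant of \<open>norm_act\<close>.\<close>

lemma act_integral:
  assumes [measurable]: "\<kappa> \<in> borel_measurable lborel" "v \<in> borel_measurable lborel"
    and G: "integrable lborel G" "AE w in lborel. norm (\<kappa> w) * norm (v w) \<le> G w" "integral\<^sup>L lborel G \<le> C"
  shows "integrable lborel (\<lambda>w. act (\<kappa> w) (v w))" "norm (\<integral>w. act (\<kappa> w) (v w) \<partial>lborel) \<le> 2 * C"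
proof -
  have ae: "AE w in lborel. norm (act (\<kappa> w) (v w)) \<le> 2 * G w"
    using G(2)
  proof eventually_elim
    case (elim w)
    then show ?case using norm_act[of "\<kappa> w" "v w"] by simp
  qed
  have 2: "integrable lborel (\<lambda>w. 2 * G w)" using G by simp
  show int: "integrable lborel (\<lambda>w. act (\<kappa> w) (v w))"
    by (rule Bochner_Integration.integrable_bound[OF 2]) (use ae in auto)
  have "norm (\<integral>w. act (\<kappa> w) (v w) \<partial>lborel) \<le> (\<integral>w. norm (act (\<kappa> w) (v w)) \<partial>lborel)" by (rule integral_norm_bound)
  also have "\<dots> \<le> (\<integral>w. 2 * G w \<partial>lborel)"
    by (rule integral_mono_AE) (use int 2 ae in auto)
  finally show "norm (\<integral>w. act (\<kappa> w) (v w) \<partial>lborel) \<le> 2 * C" using G(3) by simp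
qed

text \<open>The factor \<open>1/2\<close> makes \<open>U = dbar_inv m g\<close> satisfy \<open>U\<^sub>x + J0 U\<^sub>y = g\<close>, the left-hand side being twice the
  \<open>\<partial>/\<partial>cnj z\<close> derivative.\<close>

definition dbar_inv :: "nat \<Rightarrow> (complex \<Rightarrow> 'a) \<Rightarrow> complex \<Rightarrow> 'a" where
  "dbar_inv m g z = (1 / (2 * cauchy_const)) *\<^sub>R (\<integral>w. act (fs_kernel m z w) (g (disc_retract w)) \<partial>lborel)"

text \<open>After the kernel bound, \<open>(1 - |w - z|\<^sup>2 / 10)^m / |w - z|\<close> is left to
  integrate. Within distance \<open>\<rho>\<close> the power is at most 1 and the integral is of
  order \<open>\<rho>\<close>; farther out the power is at most
  \<open>(1 - \<rho>\<^sup>2 / 10)^m\<close>. Choosing \<open>\<rho>\<close> and then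
  \<open>m\<close> makes each part at most \<open>\<epsilon> / 2\<close>, independently of
  \<open>g\<close> and \<open>z\<close>.\<close>

lemma dbar_inv_weighted:
  assumes "\<eta> > 0"
  obtains m where "\<And>g M z. continuous_on (cball 0 1) g \<Longrightarrow> (\<And>w. w \<in> cball 0 1 \<Longrightarrow> norm (g w) \<le> M * (1 + (cmod w)\<^sup>2) ^ m) \<Longrightarrow>
     z \<in> cball 0 1 \<Longrightarrow> norm (dbar_inv m g z) \<le> \<eta> * M * (1 + (cmod z)\<^sup>2) ^ m"
proof -
  note cc = cauchy_const_pos
  obtain C where C: "C > 0" "\<And>r a. r > 0 \<Longrightarrow> integrable lborel (near_kernel 1 a r)"
    "\<And>r a. r > 0 \<Longrightarrow> integral\<^sup>L lborel (near_kernel 1 a r) \<le> C * r powr (2 - 1)"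
    using near_kernel_integral[of 1] by auto
  \<comment> \<open>The \<open>9\<close> is the bound of \<open>chi\<close>; the \<open>2\<close> of
    \<open>norm_act\<close> cancels against the normalisation
    \<open>1 / (2 * cauchy_const)\<close>.\<close>
  define \<epsilon> where "\<epsilon> = \<eta> * cauchy_const / 9"
  have \<epsilon>: "\<epsilon> > 0" using assms cc by (simp add: \<epsilon>_def)
  define \<rho> where "\<rho> = min 1 (\<epsilon> / (2 * C))"
  have \<rho>: "0 < \<rho>" "\<rho> \<le> 1" using \<epsilon> C by (auto simp: \<rho>_def)
  have \<rho>C: "C * \<rho> \<le> \<epsilon> / 2"
  proof -
    have "C * \<rho> \<le> C * (\<epsilon> / (2 * C))" using C by (intro mult_left_mono) (auto simp: \<rho>_def)
    then show ?thesis using C by simp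
  qed
  let ?q = "1 - \<rho>\<^sup>2 / 10"
  have \<rho>2: "0 < \<rho>\<^sup>2" "\<rho>\<^sup>2 \<le> 1" using \<rho> by (auto simp: power_le_one)
  have q: "0 < ?q" "?q < 1" using \<rho>2 by linarith+
  obtain m where m: "?q ^ m < \<epsilon> / (2 * (3 * C))"
    using real_arch_pow_inv[of "\<epsilon> / (2 * (3 * C))" ?q] q \<epsilon> C by auto
  show ?thesis
  proof (rule that[of m])
    fix g :: "complex \<Rightarrow> 'a" and M and z :: complex assume cont: "continuous_on (cball 0 1) g"
      and bnd: "\<And>w. w \<in> cball 0 1 \<Longrightarrow> norm (g w) \<le> M * (1 + (cmod w)\<^sup>2) ^ m" and z: "z \<in> cball 0 1"
    have M: "0 \<le> M" by (rule order_trans[OF norm_ge_zero[of "g 0"]]) (use bnd[of 0] in simp)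
    note [measurable] = retract_measurable[OF cont]
    define W where "W w = (1 - (cmod (w - z))\<^sup>2 / 10) ^ m * near_kernel 1 z 3 w" for w
    define H where "H w = near_kernel 1 z \<rho> w + ?q ^ m * near_kernel 1 z 3 w" for w
    have WH: "W w \<le> H w" for w
    proof (cases "norm (w - z) < \<rho>")
      case True
      have "(cmod (w - z))\<^sup>2 \<le> 1\<^sup>2" using True \<rho> by (intro power_mono) auto
      then have "(1 - (cmod (w - z))\<^sup>2 / 10) ^ m \<le> 1" by (intro power_le_one) auto
      then have "W w \<le> 1 * near_kernel 1 z 3 w" unfolding W_def by (intro mult_right_mono near_far_nonneg)
      also have "\<dots> = near_kernel 1 z \<rho> w" using True \<rho> by (simp add: near_kernel_def dist_norm norm_minus_commute)
      also have "\<dots> \<le> H w" unfolding H_def using q near_far_nonneg(1)[of 1 z 3 w] by simp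
      finally show ?thesis .
    next
      case False
      show ?thesis
      proof (cases "w \<in> ball z 3")
        case True
        then have "(cmod (w - z))\<^sup>2 \<le> 3\<^sup>2" by (intro power_mono) (auto simp: dist_norm norm_minus_commute)
        moreover have "\<rho>\<^sup>2 \<le> (cmod (w - z))\<^sup>2" using False \<rho> by (intro power_mono) auto
        ultimately have "(1 - (cmod (w - z))\<^sup>2 / 10) ^ m \<le> ?q ^ m" by (intro power_mono) auto
        then have "W w \<le> ?q ^ m * near_kernel 1 z 3 w" unfolding W_def by (intro mult_right_mono near_far_nonneg)
        then show ?thesis unfolding H_def using near_far_nonneg(1)[of 1 z \<rho> w] by simp
      next
        case False
        then have "near_kernel 1 z 3 w = 0" by (simp add: near_kernel_def)
        then show ?thesis unfolding W_def H_def using near_far_nonneg(1)[of 1 z \<rho> w] by simp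
      qed
    qed
    let ?c = "9 * M * (1 + (cmod z)\<^sup>2) ^ m"
    have c0: "0 \<le> ?c" using M by (intro mult_nonneg_nonneg zero_le_power) auto
    have intH: "integrable lborel H" unfolding H_def[abs_def] using C(2) \<rho> by (intro Bochner_Integration.integrable_add integrable_mult_right) auto
    have "integral\<^sup>L lborel H = integral\<^sup>L lborel (near_kernel 1 z \<rho>) + ?q ^ m * integral\<^sup>L lborel (near_kernel 1 z 3)"
      unfolding H_def[abs_def] using C(2) \<rho> by (subst Bochner_Integration.integral_add) (auto intro: integrable_mult_right)
    also have "\<dots> \<le> C * \<rho> + \<epsilon> / (2 * (3 * C)) * (C * 3)"
      using C(3)[of \<rho> z] C(3)[of 3 z] \<rho> m q C(1) \<epsilon>
      by (intro add_mono mult_mono) (auto intro!: integral_nonneg_AE simp: near_far_nonneg)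
    also have "\<dots> \<le> \<epsilon>" using \<rho>C C(1) by simp
    finally have IH: "integral\<^sup>L lborel (\<lambda>w. ?c * H w) \<le> ?c * \<epsilon>" using c0 by (simp add: mult_left_mono)
    have "norm (\<integral>w. act (fs_kernel m z w) (g (disc_retract w)) \<partial>lborel) \<le> 2 * (?c * \<epsilon>)"
    proof (rule act_integral(2)[where G = "\<lambda>w. ?c * H w"])
      show "AE w in lborel. norm (fs_kernel m z w) * norm (g (disc_retract w)) \<le> ?c * H w"
        using AE_lborel_singleton[of z]
      proof eventually_elim
        case (elim w)
        \<comment> \<open>The growth hypothesis is applied at the projected point, whose weight is
          at most that of \<open>w\<close>.\<close>
        have "norm (g (disc_retract w)) \<le> M * (1 + (cmod (disc_retract w))\<^sup>2) ^ m" by (rule bnd[OF disc_retract(1)])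
        also have "\<dots> \<le> M * (1 + (cmod w)\<^sup>2) ^ m"
          using M by (intro mult_left_mono power_mono add_left_mono) (auto intro!: power_mono disc_retract)
        finally have "norm (fs_kernel m z w) * norm (g (disc_retract w)) \<le> norm (fs_kernel m z w) * (M * (1 + (cmod w)\<^sup>2) ^ m)"
          by (rule mult_left_mono) simp
        also have "\<dots> = M * (norm (fs_kernel m z w) * (1 + (cmod w)\<^sup>2) ^ m)" by simp
        also have "\<dots> \<le> M * (9 * (1 + (cmod z)\<^sup>2) ^ m * W w)"
          unfolding W_def using z elim by (intro mult_left_mono fs_kernel_weighted_bound M) auto
        also have "\<dots> = ?c * W w" by simp
        also have "\<dots> \<le> ?c * H w" by (rule mult_left_mono[OF WH c0])
        finally show ?case .
      qed
    qed (use intH IH in auto)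
    then have "(1 / (2 * cauchy_const)) * norm (\<integral>w. act (fs_kernel m z w) (g (disc_retract w)) \<partial>lborel) \<le> (1 / (2 * cauchy_const)) * (2 * (?c * \<epsilon>))"
      by (rule mult_left_mono) (use cc in simp)
    then have "norm (dbar_inv m g z) \<le> (1 / (2 * cauchy_const)) * (2 * (?c * \<epsilon>))"
      unfolding dbar_inv_def norm_scaleR using cc by simp
    also have "\<dots> = \<eta> * M * (1 + (cmod z)\<^sup>2) ^ m" using cc by (simp add: \<epsilon>_def)
    finally show "norm (dbar_inv m g z) \<le> \<eta> * M * (1 + (cmod z)\<^sup>2) ^ m" .
  qed
qed

end

section \<open>Hoelder regularity and first-order expansion of the transform\<close>

lemma indicator_cball_integral:
  "integrable lborel (indicator (cball (0::complex) 2) :: complex \<Rightarrow> real)"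
  "(\<integral>w. indicator (cball (0::complex) 2) w \<partial>lborel) \<le> (16::real)"
proof -
  show "integrable lborel (indicator (cball (0::complex) 2) :: complex \<Rightarrow> real)"
    by (rule integrable_real_indicator) (auto intro!: emeasure_bounded_finite[unfolded infinity_ennreal_def])
  show "(\<integral>w. indicator (cball (0::complex) 2) w \<partial>lborel) \<le> (16::real)"
    using pi_less_4 by (simp add: content_cball unit_ball_vol_2)
qed

lemma chi_ell_bound:
  assumes "\<And>w. norm w \<le> 2 \<Longrightarrow> norm (e w) \<le> C" "0 \<le> C"
  shows "norm (complex_of_real (chi w) * e w) \<le> 9 * C * indicator (cball 0 2) w"
proof (cases "norm w \<le> 2")
  case True
  have "norm (complex_of_real (chi w) * e w) \<le> 9 * C"
    unfolding norm_mult norm_of_real by (intro mult_mono chi_bound assms True) auto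
  then show ?thesis using True by simp
qed (simp add: chi_outer)

context linear_complex_structure
begin

lemma dbar_inv_integrable:
  assumes cont: "continuous_on (cball 0 1) g" and bnd: "\<And>w. w \<in> cball 0 1 \<Longrightarrow> norm (g w) \<le> M" and z: "z \<in> cball 0 1"
  shows "integrable lborel (\<lambda>w. act (fs_kernel m z w) (g (disc_retract w)))"
proof -
  have z1: "norm z \<le> 1" using z by simp
  note [measurable] = retract_measurable[OF cont]
  obtain C where C: "C > 0" "\<And>r a. r > 0 \<Longrightarrow> integrable lborel (near_kernel 1 a r)"
    "\<And>r a. r > 0 \<Longrightarrow> integral\<^sup>L lborel (near_kernel 1 a r) \<le> C * r powr (2 - 1)"
    using near_kernel_integral[of 1] by auto
  obtain D where D: "D \<ge> 0" "\<And>w. norm w \<le> 2 \<Longrightarrow> norm (fs_correction m z w) \<le> D"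
    using fs_correction_taylor[of m] z1 by metis
  have M: "0 \<le> M" using bnd[of 0] by (meson centre_in_cball norm_ge_zero order_trans zero_le_one)
  let ?G = "\<lambda>w. (9 * 1 * near_kernel 1 z 3 w + 9 * D * indicator (cball 0 2) w) * M"
  show ?thesis
  proof (rule act_integral(1)[where G = ?G and C = "integral\<^sup>L lborel ?G"])
    show "integrable lborel ?G"
      using C(2)[of 3 z] indicator_cball_integral(1)
      by (intro integrable_mult_left Bochner_Integration.integrable_add integrable_mult_right) auto
    show "AE w in lborel. norm (fs_kernel m z w) * norm (g (disc_retract w)) \<le> ?G w"
      using AE_lborel_singleton[of z]
    proof eventually_elim
      case (elim w)
      have "norm (fs_kernel m z w) \<le> \<bar>chi w\<bar> * norm (1 / (z - w)) + norm (of_real (chi w) * fs_correction m z w)"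
        unfolding fs_kernel_def distrib_left by (rule order_trans[OF norm_triangle_ineq]) (simp add: norm_mult norm_divide)
      also have "\<dots> \<le> 9 * 1 * near_kernel 1 z 3 w + 9 * D * indicator (cball 0 2) w"
      proof (rule add_mono)
        show "\<bar>chi w\<bar> * norm (1 / (z - w)) \<le> 9 * 1 * near_kernel 1 z 3 w"
          by (rule chi_over_bound[OF z1]) (use elim in \<open>auto simp: norm_divide norm_inverse powr_minus norm_minus_commute divide_inverse\<close>)
        show "norm (of_real (chi w) * fs_correction m z w) \<le> 9 * D * indicator (cball 0 2) w"
          by (rule chi_ell_bound) (use D in auto)
      qed
      finally show ?case using bnd[OF disc_retract(1), of w] M by (intro mult_mono) (auto intro!: add_nonneg_nonneg mult_nonneg_nonneg near_far_nonneg D)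
    qed
  qed auto
qed

lemma dbar_inv_add:
  assumes "continuous_on (cball 0 1) f" "continuous_on (cball 0 1) g" "z \<in> cball 0 1"
  shows "dbar_inv m (\<lambda>z. f z + g z) z = dbar_inv m f z + dbar_inv m g z"
proof -
  have "\<exists>M. \<forall>w\<in>cball 0 1. norm (f w) \<le> M" if "continuous_on (cball 0 1) f" for f :: "complex \<Rightarrow> 'a"
    using compact_imp_bounded[OF compact_continuous_image[OF that compact_cball]] by (auto simp: bounded_iff)
  then obtain M N where M: "\<And>w. w \<in> cball 0 1 \<Longrightarrow> norm (f w) \<le> M" and N: "\<And>w. w \<in> cball 0 1 \<Longrightarrow> norm (g w) \<le> N"
    using assms(1,2) by metis
  show ?thesis unfolding dbar_inv_def
    using dbar_inv_integrable[OF assms(1) M assms(3)] dbar_inv_integrable[OF assms(2) N assms(3)]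
    by (simp add: act.add_right scaleR_add_right)
qed

text \<open>Merely bounded data have a Hoelder continuous transform. This gain lets the residuals of
  the Neumann series, which contract only in a supremum norm, recover Hoelder bounds.\<close>

lemma dbar_inv_diff_kernel:
  assumes \<alpha>: "0 < \<alpha>" "\<alpha> < 1"
  obtains C where "C \<ge> 0" "\<And>g M z z'. continuous_on (cball 0 1) g \<Longrightarrow> (\<And>w. w \<in> cball 0 1 \<Longrightarrow> norm (g w) \<le> M) \<Longrightarrow>
     z \<in> cball 0 1 \<Longrightarrow> z' \<in> cball 0 1 \<Longrightarrow> norm (dbar_inv m g z - dbar_inv m g z') \<le> C * M * norm (z - z') powr \<alpha>"
proof -
  note cc = cauchy_const_pos
  obtain C1 where C1: "C1 > 0" "\<And>r a. r > 0 \<Longrightarrow> integrable lborel (near_kernel (1 + \<alpha>) a r)"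
    "\<And>r a. r > 0 \<Longrightarrow> integral\<^sup>L lborel (near_kernel (1 + \<alpha>) a r) \<le> C1 * r powr (2 - (1 + \<alpha>))"
    using near_kernel_integral[of "1 + \<alpha>"] \<alpha> by auto
  obtain D where D: "D \<ge> 0" 
    "\<And>z z' w. norm z \<le> 1 \<Longrightarrow> norm z' \<le> 1 \<Longrightarrow> norm w \<le> 2 \<Longrightarrow> norm (fs_correction m z' w - fs_correction m z w) \<le> D * norm (z' - z)"
    using fs_correction_taylor[of m] by metis
  \<comment> \<open>In the first term \<open>36\<close> is \<open>9 * 2\<close> from
    \<open>chi\<close> and the interpolation inequality, doubled for the two poles. In the second,
    \<open>18\<close> is \<open>9 * 2\<close> with the \<open>2\<close> of
    \<open>norm_le_two_powr\<close>, and \<open>16\<close> bounds the area of the disc of radius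
    2.\<close>
  define K where "K = 36 * C1 * 3 powr (1 - \<alpha>) + 18 * D * 16"
  have K: "K \<ge> 0" using C1 D by (simp add: K_def)
  show ?thesis
  proof (rule that[of "K / cauchy_const"])
    fix g :: "complex \<Rightarrow> 'a" and M and z z' :: complex assume cont: "continuous_on (cball 0 1) g"
      and bnd: "\<And>w. w \<in> cball 0 1 \<Longrightarrow> norm (g w) \<le> M" and z: "z \<in> cball 0 1" and z': "z' \<in> cball 0 1"
    have z1: "norm z \<le> 1" "norm z' \<le> 1" using z z' by simp_all
    note [measurable] = retract_measurable[OF cont]
    have M: "0 \<le> M" using bnd[of 0] by (meson centre_in_cball norm_ge_zero order_trans zero_le_one)
    let ?p = "norm (z - z') powr \<alpha>"
    let ?H = "\<lambda>w. 18 * near_kernel (1 + \<alpha>) z 3 w + 18 * near_kernel (1 + \<alpha>) z' 3 w + 18 * D * indicator (cball 0 2) w"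
    have intH: "integrable lborel ?H"
      using C1(2)[of 3 z] C1(2)[of 3 z'] indicator_cball_integral(1)
      by (intro Bochner_Integration.integrable_add integrable_mult_right) auto
    have "integral\<^sup>L lborel ?H = 18 * integral\<^sup>L lborel (near_kernel (1 + \<alpha>) z 3) + 18 * integral\<^sup>L lborel (near_kernel (1 + \<alpha>) z' 3)
        + 18 * D * (\<integral>w. indicator (cball (0::complex) 2) w \<partial>lborel)"
      using C1(2)[of 3 z] C1(2)[of 3 z'] indicator_cball_integral(1) by simp
    also have "\<dots> \<le> 18 * (C1 * 3 powr (1 - \<alpha>)) + 18 * (C1 * 3 powr (1 - \<alpha>)) + 18 * D * 16"
      using C1(3)[of 3 z] C1(3)[of 3 z'] D by (intro add_mono mult_left_mono indicator_cball_integral) auto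
    also have "\<dots> = K" by (simp add: K_def)
    finally have IH: "integral\<^sup>L lborel ?H \<le> K" .
    have eq: "dbar_inv m g z - dbar_inv m g z' = (1 / (2 * cauchy_const)) *\<^sub>R (\<integral>w. act (fs_kernel m z w - fs_kernel m z' w) (g (disc_retract w)) \<partial>lborel)"
      using dbar_inv_integrable[OF cont bnd z] dbar_inv_integrable[OF cont bnd z']
      by (simp add: dbar_inv_def act.diff_left scaleR_diff_right)
    have "norm (\<integral>w. act (fs_kernel m z w - fs_kernel m z' w) (g (disc_retract w)) \<partial>lborel) \<le> 2 * (?p * M * K)"
    proof (rule act_integral(2)[where G = "\<lambda>w. ?p * M * ?H w"])
      show "integrable lborel (\<lambda>w. ?p * M * ?H w)" by (rule integrable_mult_right) (rule intH)
      show "(\<integral>w. ?p * M * ?H w \<partial>lborel) \<le> ?p * M * K"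
        unfolding integral_mult_right_zero using IH M by (intro mult_left_mono) auto
      show "AE w in lborel. norm (fs_kernel m z w - fs_kernel m z' w) * norm (g (disc_retract w)) \<le> ?p * M * ?H w"
        using AE_lborel_singleton[of z] AE_lborel_singleton[of z']
      proof eventually_elim
        case (elim w)
        have "norm (1 / (z - w) - 1 / (z' - w)) \<le> 2 * norm ((z - w) - (z' - w)) powr \<alpha> * (norm (z - w) powr -(1 + \<alpha>) + norm (z' - w) powr -(1 + \<alpha>))"
          by (rule inverse_diff_bound[OF \<alpha>]) (use elim in auto)
        then have i: "norm (1 / (z - w) - 1 / (z' - w)) \<le> 2 * ?p * norm (w - z) powr -(1 + \<alpha>) + 2 * ?p * norm (w - z') powr -(1 + \<alpha>)"
          by (simp add: norm_minus_commute algebra_simps)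
        have "\<bar>chi w\<bar> * norm (1 / (z - w) - 1 / (z' - w)) \<le> \<bar>chi w\<bar> * (2 * ?p * norm (w - z) powr -(1 + \<alpha>)) + \<bar>chi w\<bar> * (2 * ?p * norm (w - z') powr -(1 + \<alpha>))"
          using mult_left_mono[OF i, of "\<bar>chi w\<bar>"] by (simp add: distrib_left)
        also have "\<dots> \<le> 9 * (2 * ?p) * near_kernel (1 + \<alpha>) z 3 w + 9 * (2 * ?p) * near_kernel (1 + \<alpha>) z' 3 w"
          by (intro add_mono chi_over_bound) (use z1 elim in auto)
        finally have 1: "norm (of_real (chi w) * (1 / (z - w) - 1 / (z' - w))) \<le> 9 * (2 * ?p) * near_kernel (1 + \<alpha>) z 3 w + 9 * (2 * ?p) * near_kernel (1 + \<alpha>) z' 3 w"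
          by (simp add: norm_mult)
        have 2: "norm (of_real (chi w) * (fs_correction m z w - fs_correction m z' w)) \<le> 9 * (D * (2 * ?p)) * indicator (cball 0 2) w"
        proof (rule chi_ell_bound)
          fix w :: complex assume w: "norm w \<le> 2"
          have "norm (fs_correction m z w - fs_correction m z' w) \<le> D * norm (z - z')" by (rule D) (use z1 w in auto)
          also have "\<dots> \<le> D * (2 * ?p)" by (intro mult_left_mono norm_le_two_powr \<alpha> z1 D)
          finally show "norm (fs_correction m z w - fs_correction m z' w) \<le> D * (2 * ?p)" .
        qed (use D in auto)
        have "fs_kernel m z w - fs_kernel m z' w = of_real (chi w) * (1 / (z - w) - 1 / (z' - w)) + of_real (chi w) * (fs_correction m z w - fs_correction m z' w)"
          by (simp add: fs_kernel_def algebra_simps)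
        then have "norm (fs_kernel m z w - fs_kernel m z' w) \<le> norm (of_real (chi w) * (1 / (z - w) - 1 / (z' - w))) + norm (of_real (chi w) * (fs_correction m z w - fs_correction m z' w))"
          by (simp only: norm_triangle_ineq)
        also have "\<dots> \<le> ?p * ?H w" using add_mono[OF 1 2] by (simp add: algebra_simps)
        finally have "norm (fs_kernel m z w - fs_kernel m z' w) * norm (g (disc_retract w)) \<le> (?p * ?H w) * M"
          using bnd[OF disc_retract(1), of w] D
          by (intro mult_mono) (auto intro!: mult_nonneg_nonneg add_nonneg_nonneg near_far_nonneg)
        then show ?case by (simp add: mult_ac)
      qed
    qed measurable
    then have "(1 / (2 * cauchy_const)) * norm (\<integral>w. act (fs_kernel m z w - fs_kernel m z' w) (g (disc_retract w)) \<partial>lborel)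
       \<le> (1 / (2 * cauchy_const)) * (2 * (?p * M * K))"
      by (rule mult_left_mono) (use cc in simp)
    then show "norm (dbar_inv m g z - dbar_inv m g z') \<le> K / cauchy_const * M * ?p"
      unfolding eq norm_scaleR using cc by (simp add: mult_ac)
  qed (use K cc in auto)
qed

text \<open>Both points lie where \<open>bar_cut\<close> is conjugation. This is the source of the
  term with \<open>cnj (z' - z)\<close> in the expansion of the transform.\<close>

lemma chi_difference_integral:
  assumes "z \<in> cball 0 1" "z' \<in> cball 0 1"
  shows "integrable lborel (\<lambda>w. of_real (chi w) * (1 / (z' - w) - 1 / (z - w)) :: complex)"
    "(\<integral>w. of_real (chi w) * (1 / (z' - w) - 1 / (z - w)) \<partial>lborel) = of_real cauchy_const * cnj (z' - z)"
proof -
  have int: "integrable lborel (\<lambda>w. of_real (chi w) / (z - w) :: complex)" for z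
    by (rule Bochner_Integration.integrable_bound[OF chi_cauchy_integrable[of z]]) (auto simp: norm_divide)
  have eq: "of_real (chi w) * (1 / (z' - w) - 1 / (z - w)) = of_real (chi w) / (z' - w) - of_real (chi w) / (z - w :: complex)" for w
    by (simp add: right_diff_distrib)
  show "integrable lborel (\<lambda>w. of_real (chi w) * (1 / (z' - w) - 1 / (z - w)) :: complex)"
    unfolding eq by (rule Bochner_Integration.integrable_diff[OF int int])
  show "(\<integral>w. of_real (chi w) * (1 / (z' - w) - 1 / (z - w)) \<partial>lborel) = of_real cauchy_const * cnj (z' - z)"
    unfolding eq using int assms by (simp add: chi_cauchy_integral bar_cut_inner algebra_simps)
qed

lemma dbar_inv_expansion:
  assumes \<alpha>: "0 < \<alpha>" "\<alpha> < 1"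
  obtains C where "C \<ge> 0" "\<And>g M. hoelder_le \<alpha> M g \<Longrightarrow> \<exists>D. \<forall>z\<in>cball 0 1. norm (D z) \<le> C * M \<and> (\<forall>z'\<in>cball 0 1.
     norm (dbar_inv m g z' - dbar_inv m g z - act (z' - z) (D z) - (1/2) *\<^sub>R act (cnj (z' - z)) (g z)) \<le> C * M * norm (z' - z) powr (1 + \<alpha>))"
proof -
  note cc = cauchy_const_pos
  obtain C1 where C1: "C1 > 0" "\<And>r a. r > 0 \<Longrightarrow> integrable lborel (near_kernel 1 a r)"
    "\<And>r a. r > 0 \<Longrightarrow> integral\<^sup>L lborel (near_kernel 1 a r) \<le> C1 * r powr (2 - 1)"
    using near_kernel_integral[of 1] by auto
  obtain C2 where C2: "C2 > 0" "\<And>r a. r > 0 \<Longrightarrow> integrable lborel (near_kernel (2 - \<alpha>) a r)"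
    "\<And>r a. r > 0 \<Longrightarrow> integral\<^sup>L lborel (near_kernel (2 - \<alpha>) a r) \<le> C2 * r powr (2 - (2 - \<alpha>))"
    using near_kernel_integral[of "2 - \<alpha>"] \<alpha> by auto
  obtain C3 where C3: "C3 > 0" "\<And>r a. r > 0 \<Longrightarrow> integrable lborel (far_kernel (3 - \<alpha>) a r)"
    "\<And>r a. r > 0 \<Longrightarrow> integral\<^sup>L lborel (far_kernel (3 - \<alpha>) a r) \<le> C3 * r powr (2 - (3 - \<alpha>))"
    using far_kernel_integral[of "3 - \<alpha>"] \<alpha> by auto
  obtain E d where E: "E \<ge> 0" and dm: "\<And>z. d z \<in> borel_measurable borel"
    and E2: "\<And>z z' w. norm z \<le> 1 \<Longrightarrow> norm w \<le> 2 \<Longrightarrow> norm (d z w) \<le> E"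
    and E3: "\<And>z z' w. norm z \<le> 1 \<Longrightarrow> norm z' \<le> 1 \<Longrightarrow> norm w \<le> 2 \<Longrightarrow>
       norm (fs_correction m z' w - fs_correction m z w - d z w * (z' - z)) \<le> E * (norm (z' - z))\<^sup>2"
    using fs_correction_taylor[of m] by metis
  note [measurable] = dm
  \<comment> \<open>Up to the common factors, \<open>K1\<close> collects the remainder estimates and
    \<open>K2\<close> bounds \<open>D\<close>.\<close>
  define K1 where "K1 = 9 * (12 * C1 + 4 * C2 + 4 * C3) + 9 * (2 * E) * 16"
  define K2 where "K2 = 9 * (C2 * 3 powr \<alpha>) + 9 * E * 16"
  define K where "K = max K1 K2"
  have "K2 \<ge> 0" using C2(1) E by (simp add: K2_def)
  then have K: "K \<ge> 0" by (simp add: K_def le_max_iff_disj)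
  show ?thesis
  proof (rule that[of "K / cauchy_const"])
    fix g :: "complex \<Rightarrow> 'a" and M assume g: "hoelder_le \<alpha> M g"
    have cont: "continuous_on (cball 0 1) g" by (rule hoelder_le_continuous[OF g \<alpha>(1)])
    have bnd: "\<And>w. w \<in> cball 0 1 \<Longrightarrow> norm (g w) \<le> M" using hoelder_leD(1)[OF g] .
    have M: "0 \<le> M" using g by (rule hoelder_le_nonneg)
    note gm[measurable] = retract_measurable[OF cont]
    have gdiff: "norm (g (disc_retract w) - g z) \<le> M * norm (w - z) powr \<alpha>" if z: "z \<in> cball 0 1" for w z
    proof -
      have "norm (g (disc_retract w) - g z) \<le> M * norm (disc_retract w - z) powr \<alpha>"
        by (rule hoelder_leD(2)[OF g disc_retract(1) z])
      also have "\<dots> \<le> M * norm (w - z) powr \<alpha>"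
        using disc_retract(3)[of w z] disc_retract(2)[OF z] M \<alpha> by (intro mult_left_mono powr_mono2) auto
      finally show ?thesis .
    qed
    \<comment> \<open>The \<open>z\<close>-derivative of the kernel: its singular part acts on
      \<open>g - g z\<close>, its bounded part \<open>d\<close> on \<open>g\<close> itself.\<close>
    define I1 where "I1 z w = act (of_real (chi w) * (- 1 / (z - w)\<^sup>2)) (g (disc_retract w) - g z)" for z w
    define I2 where "I2 z w = act (of_real (chi w) * d z w) (g (disc_retract w))" for z w
    define D where "D z = (1 / (2 * cauchy_const)) *\<^sub>R (integral\<^sup>L lborel (I1 z) + integral\<^sup>L lborel (I2 z))" for z
    have I1: "integrable lborel (I1 z)" "norm (integral\<^sup>L lborel (I1 z)) \<le> 2 * (M * (9 * (C2 * 3 powr \<alpha>)))"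
      if z: "z \<in> cball 0 1" for z
    proof -
      have G: "integrable lborel (\<lambda>w. M * (9 * near_kernel (2 - \<alpha>) z 3 w))"
        "AE w in lborel. norm (of_real (chi w) * (- 1 / (z - w)\<^sup>2) :: complex) * norm (g (disc_retract w) - g z) \<le> M * (9 * near_kernel (2 - \<alpha>) z 3 w)"
        "(\<integral>w. M * (9 * near_kernel (2 - \<alpha>) z 3 w) \<partial>lborel) \<le> M * (9 * (C2 * 3 powr \<alpha>))"
      proof -
        show "integrable lborel (\<lambda>w. M * (9 * near_kernel (2 - \<alpha>) z 3 w))" using C2(2)[of 3 z] by simp
        show "(\<integral>w. M * (9 * near_kernel (2 - \<alpha>) z 3 w) \<partial>lborel) \<le> M * (9 * (C2 * 3 powr \<alpha>))"
          using C2(3)[of 3 z] M by (simp add: mult_left_mono)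
        show "AE w in lborel. norm (of_real (chi w) * (- 1 / (z - w)\<^sup>2) :: complex) * norm (g (disc_retract w) - g z) \<le> M * (9 * near_kernel (2 - \<alpha>) z 3 w)"
          using AE_lborel_singleton[of z]
        proof eventually_elim
          case (elim w)
          have "\<bar>chi w\<bar> * (norm (1 / (z - w)\<^sup>2) * norm (g (disc_retract w) - g z)) \<le> 9 * M * near_kernel (2 - \<alpha>) z 3 w"
          proof (rule chi_over_bound)
            have "norm (1 / (z - w)\<^sup>2) * norm (g (disc_retract w) - g z) \<le> norm (1 / (z - w)\<^sup>2) * (M * norm (w - z) powr \<alpha>)"
              by (intro mult_left_mono gdiff z) auto
            also have "\<dots> = M * norm (w - z) powr -(2 - \<alpha>)"
              using elim by (simp add: norm_divide norm_power norm_minus_commute powr_diff)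
            finally show "norm (1 / (z - w)\<^sup>2) * norm (g (disc_retract w) - g z) \<le> M * norm (w - z) powr -(2 - \<alpha>)" .
          qed (use z M elim in auto)
          then show ?case by (simp add: norm_mult norm_divide mult_ac)
        qed
      qed
      show "integrable lborel (I1 z)" unfolding I1_def[abs_def] by (rule act_integral(1)[OF _ _ G]) measurable
      show "norm (integral\<^sup>L lborel (I1 z)) \<le> 2 * (M * (9 * (C2 * 3 powr \<alpha>)))"
        unfolding I1_def[abs_def] by (rule act_integral(2)[OF _ _ G]) measurable
    qed
    have ib: "integrable lborel (\<lambda>w. M * (9 * X * indicator (cball (0::complex) 2) w))"
        "(\<integral>w. M * (9 * X * indicator (cball (0::complex) 2) w) \<partial>lborel) \<le> M * (9 * X * 16)" if "0 \<le> X" for X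
    proof -
      show "integrable lborel (\<lambda>w. M * (9 * X * indicator (cball (0::complex) 2) w))"
        by (intro integrable_mult_right) (use indicator_cball_integral(1) in auto)
      have "(\<integral>w. M * (9 * X * indicator (cball (0::complex) 2) w) \<partial>lborel) = M * (9 * X * (\<integral>w. indicator (cball (0::complex) 2) w \<partial>lborel))"
        by (simp only: integral_mult_right_zero)
      also have "\<dots> \<le> M * (9 * X * 16)" using M that by (intro mult_left_mono indicator_cball_integral) auto
      finally show "(\<integral>w. M * (9 * X * indicator (cball (0::complex) 2) w) \<partial>lborel) \<le> M * (9 * X * 16)" .
    qed
    have ebd: "AE w in lborel. norm (of_real (chi w) * e w :: complex) * norm (g (disc_retract w)) \<le> M * (9 * X * indicator (cball 0 2) w)"
      if "\<And>w. norm w \<le> 2 \<Longrightarrow> norm (e w) \<le> X" "0 \<le> X" for e X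
    proof (intro AE_I2)
      fix w :: complex
      have "norm (of_real (chi w) * e w) * norm (g (disc_retract w)) \<le> (9 * X * indicator (cball 0 2) w) * M"
        by (intro mult_mono chi_ell_bound that bnd disc_retract(1)) (use that in auto)
      then show "norm (of_real (chi w) * e w :: complex) * norm (g (disc_retract w)) \<le> M * (9 * X * indicator (cball 0 2) w)"
        by (simp add: mult_ac)
    qed
    have I2: "integrable lborel (I2 z)" "norm (integral\<^sup>L lborel (I2 z)) \<le> 2 * (M * (9 * E * 16))"
      if z: "z \<in> cball 0 1" for z
    proof -
      have z1: "norm z \<le> 1" using z by simp
      note G = ib(1)[OF E] ebd[OF E2[OF z1] E] ib(2)[OF E]
      show "integrable lborel (I2 z)" unfolding I2_def[abs_def] by (rule act_integral(1)[OF _ _ G]) measurable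
      show "norm (integral\<^sup>L lborel (I2 z)) \<le> 2 * (M * (9 * E * 16))" unfolding I2_def[abs_def] by (rule act_integral(2)[OF _ _ G]) measurable
    qed
    have Dbound: "norm (D z) \<le> K / cauchy_const * M" if z: "z \<in> cball 0 1" for z
    proof -
      have "norm (integral\<^sup>L lborel (I1 z) + integral\<^sup>L lborel (I2 z)) \<le> 2 * (M * (9 * (C2 * 3 powr \<alpha>))) + 2 * (M * (9 * E * 16))"
        by (rule order_trans[OF norm_triangle_ineq]) (intro add_mono I1 I2 z)
      also have "\<dots> = 2 * M * K2" by (simp add: K2_def algebra_simps)
      also have "\<dots> \<le> 2 * M * K" using M by (intro mult_left_mono) (auto simp: K_def)
      finally have "(1 / (2 * cauchy_const)) * norm (integral\<^sup>L lborel (I1 z) + integral\<^sup>L lborel (I2 z)) \<le> (1 / (2 * cauchy_const)) * (2 * M * K)"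
        by (rule mult_left_mono) (use cc in simp)
      then show ?thesis unfolding D_def norm_scaleR using cc by (simp add: mult_ac)
    qed
    have expand: "norm (dbar_inv m g z' - dbar_inv m g z - act (z' - z) (D z) - (1/2) *\<^sub>R act (cnj (z' - z)) (g z)) \<le> K / cauchy_const * M * norm (z' - z) powr (1 + \<alpha>)"
      if z: "z \<in> cball 0 1" and z': "z' \<in> cball 0 1" for z z'
    proof (cases "z' = z")
      case True
      then show ?thesis by (simp add: act.zero_left)
    next
      case False
      define h where "h = z' - z"
      have h: "h \<noteq> 0" "z' = z + h" using False by (auto simp: h_def)
      have z1: "norm z \<le> 1" "norm z' \<le> 1" using z z' by auto
      have hn: "0 < norm h" "norm h \<le> 2" using h(1) norm_triangle_ineq4[of z' z] z1 by (auto simp: h_def)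
      let ?p = "norm h powr (1 + \<alpha>)"
      let ?R = "\<lambda>w. 1 / (z' - w) - 1 / (z - w) + h / (z - w)\<^sup>2"
      let ?L = "\<lambda>w. fs_correction m z' w - fs_correction m z w - d z w * h"
      let ?X = "\<lambda>w. act (of_real (chi w) * ?R w) (g (disc_retract w) - g z)"
      let ?Y = "\<lambda>w. act (of_real (chi w) * ?L w) (g (disc_retract w))"
      \<comment> \<open>The majorant of \<open>inverse_taylor_bound\<close>. The singularity at
        \<open>z'\<close> has order 1, the one at \<open>z\<close> order 2 - \<alpha>, and the decay
        at infinity order 3 - \<alpha>, so all three terms are integrable.\<close>
      define G where "G w = 4 * norm h powr \<alpha> * near_kernel 1 z' (3 * norm h) w
       + 2 * norm h * near_kernel (2 - \<alpha>) z (2 * norm h) w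
       + 2 * (norm h)\<^sup>2 * far_kernel (3 - \<alpha>) z (2 * norm h) w" for w
      have intG: "integrable lborel G" unfolding G_def[abs_def] using C1(2) C2(2) C3(2) hn by simp
      have "integral\<^sup>L lborel G = 4 * norm h powr \<alpha> * integral\<^sup>L lborel (near_kernel 1 z' (3 * norm h))
       + 2 * norm h * integral\<^sup>L lborel (near_kernel (2 - \<alpha>) z (2 * norm h))
       + 2 * (norm h)\<^sup>2 * integral\<^sup>L lborel (far_kernel (3 - \<alpha>) z (2 * norm h))"
        unfolding G_def[abs_def] using C1(2) C2(2) C3(2) hn by simp
      also have "\<dots> \<le> 4 * norm h powr \<alpha> * (C1 * (3 * norm h) powr (2 - 1)) + 2 * norm h * (C2 * (2 * norm h) powr (2 - (2 - \<alpha>)))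
         + 2 * (norm h)\<^sup>2 * (C3 * (2 * norm h) powr (2 - (3 - \<alpha>)))"
        using hn by (intro add_mono mult_left_mono C1(3) C2(3) C3(3)) auto
      also have "\<dots> \<le> 12 * C1 * ?p + 4 * C2 * ?p + 4 * C3 * ?p"
      proof (intro add_mono)
        show "4 * norm h powr \<alpha> * (C1 * (3 * norm h) powr (2 - 1)) \<le> 12 * C1 * ?p"
          using hn by (simp add: powr_add)
        have t: "(2::real) powr \<alpha> \<le> 2 powr 1" "(2::real) powr (\<alpha> - 1) \<le> 2 powr 0" using powr_mono[of \<alpha> 1 "2::real"] powr_mono[of "\<alpha> - 1" 0 "2::real"] \<alpha> by auto
        have "2 * norm h * (C2 * (2 * norm h) powr (2 - (2 - \<alpha>))) = 2 powr \<alpha> * (2 * C2 * ?p)"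
          using hn by (simp add: powr_add powr_mult)
        also have "\<dots> \<le> 2 * (2 * C2 * ?p)" using t C2(1) by (intro mult_right_mono) auto
        finally show "2 * norm h * (C2 * (2 * norm h) powr (2 - (2 - \<alpha>))) \<le> 4 * C2 * ?p" by simp
        have "2 * (norm h)\<^sup>2 * (C3 * (2 * norm h) powr (2 - (3 - \<alpha>))) = 2 powr (\<alpha> - 1) * (2 * C3 * ?p)"
          using hn by (simp add: powr_add powr_mult powr_diff power2_eq_square)
        also have "\<dots> \<le> 1 * (2 * C3 * ?p)" using t C3(1) by (intro mult_right_mono) auto
        also have "\<dots> \<le> 4 * C3 * ?p" using C3(1) by simp
        finally show "2 * (norm h)\<^sup>2 * (C3 * (2 * norm h) powr (2 - (3 - \<alpha>))) \<le> 4 * C3 * ?p" .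
      qed
      finally have IG: "integral\<^sup>L lborel G \<le> (12 * C1 + 4 * C2 + 4 * C3) * ?p" by (simp add: algebra_simps)
      have X: "integrable lborel ?X" "norm (integral\<^sup>L lborel ?X) \<le> 2 * (9 * M * ((12 * C1 + 4 * C2 + 4 * C3) * ?p))"
      proof -
        have G: "integrable lborel (\<lambda>w. 9 * M * G w)"
          "AE w in lborel. norm (of_real (chi w) * ?R w) * norm (g (disc_retract w) - g z) \<le> 9 * M * G w"
          "(\<integral>w. 9 * M * G w \<partial>lborel) \<le> 9 * M * ((12 * C1 + 4 * C2 + 4 * C3) * ?p)"
        proof -
          show "integrable lborel (\<lambda>w. 9 * M * G w)" using intG by simp
          show "(\<integral>w. 9 * M * G w \<partial>lborel) \<le> 9 * M * ((12 * C1 + 4 * C2 + 4 * C3) * ?p)"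
            unfolding integral_mult_right_zero using M IG by (intro mult_left_mono) auto
          show "AE w in lborel. norm (of_real (chi w) * ?R w) * norm (g (disc_retract w) - g z) \<le> 9 * M * G w"
            using AE_lborel_singleton[of z] AE_lborel_singleton[of z']
          proof eventually_elim
            case (elim w)
            have "norm (of_real (chi w) * ?R w) * norm (g (disc_retract w) - g z) \<le> (9 * norm (?R w)) * (M * norm (w - z) powr \<alpha>)"
              unfolding norm_mult norm_of_real by (intro mult_mono gdiff z chi_bound mult_right_mono) auto
            also have "\<dots> = 9 * M * (norm (?R w) * norm (w - z) powr \<alpha>)" by simp
            also have "\<dots> \<le> 9 * M * G w" unfolding G_def h(2)
              using elim h M by (intro mult_left_mono inverse_taylor_bound \<alpha>) auto
            finally show ?case .
          qed
        qed
        show "integrable lborel ?X" by (rule act_integral(1)[OF _ _ G]) measurable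
        show "norm (integral\<^sup>L lborel ?X) \<le> 2 * (9 * M * ((12 * C1 + 4 * C2 + 4 * C3) * ?p))"
          by (rule act_integral(2)[OF _ _ G]) measurable
      qed
      have Y: "integrable lborel ?Y" "norm (integral\<^sup>L lborel ?Y) \<le> 2 * (M * (9 * (2 * E * ?p) * 16))"
      proof -
        have h2: "(norm h)\<^sup>2 \<le> 2 * ?p"
        proof -
          have "norm h * norm h \<le> norm h * (2 * norm h powr \<alpha>)"
            using norm_le_two_powr[OF \<alpha> z1(2,1)] by (intro mult_left_mono) (auto simp: h_def)
          then show ?thesis using hn by (simp add: power2_eq_square powr_add mult_ac)
        qed
        have e: "norm (?L w) \<le> 2 * E * ?p" if "norm w \<le> 2" for w
        proof -
          have "norm (?L w) \<le> E * (norm h)\<^sup>2" using E3[OF z1 that] by (simp add: h_def)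
          also have "\<dots> \<le> E * (2 * ?p)" by (intro mult_left_mono h2 E)
          finally show ?thesis by simp
        qed
        have E0: "0 \<le> 2 * E * ?p" using E by simp
        note G = ib(1)[OF E0] ebd[OF e E0] ib(2)[OF E0]
        show "integrable lborel ?Y" by (rule act_integral(1)[OF _ _ G]) measurable
        show "norm (integral\<^sup>L lborel ?Y) \<le> 2 * (M * (9 * (2 * E * ?p) * 16))" by (rule act_integral(2)[OF _ _ G]) measurable
      qed
      have iact: "integrable lborel (\<lambda>w. act h (F w))" "(\<integral>w. act h (F w) \<partial>lborel) = act h (integral\<^sup>L lborel F)"
        if "integrable lborel F" for F :: "complex \<Rightarrow> 'a"
        using that integrable_bounded_linear[OF act.bounded_linear_right] integral_bounded_linear[OF act.bounded_linear_right] by blast+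
      let ?c = "\<lambda>w. of_real (chi w) * (1 / (z' - w) - 1 / (z - w)) :: complex"
      have cact: "integrable lborel (\<lambda>w. act (?c w) (g z))" "(\<integral>w. act (?c w) (g z) \<partial>lborel) = act (of_real cauchy_const * cnj h) (g z)"
        using chi_difference_integral[OF z z'] integrable_bounded_linear[OF act.bounded_linear_left chi_difference_integral(1)[OF z z'], of "g z"]
          integral_bounded_linear[OF act.bounded_linear_left chi_difference_integral(1)[OF z z'], of "g z"] by (simp_all add: h_def)
      let ?S = "\<lambda>z w. act (fs_kernel m z w) (g (disc_retract w))"
      have S: "integrable lborel (?S z)" "integrable lborel (?S z')"
        using dbar_inv_integrable[OF cont bnd] z z' by auto
      have pw: "?S z' w - ?S z w - act h (I1 z w + I2 z w) - act (?c w) (g z) = ?X w + ?Y w" for w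
      proof -
        have 1: "act h (I1 z w + I2 z w) = act (h * (of_real (chi w) * (- 1 / (z - w)\<^sup>2))) (g (disc_retract w) - g z)
            + act (h * (of_real (chi w) * d z w)) (g (disc_retract w))"
          by (simp only: I1_def I2_def act.add_right act_mult)
        have 2: "?S z' w - ?S z w = act (?c w) (g z) + act (?c w) (g (disc_retract w) - g z) + act (of_real (chi w) * (fs_correction m z' w - fs_correction m z w)) (g (disc_retract w))"
          unfolding act.add_right[symmetric] by (simp add: fs_kernel_def algebra_simps flip: act.add_left act.diff_left)
        have 3: "of_real (chi w) * ?R w = ?c w - h * (of_real (chi w) * (- 1 / (z - w)\<^sup>2))" by (simp add: algebra_simps)
        have 4: "of_real (chi w) * ?L w = of_real (chi w) * (fs_correction m z' w - fs_correction m z w) - h * (of_real (chi w) * d z w)" by (simp add: algebra_simps)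
        show ?thesis unfolding 1 2 3 4 act.diff_left by simp
      qed
      have "integral\<^sup>L lborel ?X + integral\<^sup>L lborel ?Y = (\<integral>w. ?S z' w - ?S z w - act h (I1 z w + I2 z w) - act (?c w) (g z) \<partial>lborel)"
        unfolding pw using X(1) Y(1) by simp
      also have "\<dots> = integral\<^sup>L lborel (?S z') - integral\<^sup>L lborel (?S z) - act h (integral\<^sup>L lborel (I1 z) + integral\<^sup>L lborel (I2 z)) - act (of_real cauchy_const * cnj h) (g z)"
        using S I1(1)[OF z] I2(1)[OF z] cact iact by simp
      finally have eq: "integral\<^sup>L lborel ?X + integral\<^sup>L lborel ?Y = \<dots>" .
      have "dbar_inv m g z' - dbar_inv m g z - act h (D z) - (1/2) *\<^sub>R act (cnj h) (g z) = (1 / (2 * cauchy_const)) *\<^sub>R (integral\<^sup>L lborel ?X + integral\<^sup>L lborel ?Y)"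
        unfolding eq dbar_inv_def D_def using cc by (simp add: scaleR_diff_right act.scaleR_right act_mult act_of_real)
      then have "norm (dbar_inv m g z' - dbar_inv m g z - act h (D z) - (1/2) *\<^sub>R act (cnj h) (g z)) = (1 / (2 * cauchy_const)) * norm (integral\<^sup>L lborel ?X + integral\<^sup>L lborel ?Y)"
        using cc by simp
      also have "\<dots> \<le> (1 / (2 * cauchy_const)) * (2 * M * ?p * K)"
      proof (rule mult_left_mono)
        have "norm (integral\<^sup>L lborel ?X + integral\<^sup>L lborel ?Y) \<le> 2 * (9 * M * ((12 * C1 + 4 * C2 + 4 * C3) * ?p)) + 2 * (M * (9 * (2 * E * ?p) * 16))"
          by (rule order_trans[OF norm_triangle_ineq]) (intro add_mono X Y)
        also have "\<dots> = 2 * M * ?p * K1" by (simp add: K1_def algebra_simps)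
        also have "\<dots> \<le> 2 * M * ?p * K" using M by (intro mult_left_mono) (auto simp: K_def)
        finally show "norm (integral\<^sup>L lborel ?X + integral\<^sup>L lborel ?Y) \<le> 2 * M * ?p * K" .
      qed (use cc in simp)
      also have "\<dots> = K / cauchy_const * M * ?p" using cc by simp
      finally show ?thesis by (simp add: h_def)
    qed
    show "\<exists>D. \<forall>z\<in>cball 0 1. norm (D z) \<le> K / cauchy_const * M \<and> (\<forall>z'\<in>cball 0 1.
     norm (dbar_inv m g z' - dbar_inv m g z - act (z' - z) (D z) - (1/2) *\<^sub>R act (cnj (z' - z)) (g z)) \<le> K / cauchy_const * M * norm (z' - z) powr (1 + \<alpha>))"
      using Dbound expand by blast
  qed (use K cc in auto)
qed

end

section \<open>Series of Hoelder functions and the Neumann series\<close>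

lemma hoelder_le_suminf:
  fixes f :: "nat \<Rightarrow> complex \<Rightarrow> 'a::banach"
  assumes f: "\<And>n. hoelder_le \<alpha> (A n) (f n)" and A: "summable A"
  shows "z \<in> cball 0 1 \<Longrightarrow> summable (\<lambda>n. f n z)" "hoelder_le \<alpha> (suminf A) (\<lambda>z. \<Sum>n. f n z)"
proof -
  have sn: "summable (\<lambda>n. norm (f n z))" if "z \<in> cball 0 1" for z
    by (rule summable_comparison_test'[OF A, of 0]) (use hoelder_leD(1)[OF f that] in auto)
  show s: "summable (\<lambda>n. f n z)" if "z \<in> cball 0 1" for z
    by (rule summable_norm_cancel[OF sn[OF that]])
  show "hoelder_le \<alpha> (suminf A) (\<lambda>z. \<Sum>n. f n z)"
  proof (rule hoelder_leI)
    fix z :: complex assume z: "z \<in> cball 0 1"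
    have "norm (\<Sum>n. f n z) \<le> (\<Sum>n. norm (f n z))" by (rule summable_norm[OF sn[OF z]])
    also have "\<dots> \<le> suminf A" by (rule suminf_le[OF _ sn[OF z] A]) (rule hoelder_leD(1)[OF f z])
    finally show "norm (\<Sum>n. f n z) \<le> suminf A" .
    fix z' :: complex assume z': "z' \<in> cball 0 1"
    let ?p = "norm (z - z') powr \<alpha>"
    have Ap: "summable (\<lambda>n. A n * ?p)" using A by (rule summable_mult2)
    have sd: "summable (\<lambda>n. norm (f n z - f n z'))"
      by (rule summable_comparison_test'[OF Ap, of 0]) (use hoelder_leD(2)[OF f z z'] in auto)
    have "(\<Sum>n. f n z) - (\<Sum>n. f n z') = (\<Sum>n. f n z - f n z')" by (rule suminf_diff[OF s s]) fact+
    also have "norm \<dots> \<le> (\<Sum>n. norm (f n z - f n z'))" by (rule summable_norm[OF sd])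
    also have "\<dots> \<le> (\<Sum>n. A n * ?p)" by (rule suminf_le[OF _ sd Ap]) (rule hoelder_leD(2)[OF f z z'])
    also have "\<dots> = suminf A * ?p" using suminf_mult2[OF A] by simp
    finally show "norm ((\<Sum>n. f n z) - (\<Sum>n. f n z')) \<le> suminf A * ?p" .
  qed
qed

text \<open>The product rule for the seminorm: one summand varies the argument, the other the
  operator, hence the factor 2.\<close>

lemma hoelder_le_family:
  fixes B :: "complex \<Rightarrow> 'a::real_normed_vector \<Rightarrow> 'b::real_normed_vector"
  assumes lin: "\<And>z. linear (B z)" and b: "0 \<le> b"
    and B1: "\<And>z v. z \<in> cball 0 1 \<Longrightarrow> norm (B z v) \<le> b * norm v"
    and B2: "\<And>z z' v. z \<in> cball 0 1 \<Longrightarrow> z' \<in> cball 0 1 \<Longrightarrow> norm (B z v - B z' v) \<le> b * norm (z - z') powr \<alpha> * norm v"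
    and U: "hoelder_le \<alpha> M U"
  shows "hoelder_le \<alpha> (2 * b * M) (\<lambda>z. B z (U z))"
proof (rule hoelder_leI)
  have M: "0 \<le> M" using U by (rule hoelder_le_nonneg)
  fix z :: complex assume z: "z \<in> cball 0 1"
  have "norm (B z (U z)) \<le> b * M" using B1[OF z, of "U z"] mult_left_mono[OF hoelder_leD(1)[OF U z] b] by linarith
  also have "\<dots> \<le> 2 * b * M" using M b by simp
  finally show "norm (B z (U z)) \<le> 2 * b * M" .
  fix z' :: complex assume z': "z' \<in> cball 0 1"
  have "B z (U z) - B z' (U z') = B z (U z - U z') + (B z (U z') - B z' (U z'))"
    by (simp add: linear_diff[OF lin])
  then have "norm (B z (U z) - B z' (U z')) \<le> norm (B z (U z - U z')) + norm (B z (U z') - B z' (U z'))"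
    by (simp only: norm_triangle_ineq)
  also have "\<dots> \<le> b * (M * norm (z - z') powr \<alpha>) + b * norm (z - z') powr \<alpha> * M"
    by (intro add_mono order_trans[OF B1] order_trans[OF B2] mult_left_mono hoelder_leD[OF U] z z') (use b in auto)
  finally show "norm (B z (U z) - B z' (U z')) \<le> 2 * b * M * norm (z - z') powr \<alpha>" by (simp add: algebra_simps)
qed

context linear_complex_structure
begin

text \<open>The series identities hold on the disc only; this is enough because the transform sees
  its datum through the projection onto the disc.\<close>

lemma dbar_inv_cong: "(\<And>z. z \<in> cball 0 1 \<Longrightarrow> f z = g z) \<Longrightarrow> dbar_inv m f = dbar_inv m g"
  unfolding dbar_inv_def fun_eq_iff using disc_retract(1) by simp

text \<open>Campanato's argument turns the expansion into partial derivatives. The Hoelder bound of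
  the transform itself enters as a parameter \<open>K\<close>, since it comes from the separate
  estimates in the supremum norm.\<close>

lemma dbar_inv_C1:
  assumes \<alpha>: "0 < \<alpha>" "\<alpha> < 1"
  obtains C where "C \<ge> 0" "\<And>u N K. hoelder_le \<alpha> N u \<Longrightarrow> hoelder_le \<alpha> (K * N) (dbar_inv m u) \<Longrightarrow> 0 \<le> K \<Longrightarrow>
     \<exists>Ux Uy. c1_le \<alpha> ((C + K) * N) (dbar_inv m u) Ux Uy \<and> (\<forall>z\<in>cball 0 1. Ux z + J0 (Uy z) = u z)"
proof (rule dbar_inv_expansion[OF \<alpha>, of m])
  fix C assume C: "C \<ge> 0" and ex: "\<And>g M. hoelder_le \<alpha> M g \<Longrightarrow> \<exists>D. \<forall>z\<in>cball 0 1. norm (D z) \<le> C * M \<and> (\<forall>z'\<in>cball 0 1.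
     norm (dbar_inv m g z' - dbar_inv m g z - act (z' - z) (D z) - (1/2) *\<^sub>R act (cnj (z' - z)) (g z)) \<le> C * M * norm (z' - z) powr (1 + \<alpha>))"
  show ?thesis
  \<comment> \<open>Campanato's constant accounts for \<open>64 * C\<close>; the remaining
    \<open>C + 1\<close> covers the bound \<open>C * N + N\<close> of the derivatives
    themselves.\<close>
  proof (rule that[of "65 * C + 1"])
    fix u :: "complex \<Rightarrow> 'a" and N K assume u: "hoelder_le \<alpha> N u" and SK: "hoelder_le \<alpha> (K * N) (dbar_inv m u)" and K: "0 \<le> K"
    have N: "0 \<le> N" using u by (rule hoelder_le_nonneg)
    obtain D where D1: "\<And>z. z \<in> cball 0 1 \<Longrightarrow> norm (D z) \<le> C * N"
      and D2: "\<And>z z'. z \<in> cball 0 1 \<Longrightarrow> z' \<in> cball 0 1 \<Longrightarrow>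
       norm (dbar_inv m u z' - dbar_inv m u z - act (z' - z) (D z) - (1/2) *\<^sub>R act (cnj (z' - z)) (u z)) \<le> C * N * norm (z' - z) powr (1 + \<alpha>)"
      using ex[OF u] by blast
    \<comment> \<open>A map with differential \<open>h D + cnj h u / 2\<close>, where complex
      scalars act through \<open>J0\<close>, has these partial derivatives in the directions
      \<open>1\<close> and \<open>\<i>\<close>.\<close>
    define Ux where "Ux z = D z + (1/2) *\<^sub>R u z" for z
    define Uy where "Uy z = J0 (D z) - (1/2) *\<^sub>R J0 (u z)" for z
    note Jl = linear_add[OF linear_J0] linear_cmul[OF linear_J0] linear_diff[OF linear_J0]
    have app: "norm (dbar_inv m u z' - dbar_inv m u z - Re (z' - z) *\<^sub>R Ux z - Im (z' - z) *\<^sub>R Uy z) \<le> C * N * norm (z' - z) powr (1 + \<alpha>)"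
      if "norm z \<le> 1" "norm z' \<le> 1" for z z'
    proof -
      have eq: "dbar_inv m u z' - dbar_inv m u z - act (z' - z) (D z) - (1/2) *\<^sub>R act (cnj (z' - z)) (u z) = dbar_inv m u z' - dbar_inv m u z - Re (z' - z) *\<^sub>R Ux z - Im (z' - z) *\<^sub>R Uy z"
        by (simp add: Ux_def Uy_def act_def diff_divide_distrib algebra_simps)
      have "z \<in> cball 0 1" "z' \<in> cball 0 1" using that by simp_all
      from D2[OF this] show ?thesis unfolding eq .
    qed
    have CN: "0 \<le> C * N" using C N by simp
    note camp = campanato[OF \<alpha> CN app]
    let ?T = "(65 * C + 1 + K) * N"
    have T: "64 * (C * N) \<le> ?T" "C * N + N \<le> ?T" "K * N \<le> ?T"
      using CN N mult_nonneg_nonneg[OF K N] by (auto simp: algebra_simps)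
    have bU: "norm (Ux z) \<le> C * N + N" "norm (Uy z) \<le> C * N + N" if z: "z \<in> cball 0 1" for z
    proof -
      have "norm (Ux z) \<le> norm (D z) + (1/2) * norm (u z)"
        unfolding Ux_def by (rule order_trans[OF norm_triangle_ineq]) simp
      then show "norm (Ux z) \<le> C * N + N" using D1[OF z] hoelder_leD(1)[OF u z] N by linarith
      have "norm (Uy z) \<le> norm (J0 (D z)) + (1/2) * norm (J0 (u z))"
        unfolding Uy_def by (rule order_trans[OF norm_triangle_ineq4]) simp
      then show "norm (Uy z) \<le> C * N + N" using norm_J0[of "D z"] norm_J0[of "u z"] D1[OF z] hoelder_leD(1)[OF u z] N by linarith
    qed
    have "c1_le \<alpha> ?T (dbar_inv m u) Ux Uy"
      unfolding c1_le_def
    proof (intro conjI ballI)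
      show "hoelder_le \<alpha> ?T (dbar_inv m u)" by (rule hoelder_le_mono[OF SK T(3)])
      have p: "64 * (C * N) * norm (z - z') powr \<alpha> \<le> ?T * norm (z - z') powr \<alpha>" for z z' :: complex
        by (intro mult_right_mono T) auto
      show "hoelder_le \<alpha> ?T Ux"
      proof (rule hoelder_leI)
        show "norm (Ux z) \<le> ?T" if "z \<in> cball 0 1" for z by (rule order_trans[OF bU(1)[OF that] T(2)])
        show "norm (Ux z - Ux z') \<le> ?T * norm (z - z') powr \<alpha>" if "z \<in> cball 0 1" "z' \<in> cball 0 1" for z z'
          by (rule order_trans[OF camp(1) p]) (use that in auto)
      qed
      show "hoelder_le \<alpha> ?T Uy"
      proof (rule hoelder_leI)
        show "norm (Uy z) \<le> ?T" if "z \<in> cball 0 1" for z by (rule order_trans[OF bU(2)[OF that] T(2)])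
        show "norm (Uy z - Uy z') \<le> ?T * norm (z - z') powr \<alpha>" if "z \<in> cball 0 1" "z' \<in> cball 0 1" for z z'
          by (rule order_trans[OF camp(2) p]) (use that in auto)
      qed
      show "(dbar_inv m u has_derivative (\<lambda>h. Re h *\<^sub>R Ux z + Im h *\<^sub>R Uy z)) (at z within cball 0 1)" if "z \<in> cball 0 1" for z
        using camp(3) that by simp
    qed
    moreover have "Ux z + J0 (Uy z) = u z" for z
      by (simp add: Ux_def Uy_def Jl J0_J0 flip: scaleR_add_left)
    ultimately show "\<exists>Ux Uy. c1_le \<alpha> ?T (dbar_inv m u) Ux Uy \<and> (\<forall>z\<in>cball 0 1. Ux z + J0 (Uy z) = u z)" by blast
  qed (use C in auto)
qed

text \<open>With \<open>S = dbar_inv m\<close> the ansatz \<open>U = S u\<close> leads to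
  \<open>u + B (S u) = g\<close>. The residuals \<open>r (Suc n) = - B (S (r n))\<close> halve in
  the weighted supremum norm. Their Hoelder bounds follow from the supremum bound of the preceding
  residual, because \<open>S\<close> gains regularity, and so decay at the same rate; the map need
  not contract in the Hoelder norm.\<close>

theorem perturbed_dbar_solvable:
  assumes \<alpha>: "0 < \<alpha>" "\<alpha> < 1" and lin: "\<And>z. linear (B z)" and b: "0 \<le> b"
    and B1: "\<And>z v. z \<in> cball 0 1 \<Longrightarrow> norm (B z v) \<le> b * norm v"
    and B2: "\<And>z z' v. z \<in> cball 0 1 \<Longrightarrow> z' \<in> cball 0 1 \<Longrightarrow> norm (B z v - B z' v) \<le> b * norm (z - z') powr \<alpha> * norm v"
  obtains C where "C \<ge> 0" "\<And>g M. hoelder_le \<alpha> M g \<Longrightarrow>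
     \<exists>U Ux Uy. c1_le \<alpha> (C * M) U Ux Uy \<and> (\<forall>z\<in>cball 0 1. Ux z + J0 (Uy z) + B z (U z) = g z)"
proof -
  \<comment> \<open>The inequality \<open>b * \<eta> \<le> 1 / 2\<close> makes the residuals halve,
    and \<open>\<eta> \<le> 1\<close> bounds the transform of bounded data by
    \<open>P\<close>.\<close>
  define \<eta> where "\<eta> = 1 / (2 * (b + 1))"
  have \<eta>: "\<eta> > 0" "b * \<eta> \<le> 1 / 2" "\<eta> \<le> 1" using b by (auto simp: \<eta>_def field_simps)
  obtain m where W: "\<And>g M z. continuous_on (cball 0 1) g \<Longrightarrow> (\<And>w. w \<in> cball 0 1 \<Longrightarrow> norm (g w) \<le> M * (1 + (cmod w)\<^sup>2) ^ m) \<Longrightarrow>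
     z \<in> cball 0 1 \<Longrightarrow> norm (dbar_inv m g z) \<le> \<eta> * M * (1 + (cmod z)\<^sup>2) ^ m"
    using dbar_inv_weighted[OF \<eta>(1)] by blast
  obtain C2 where C2: "C2 \<ge> 0" "\<And>g M z z'. continuous_on (cball 0 1) g \<Longrightarrow> (\<And>w. w \<in> cball 0 1 \<Longrightarrow> norm (g w) \<le> M) \<Longrightarrow>
     z \<in> cball 0 1 \<Longrightarrow> z' \<in> cball 0 1 \<Longrightarrow> norm (dbar_inv m g z - dbar_inv m g z') \<le> C2 * M * norm (z - z') powr \<alpha>"
    using dbar_inv_diff_kernel[OF \<alpha>, of m] by blast
  obtain C3 where C3: "C3 \<ge> 0" "\<And>u N K. hoelder_le \<alpha> N u \<Longrightarrow> hoelder_le \<alpha> (K * N) (dbar_inv m u) \<Longrightarrow> 0 \<le> K \<Longrightarrow>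
     \<exists>Ux Uy. c1_le \<alpha> ((C3 + K) * N) (dbar_inv m u) Ux Uy \<and> (\<forall>z\<in>cball 0 1. Ux z + J0 (Uy z) = u z)"
    using dbar_inv_C1[OF \<alpha>, of m] by blast
  \<comment> \<open>The largest value of the weight on the closed disc; it converts weighted into
    plain supremum bounds.\<close>
  define P :: real where "P = 2 ^ m"
  have P: "P \<ge> 1" by (simp add: P_def)
  have weight: "1 \<le> (1 + (cmod z)\<^sup>2) ^ m" "(1 + (cmod z)\<^sup>2) ^ m \<le> P" if "z \<in> cball 0 1" for z
    using that by (auto simp: P_def power_le_one intro!: power_mono one_le_power)
  define K where "K = P + C2"
  have K: "K \<ge> 0" using P C2 by (simp add: K_def)
  have SK: "hoelder_le \<alpha> (K * N) (dbar_inv m g)"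
    if cont: "continuous_on (cball 0 1) g" and bd: "\<And>w. w \<in> cball 0 1 \<Longrightarrow> norm (g w) \<le> N" for g N
  proof (rule hoelder_leI)
    have N: "0 \<le> N" by (rule order_trans[OF norm_ge_zero bd[of 0]]) simp
    fix z :: complex assume z: "z \<in> cball 0 1"
    have "norm (dbar_inv m g z) \<le> \<eta> * N * (1 + (cmod z)\<^sup>2) ^ m"
    proof (rule W[OF cont _ z])
      fix w :: complex assume w: "w \<in> cball 0 1"
      have "norm (g w) \<le> N * 1" using bd[OF w] by simp
      also have "\<dots> \<le> N * (1 + (cmod w)\<^sup>2) ^ m" by (intro mult_left_mono weight w N)
      finally show "norm (g w) \<le> N * (1 + (cmod w)\<^sup>2) ^ m" .
    qed
    also have "\<dots> \<le> 1 * N * P" by (intro mult_mono weight z \<eta> mult_nonneg_nonneg N) (use \<eta> N in auto)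
    also have "\<dots> \<le> K * N" using mult_nonneg_nonneg[OF C2(1) N] by (simp add: K_def algebra_simps)
    finally show "norm (dbar_inv m g z) \<le> K * N" .
    fix z' :: complex assume z': "z' \<in> cball 0 1"
    have "norm (dbar_inv m g z - dbar_inv m g z') \<le> C2 * N * norm (z - z') powr \<alpha>" by (rule C2(2)[OF cont bd z z'])
    also have "\<dots> \<le> K * N * norm (z - z') powr \<alpha>" using P N by (intro mult_right_mono) (auto simp: K_def)
    finally show "norm (dbar_inv m g z - dbar_inv m g z') \<le> K * N * norm (z - z') powr \<alpha>" .
  qed
  \<comment> \<open>The \<open>4\<close> is the \<open>2\<close> of the product estimate times the
    \<open>2\<close> lost in passing from the residual \<open>k\<close> to its successor; the
    \<open>1\<close> accounts for \<open>r 0 = g\<close>.\<close>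
  define Q where "Q = 1 + 4 * b * K * P"
  have Q: "Q \<ge> 1" using b K P by (simp add: Q_def)
  show ?thesis
  proof (rule that[of "(C3 + K) * (2 * Q)"])
    fix g :: "complex \<Rightarrow> 'a" and M assume g: "hoelder_le \<alpha> M g"
    have M: "0 \<le> M" using g by (rule hoelder_le_nonneg)
    define r where "r = rec_nat g (\<lambda>n f z. - B z (dbar_inv m f z))"
    have r0: "r 0 = g" and rS: "r (Suc n) = (\<lambda>z. - B z (dbar_inv m (r n) z))" for n by (simp_all add: r_def)
    have neg: "hoelder_le \<alpha> (2 * b * N) (\<lambda>z. - B z (U z))" if U: "hoelder_le \<alpha> N U" for U N
    proof -
      have "hoelder_le \<alpha> (2 * b * N) (\<lambda>z. B z (U z))"
        by (rule hoelder_le_family[where B = B, OF lin b B1 B2 U])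
      then show ?thesis by (simp add: hoelder_le_def norm_minus_commute)
    qed
    have r: "continuous_on (cball 0 1) (r n) \<and> (\<forall>w\<in>cball 0 1. norm (r n w) \<le> M * (1/2) ^ n * (1 + (cmod w)\<^sup>2) ^ m)" for n
    proof (induction n)
      case 0
      have "norm (g w) \<le> M * (1 + (cmod w)\<^sup>2) ^ m" if w: "w \<in> cball 0 1" for w
      proof -
        have "norm (g w) \<le> M * 1" using hoelder_leD(1)[OF g w] by simp
        also have "\<dots> \<le> M * (1 + (cmod w)\<^sup>2) ^ m" by (intro mult_left_mono weight w M)
        finally show ?thesis .
      qed
      then show ?case using hoelder_le_continuous[OF g \<alpha>(1)] by (simp add: r0)
    next
      case (Suc n)
      then have c: "continuous_on (cball 0 1) (r n)" and bd: "\<And>w. w \<in> cball 0 1 \<Longrightarrow> norm (r n w) \<le> M * (1/2) ^ n * (1 + (cmod w)\<^sup>2) ^ m"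
        by auto
      have bP: "norm (r n w) \<le> M * (1/2) ^ n * P" if w: "w \<in> cball 0 1" for w
        by (rule order_trans[OF bd[OF w]]) (intro mult_left_mono weight w mult_nonneg_nonneg M, simp)
      have "norm (r (Suc n) w) \<le> M * (1/2) ^ Suc n * (1 + (cmod w)\<^sup>2) ^ m" if w: "w \<in> cball 0 1" for w
      proof -
        have "norm (r (Suc n) w) \<le> b * norm (dbar_inv m (r n) w)" unfolding rS using B1[OF w] by simp
        also have "\<dots> \<le> b * (\<eta> * (M * (1/2) ^ n) * (1 + (cmod w)\<^sup>2) ^ m)" by (intro mult_left_mono W c bd w b)
        also have "\<dots> = (b * \<eta>) * (M * (1/2) ^ n * (1 + (cmod w)\<^sup>2) ^ m)" by simp
        also have "\<dots> \<le> (1/2) * (M * (1/2) ^ n * (1 + (cmod w)\<^sup>2) ^ m)"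
          using M weight(1)[OF w] by (intro mult_right_mono \<eta> mult_nonneg_nonneg) auto
        finally show ?thesis by simp
      qed
      moreover have "continuous_on (cball 0 1) (r (Suc n))"
        unfolding rS by (rule hoelder_le_continuous[OF neg[OF SK[OF c bP]] \<alpha>(1)])
      ultimately show ?case by blast
    qed
    have rP: "norm (r n w) \<le> M * (1/2) ^ n * P" if w: "w \<in> cball 0 1" for w n
      by (rule order_trans[OF r[THEN conjunct2, rule_format, OF w]]) (intro mult_left_mono weight w mult_nonneg_nonneg M, simp)
    have rc: "continuous_on (cball 0 1) (r n)" for n using r by blast
    let ?A = "\<lambda>n. Q * M * (1/2) ^ n"
    have rh: "hoelder_le \<alpha> (?A n) (r n)" for n
    proof (cases n)
      case 0
      show ?thesis unfolding 0 r0 by (rule hoelder_le_mono[OF g]) (use mult_right_mono[OF Q M] in simp)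
    next
      case (Suc k)
      have "hoelder_le \<alpha> (2 * b * (K * (M * (1/2) ^ k * P))) (r n)"
        unfolding Suc rS by (rule neg[OF SK[OF rc rP]])
      moreover have "2 * b * (K * (M * (1/2) ^ k * P)) = (4 * b * K * P) * M * (1/2) ^ n" by (simp add: Suc)
      moreover have "\<dots> \<le> ?A n" using M by (intro mult_right_mono) (auto simp: Q_def)
      ultimately show ?thesis by (metis hoelder_le_mono)
    qed
    have As: "summable (\<lambda>n. ?A (n + k))" and Asum: "(\<Sum>n. ?A (n + k)) = 2 * Q * M * (1/2) ^ k" for k
    proof -
      have "(\<lambda>n. (1/2::real) ^ n) sums 2" using geometric_sums[of "1/2::real"] by simp
      from sums_mult[OF this, of "Q * M * (1/2) ^ k"]
      have "(\<lambda>n. ?A (n + k)) sums (2 * Q * M * (1/2) ^ k)" by (simp add: power_add mult_ac)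
      then show "summable (\<lambda>n. ?A (n + k))" "(\<Sum>n. ?A (n + k)) = 2 * Q * M * (1/2) ^ k"
        by (auto simp: sums_iff)
    qed
    \<comment> \<open>Additivity of the transform concerns finite sums; the tails, whose norms tend
      to zero, carry it over to the whole series.\<close>
    define tail where "tail k z = (\<Sum>n. r (n + k) z)" for k z
    define u where "u = tail 0"
    have th: "hoelder_le \<alpha> (2 * Q * M * (1/2) ^ k) (tail k)" for k
      using hoelder_le_suminf(2)[OF rh As, of k] unfolding Asum tail_def[abs_def] .
    have rs: "summable (\<lambda>n. r n z)" if "z \<in> cball 0 1" for z
      by (rule hoelder_le_suminf(1)[OF rh _ that]) (use As[of 0] in simp)
    have tS: "tail k z = r k z + tail (Suc k) z" if "z \<in> cball 0 1" for k z
    proof -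
      have "summable (\<lambda>n. r (n + k) z)" using summable_ignore_initial_segment[OF rs[OF that]] .
      from suminf_split_head[OF this] show ?thesis by (simp add: tail_def)
    qed
    have tc: "continuous_on (cball 0 1) (tail k)" for k by (rule hoelder_le_continuous[OF th \<alpha>(1)])
    have Spart: "dbar_inv m u z = (\<Sum>n<k. dbar_inv m (r n) z) + dbar_inv m (tail k) z" if z: "z \<in> cball 0 1" for k z
    proof (induction k)
      case (Suc k)
      have "dbar_inv m (tail k) = dbar_inv m (\<lambda>z. r k z + tail (Suc k) z)" by (rule dbar_inv_cong) (rule tS)
      then have "dbar_inv m (tail k) z = dbar_inv m (r k) z + dbar_inv m (tail (Suc k)) z"
        by (simp only: dbar_inv_add[OF rc tc z])
      then show ?case using Suc by simp
    qed (simp add: u_def)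
    have Ssums: "(\<lambda>n. dbar_inv m (r n) z) sums dbar_inv m u z" if z: "z \<in> cball 0 1" for z
    proof -
      have "(\<lambda>k. K * (2 * Q * M) * (1/2) ^ k) \<longlonglongrightarrow> 0"
        by (intro tendsto_mult_right_zero LIMSEQ_power_zero) simp
      then have "(\<lambda>k. dbar_inv m (tail k) z) \<longlonglongrightarrow> 0"
        by (rule Lim_null_comparison[rotated])
           (use hoelder_leD(1)[OF SK[OF tc hoelder_leD(1)[OF th]] z] in \<open>simp add: mult.assoc\<close>)
      from tendsto_diff[OF tendsto_const[of "dbar_inv m u z"] this]
      moreover have "dbar_inv m u z - dbar_inv m (tail k) z = (\<Sum>n<k. dbar_inv m (r n) z)" for k using Spart[OF z, of k] by simp
      ultimately show ?thesis unfolding sums_def by simp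
    qed
    have uh: "hoelder_le \<alpha> (2 * Q * M) u" using th[of 0] by (simp add: u_def)
    have eq: "u z + B z (dbar_inv m u z) = g z" if z: "z \<in> cball 0 1" for z
    proof -
      have "bounded_linear (B z)" using lin by (simp add: linear_conv_bounded_linear)
      from bounded_linear.sums[OF this Ssums[OF z]]
      have "(\<lambda>n. - r (Suc n) z) sums B z (dbar_inv m u z)" by (simp add: rS)
      then have "(\<lambda>n. r (Suc n) z) sums (- B z (dbar_inv m u z))" using sums_minus by fastforce
      then have "tail (Suc 0) z = - B z (dbar_inv m u z)" by (simp add: tail_def sums_iff)
      then show ?thesis using tS[OF z, of 0] by (simp add: u_def r0)
    qed
    have "hoelder_le \<alpha> (K * (2 * Q * M)) (dbar_inv m u)"
      by (rule SK[OF hoelder_le_continuous[OF uh \<alpha>(1)] hoelder_leD(1)[OF uh]])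
    then obtain Ux Uy where U: "c1_le \<alpha> ((C3 + K) * (2 * Q * M)) (dbar_inv m u) Ux Uy" "\<forall>z\<in>cball 0 1. Ux z + J0 (Uy z) = u z"
      using C3(2)[OF uh _ K] by blast
    show "\<exists>U Ux Uy. c1_le \<alpha> ((C3 + K) * (2 * Q) * M) U Ux Uy \<and> (\<forall>z\<in>cball 0 1. Ux z + J0 (Uy z) + B z (U z) = g z)"
      using U eq by (intro exI[of _ "dbar_inv m u"] exI[of _ Ux] exI[of _ Uy]) (simp add: mult.assoc)
  qed (use C3 K Q in auto)
qed

end

section \<open>Operators with variable coefficients\<close>

text \<open>The operators are bare functions, linear at every point of the plane but bounded and
  Hoelder only on the closed disc; linearity can thus be used without a membership premise.\<close>

definition op_hoelder_le :: "real \<Rightarrow> real \<Rightarrow> (complex \<Rightarrow> 'a::real_normed_vector \<Rightarrow> 'b::real_normed_vector) \<Rightarrow> bool" where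
  "op_hoelder_le \<alpha> b B \<longleftrightarrow> 0 \<le> b \<and> (\<forall>z. linear (B z)) \<and> (\<forall>z\<in>cball 0 1. \<forall>v. norm (B z v) \<le> b * norm v) \<and>
     (\<forall>z\<in>cball 0 1. \<forall>z'\<in>cball 0 1. \<forall>v. norm (B z v - B z' v) \<le> b * norm (z - z') powr \<alpha> * norm v)"

lemma op_hoelder_leD:
  assumes "op_hoelder_le \<alpha> b B"
  shows "0 \<le> b" "linear (B z)" "z \<in> cball 0 1 \<Longrightarrow> norm (B z v) \<le> b * norm v"
    "z \<in> cball 0 1 \<Longrightarrow> z' \<in> cball 0 1 \<Longrightarrow> norm (B z v - B z' v) \<le> b * norm (z - z') powr \<alpha> * norm v"
  using assms by (auto simp: op_hoelder_le_def)

lemma op_hoelder_leI: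
  assumes "0 \<le> b" "\<And>z. linear (B z)" "\<And>z v. z \<in> cball 0 1 \<Longrightarrow> norm (B z v) \<le> b * norm v"
    "\<And>z z' v. z \<in> cball 0 1 \<Longrightarrow> z' \<in> cball 0 1 \<Longrightarrow> norm (B z v - B z' v) \<le> b * norm (z - z') powr \<alpha> * norm v"
  shows "op_hoelder_le \<alpha> b B"
  using assms by (auto simp: op_hoelder_le_def)

lemma op_hoelder_le_apply:
  assumes "op_hoelder_le \<alpha> b B" "hoelder_le \<alpha> M U"
  shows "hoelder_le \<alpha> (2 * b * M) (\<lambda>z. B z (U z))"
  using op_hoelder_leD[OF assms(1)] by (intro hoelder_le_family assms(2)) auto

lemma op_hoelder_le_const:
  assumes "linear T" "\<And>v. norm (T v) \<le> c * norm v" "0 \<le> c"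
  shows "op_hoelder_le \<alpha> c (\<lambda>z. T)"
  using assms by (intro op_hoelder_leI) auto

lemma op_hoelder_le_add:
  assumes A: "op_hoelder_le \<alpha> a A" and B: "op_hoelder_le \<alpha> b B"
  shows "op_hoelder_le \<alpha> (a + b) (\<lambda>z v. A z v + B z v)"
proof (rule op_hoelder_leI)
  show "linear (\<lambda>v. A z v + B z v)" for z
    using op_hoelder_leD(2)[OF A] op_hoelder_leD(2)[OF B] by (intro linear_compose_add)
  show "norm (A z v + B z v) \<le> (a + b) * norm v" if "z \<in> cball 0 1" for z v
    using norm_triangle_ineq[of "A z v" "B z v"] op_hoelder_leD(3)[OF A that, of v] op_hoelder_leD(3)[OF B that, of v]
    by (simp add: distrib_right)
  show "norm (A z v + B z v - (A z' v + B z' v)) \<le> (a + b) * norm (z - z') powr \<alpha> * norm v"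
    if "z \<in> cball 0 1" "z' \<in> cball 0 1" for z z' v
    using norm_triangle_ineq[of "A z v - A z' v" "B z v - B z' v"] op_hoelder_leD(4)[OF A that, of v] op_hoelder_leD(4)[OF B that, of v]
    by (simp add: distrib_right add_diff_add)
qed (use op_hoelder_leD(1)[OF A] op_hoelder_leD(1)[OF B] in simp)

lemma op_hoelder_le_minus:
  assumes A: "op_hoelder_le \<alpha> a A" shows "op_hoelder_le \<alpha> a (\<lambda>z v. - A z v)"
  using op_hoelder_leD[OF A]
  by (intro op_hoelder_leI linear_compose_neg) (auto simp: norm_minus_commute)

lemma op_hoelder_le_compose:
  assumes A: "op_hoelder_le \<alpha> a A" and B: "op_hoelder_le \<alpha> b B"
  shows "op_hoelder_le \<alpha> (2 * a * b) (\<lambda>z v. A z (B z v))"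
proof (rule op_hoelder_leI)
  note ab = op_hoelder_leD(1)[OF A] op_hoelder_leD(1)[OF B]
  show "linear (\<lambda>v. A z (B z v))" for z
    using linear_compose[OF op_hoelder_leD(2)[OF B] op_hoelder_leD(2)[OF A]] by (simp add: o_def)
  have le: "norm (A z (B z' v)) \<le> a * b * norm v" if "z \<in> cball 0 1" "z' \<in> cball 0 1" for z z' v
    using op_hoelder_leD(3)[OF A that(1), of "B z' v"] mult_left_mono[OF op_hoelder_leD(3)[OF B that(2), of v] ab(1)] by simp
  show "norm (A z (B z v)) \<le> 2 * a * b * norm v" if "z \<in> cball 0 1" for z v
    using le[OF that that, of v] mult_nonneg_nonneg[OF mult_nonneg_nonneg[OF ab] norm_ge_zero[of v]] by linarith
  fix z z' :: complex and v assume z: "z \<in> cball 0 1" "z' \<in> cball 0 1"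
  let ?p = "norm (z - z') powr \<alpha>"
  have "A z (B z v) - A z' (B z' v) = A z (B z v - B z' v) + (A z (B z' v) - A z' (B z' v))"
    by (simp add: linear_diff[OF op_hoelder_leD(2)[OF A]])
  then have "norm (A z (B z v) - A z' (B z' v)) \<le> norm (A z (B z v - B z' v)) + norm (A z (B z' v) - A z' (B z' v))"
    by (simp only: norm_triangle_ineq)
  also have "\<dots> \<le> a * (b * ?p * norm v) + a * ?p * (b * norm v)"
    by (intro add_mono order_trans[OF op_hoelder_leD(3)[OF A]] order_trans[OF op_hoelder_leD(4)[OF A]] mult_left_mono
       op_hoelder_leD(3)[OF B] op_hoelder_leD(4)[OF B] z) (use ab in auto)
  finally show "norm (A z (B z v) - A z' (B z' v)) \<le> 2 * a * b * ?p * norm v" by (simp add: algebra_simps)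
qed (use op_hoelder_leD(1)[OF A] op_hoelder_leD(1)[OF B] in simp)

lemma op_hoelder_le_bilinear:
  assumes b: "bounded_bilinear ap" and K: "\<And>x y. norm (ap x y) \<le> norm x * norm y"
    and A: "hoelder_le \<alpha> M A"
  shows "op_hoelder_le \<alpha> M (\<lambda>z. ap (A z))"
proof (rule op_hoelder_leI)
  show "linear (ap (A z))" for z
    using bounded_bilinear.bounded_linear_right[OF b] bounded_linear.linear by blast
  show "norm (ap (A z) v) \<le> M * norm v" if "z \<in> cball 0 1" for z v
    by (rule order_trans[OF K mult_right_mono[OF hoelder_leD(1)[OF A that]]]) simp
  show "norm (ap (A z) v - ap (A z') v) \<le> M * norm (z - z') powr \<alpha> * norm v" if "z \<in> cball 0 1" "z' \<in> cball 0 1" for z z' v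
    unfolding bounded_bilinear.diff_left[OF b, symmetric]
    by (rule order_trans[OF K mult_right_mono[OF hoelder_leD(2)[OF A that]]]) simp
qed (rule hoelder_le_nonneg[OF A])

lemma op_hoelder_le_bilinear_left:
  assumes b: "bounded_bilinear ap" and K: "\<And>x y. norm (ap x y) \<le> norm x * norm y"
    and B: "op_hoelder_le \<alpha> c B" and y: "hoelder_le \<alpha> M y"
  shows "op_hoelder_le \<alpha> (2 * M * c) (\<lambda>z v. ap (B z v) (y z))"
  by (rule op_hoelder_le_compose[OF op_hoelder_le_bilinear[OF bounded_bilinear.flip[OF b] _ y] B])
     (use K in \<open>simp add: mult.commute\<close>)

text \<open>Hoelder continuity of the inverse follows from the resolvent identity
  \<open>R z - R z' = R z (N z' - N z) R z'\<close>, in which each inverse contributes a factor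
  \<open>1 / \<kappa>\<close>.\<close>

lemma op_hoelder_le_inverse:
  fixes N :: "complex \<Rightarrow> 'a::euclidean_space \<Rightarrow> 'a"
  assumes N: "op_hoelder_le \<alpha> b N" and \<kappa>: "\<kappa> > 0" and low: "\<And>z v. z \<in> cball 0 1 \<Longrightarrow> \<kappa> * norm v \<le> norm (N z v)"
  obtains R c where "op_hoelder_le \<alpha> c R" "\<And>z v. z \<in> cball 0 1 \<Longrightarrow> N z (R z v) = v"
    "\<And>z v. z \<in> cball 0 1 \<Longrightarrow> R z (N z v) = v"
proof -
  have inj: "inj (N z)" if "z \<in> cball 0 1" for z
  proof -
    have "v = 0" if "N z v = 0" for v using low[OF \<open>z \<in> cball 0 1\<close>, of v] that \<kappa> by (simp add: mult_le_0_iff)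
    then show ?thesis using linear_injective_0[OF op_hoelder_leD(2)[OF N]] by blast
  qed
  \<comment> \<open>The default \<open>0\<close> outside the disc keeps \<open>R z\<close> linear
    for every \<open>z\<close>.\<close>
  define R where "R z = (if z \<in> cball 0 1 then inv (N z) else (\<lambda>v. 0))" for z
  have NR: "N z (R z v) = v" "R z (N z v) = v" if z: "z \<in> cball 0 1" for z v
  proof -
    have "surj (N z)" by (rule linear_injective_imp_surjective[OF op_hoelder_leD(2)[OF N] inj[OF z]]) (rule refl)
    then show "N z (R z v) = v" using z by (simp add: R_def surj_f_inv_f)
    show "R z (N z v) = v" using z inj[OF z] by (simp add: R_def)
  qed
  have lin: "linear (R z)" for z
  proof (cases "z \<in> cball 0 1")
    case True
    show ?thesis
    proof (rule linearI)
      show "R z (x + y) = R z x + R z y" for x y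
        using injD[OF inj[OF True], of "R z (x + y)" "R z x + R z y"] by (simp add: NR[OF True] linear_add[OF op_hoelder_leD(2)[OF N]])
      show "R z (c *\<^sub>R x) = c *\<^sub>R R z x" for c x
        using injD[OF inj[OF True], of "R z (c *\<^sub>R x)" "c *\<^sub>R R z x"] by (simp add: NR[OF True] linear_cmul[OF op_hoelder_leD(2)[OF N]])
    qed
  next
    case False
    then show ?thesis unfolding R_def by (simp add: linear_zero)
  qed
  have bd: "norm (R z v) \<le> norm v / \<kappa>" if z: "z \<in> cball 0 1" for z v
    using low[OF z, of "R z v"] \<kappa> by (simp add: NR[OF z] field_simps)
  let ?c = "1 / \<kappa> + b / \<kappa>\<^sup>2"
  have b: "0 \<le> b" by (rule op_hoelder_leD(1)[OF N])
  have "op_hoelder_le \<alpha> ?c R"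
  proof (rule op_hoelder_leI)
    fix z :: complex and v assume z: "z \<in> cball 0 1"
    show "norm (R z v) \<le> ?c * norm v"
      using bd[OF z, of v] b \<kappa> by (simp add: distrib_right add_increasing2)
    fix z' :: complex assume z': "z' \<in> cball 0 1"
    let ?y = "R z' v"
    have "R z v - ?y = R z (N z' ?y - N z ?y)"
      by (simp add: linear_diff[OF lin] NR[OF z] NR[OF z'])
    then have "norm (R z v - ?y) \<le> norm (N z' ?y - N z ?y) / \<kappa>" using bd[OF z] by simp
    also have "\<dots> \<le> (b * norm (z - z') powr \<alpha> * (norm v / \<kappa>)) / \<kappa>"
    proof (rule divide_right_mono)
      have "norm (N z' ?y - N z ?y) \<le> b * norm (z' - z) powr \<alpha> * norm ?y" by (rule op_hoelder_leD(4)[OF N z' z])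
      also have "\<dots> \<le> b * norm (z' - z) powr \<alpha> * (norm v / \<kappa>)" using b by (intro mult_left_mono bd z') auto
      finally show "norm (N z' ?y - N z ?y) \<le> b * norm (z - z') powr \<alpha> * (norm v / \<kappa>)" by (simp add: norm_minus_commute)
    qed (use \<kappa> in simp)
    also have "\<dots> = b / \<kappa>\<^sup>2 * norm (z - z') powr \<alpha> * norm v" by (simp add: power2_eq_square)
    also have "\<dots> \<le> ?c * norm (z - z') powr \<alpha> * norm v" using \<kappa> by (intro mult_right_mono) auto
    finally show "norm (R z v - R z' v) \<le> ?c * norm (z - z') powr \<alpha> * norm v" .
  qed (use lin b \<kappa> in auto)
  then show ?thesis using that NR by blast
qed

section \<open>Calculus with C^{1,\<alpha>} bounds\<close>

lemma c1_leD:
  assumes "c1_le \<alpha> M U Ux Uy"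
  shows "hoelder_le \<alpha> M U" "hoelder_le \<alpha> M Ux" "hoelder_le \<alpha> M Uy"
    "z \<in> cball 0 1 \<Longrightarrow> (U has_derivative (\<lambda>h. Re h *\<^sub>R Ux z + Im h *\<^sub>R Uy z)) (at z within cball 0 1)"
  using assms by (auto simp: c1_le_def)

lemma c1_le_mono: "c1_le \<alpha> M U Ux Uy \<Longrightarrow> M \<le> M' \<Longrightarrow> c1_le \<alpha> M' U Ux Uy"
  unfolding c1_le_def using hoelder_le_mono by blast

lemma c1_le_add:
  assumes "c1_le \<alpha> M U Ux Uy" "c1_le \<alpha> N W Wx Wy"
  shows "c1_le \<alpha> (M + N) (\<lambda>z. U z + W z) (\<lambda>z. Ux z + Wx z) (\<lambda>z. Uy z + Wy z)"
  unfolding c1_le_def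
  by (intro conjI ballI hoelder_le_add c1_leD[OF assms(1)] c1_leD[OF assms(2)]
      has_derivative_eq_rhs[OF has_derivative_add[OF c1_leD(4)[OF assms(1)] c1_leD(4)[OF assms(2)]]])
     (auto simp: algebra_simps)

lemma c1_le_linear:
  assumes T: "linear (T :: 'a::euclidean_space \<Rightarrow> 'b::euclidean_space)" "\<And>v. norm (T v) \<le> c * norm v" "0 \<le> c"
    and U: "c1_le \<alpha> M U Ux Uy"
  shows "c1_le \<alpha> (2 * c * M) (\<lambda>z. T (U z)) (\<lambda>z. T (Ux z)) (\<lambda>z. T (Uy z))"
proof -
  note h = op_hoelder_le_apply[OF op_hoelder_le_const[OF T]]
  have "bounded_linear T" using T(1) by (simp add: linear_conv_bounded_linear)
  note d = bounded_linear.has_derivative[OF this c1_leD(4)[OF U]]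
  show ?thesis unfolding c1_le_def
  proof (intro conjI ballI)
    show "((\<lambda>z. T (U z)) has_derivative (\<lambda>h. Re h *\<^sub>R T (Ux z) + Im h *\<^sub>R T (Uy z))) (at z within cball 0 1)"
      if "z \<in> cball 0 1" for z
      by (rule has_derivative_eq_rhs[OF d[OF that]]) (simp only: linear_add[OF T(1)] linear_cmul[OF T(1)])
  qed (intro h c1_leD(1)[OF U] h[OF c1_leD(2)[OF U]] h[OF c1_leD(3)[OF U]])+
qed

lemma c1_le_bilinear:
  assumes b: "bounded_bilinear ap" and K: "\<And>x y. norm (ap x y) \<le> norm x * norm y"
    and A: "c1_le \<alpha> M A Ax Ay" and U: "c1_le \<alpha> N U Ux Uy"
  shows "c1_le \<alpha> (4 * M * N) (\<lambda>z. ap (A z) (U z)) (\<lambda>z. ap (Ax z) (U z) + ap (A z) (Ux z)) (\<lambda>z. ap (Ay z) (U z) + ap (A z) (Uy z))"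
proof -
  have MN: "0 \<le> M * N" by (rule mult_nonneg_nonneg[OF hoelder_le_nonneg[OF c1_leD(1)[OF A]] hoelder_le_nonneg[OF c1_leD(1)[OF U]]])
  have h: "hoelder_le \<alpha> (2 * M * N) (\<lambda>z. ap (F z) (G z))" if "hoelder_le \<alpha> M F" "hoelder_le \<alpha> N G" for F G
    using op_hoelder_le_apply[OF op_hoelder_le_bilinear[OF b K that(1)] that(2)] .
  have h2: "hoelder_le \<alpha> (4 * M * N) (\<lambda>z. F z + G z)" if "hoelder_le \<alpha> (2 * M * N) F" "hoelder_le \<alpha> (2 * M * N) G" for F G :: "complex \<Rightarrow> 'c"
    using hoelder_le_add[OF that] by (simp add: mult.assoc)
  have d: "((\<lambda>z. ap (A z) (U z)) has_derivative (\<lambda>h. Re h *\<^sub>R (ap (Ax z) (U z) + ap (A z) (Ux z)) + Im h *\<^sub>R (ap (Ay z) (U z) + ap (A z) (Uy z)))) (at z within cball 0 1)"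
    if z: "z \<in> cball 0 1" for z
    by (rule has_derivative_eq_rhs[OF bounded_bilinear.FDERIV[OF b c1_leD(4)[OF A z] c1_leD(4)[OF U z]]])
       (simp add: fun_eq_iff bounded_bilinear.add_left[OF b] bounded_bilinear.add_right[OF b]
         bounded_bilinear.scaleR_left[OF b] bounded_bilinear.scaleR_right[OF b] scaleR_add_right)
  show ?thesis unfolding c1_le_def
    by (intro conjI ballI d h2 h c1_leD[OF A] c1_leD[OF U] hoelder_le_mono[OF h[OF c1_leD(1)[OF A] c1_leD(1)[OF U]]])
       (use MN in auto)
qed

lemma c1_le_minus: "c1_le \<alpha> M U Ux Uy \<Longrightarrow> c1_le \<alpha> M (\<lambda>z. - U z) (\<lambda>z. - Ux z) (\<lambda>z. - Uy z)"
  unfolding c1_le_def hoelder_le_def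
  by (auto simp: norm_minus_commute intro!: has_derivative_eq_rhs[OF has_derivative_minus])

text \<open>The substitution \<open>W = U - A J0 U\<close> conjugates \<open>A\<close> to the constant structure \<open>J0\<close>, because
  \<open>A (1 - A J0) = A + J0 = (1 - A J0) J0\<close>; moreover \<open>1 - A J0 = - A (A + J0)\<close> is invertible.\<close>

theorem (in linear_complex_structure) variable_structure_solvable:
  fixes ap :: "'m::real_normed_vector \<Rightarrow> 'a \<Rightarrow> 'a"
  assumes \<alpha>: "0 < \<alpha>" "\<alpha> < 1" and bil: "bounded_bilinear ap" and K: "\<And>x y. norm (ap x y) \<le> norm x * norm y"
    and A: "c1_le \<alpha> M A Ax Ay"
    and sq: "\<And>z v. z \<in> cball 0 1 \<Longrightarrow> ap (A z) (ap (A z) v) = - v"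
    and inj: "\<And>z v. z \<in> cball 0 1 \<Longrightarrow> ap (A z) v + J0 v = 0 \<Longrightarrow> v = 0"
    and a: "op_hoelder_le \<alpha> c a"
  obtains C where "C \<ge> 0" "\<And>g N. hoelder_le \<alpha> N g \<Longrightarrow>
     \<exists>W Wx Wy. c1_le \<alpha> (C * N) W Wx Wy \<and> (\<forall>z\<in>cball 0 1. Wx z + ap (A z) (Wy z) + a z (W z) = g z)"
proof -
  note Jop = op_hoelder_le_const[OF linear_J0, of 1 \<alpha>, simplified, OF norm_J0]
  note apl = bounded_bilinear.add_right[OF bil] bounded_bilinear.add_left[OF bil] bounded_bilinear.diff_right[OF bil]
    bounded_bilinear.minus_right[OF bil] bounded_bilinear.minus_left[OF bil]
  define N where "N z v = v - ap (A z) (J0 v)" for z v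
  have idop: "op_hoelder_le \<alpha> 1 (\<lambda>z v::'a. v)" by (rule op_hoelder_le_const) (auto intro: linear_id[unfolded id_def])
  have Aop: "op_hoelder_le \<alpha> M (\<lambda>z v. ap (F z) v)" if "hoelder_le \<alpha> M F" for F
    using op_hoelder_le_bilinear[OF bil K that] .
  have Nop: "op_hoelder_le \<alpha> (1 + 2 * M * 1) N"
    using op_hoelder_le_add[OF idop op_hoelder_le_minus[OF op_hoelder_le_compose[OF Aop[OF c1_leD(1)[OF A]] Jop]]]
    by (simp add: N_def[abs_def])
  have N_inj: "v = 0" if z: "z \<in> cball 0 1" and "N z v = 0" for z v
  proof (rule inj[OF z])
    have "v = ap (A z) (J0 v)" using that by (simp add: N_def)
    then have "ap (A z) v = ap (A z) (ap (A z) (J0 v))" by simp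
    also have "\<dots> = - J0 v" by (rule sq[OF z])
    finally show "ap (A z) v + J0 v = 0" by simp
  qed
  \<comment> \<open>The constant is the minimum of \<open>|N z v|\<close> over the compact product
    of the disc and the unit sphere, positive by injectivity; homogeneity extends the bound to all
    \<open>v\<close>.\<close>
  obtain \<kappa> where \<kappa>: "\<kappa> > 0" "\<And>z v. z \<in> cball 0 1 \<Longrightarrow> \<kappa> * norm v \<le> norm (N z v)"
  proof (cases "sphere (0::'a) 1 = {}")
    case True
    then have z: "v = 0" for v :: 'a
    proof -
      have "v /\<^sub>R norm v \<in> sphere 0 1" if "v \<noteq> 0" using that by simp
      then show ?thesis using True by blast
    qed
    have "1 * norm v \<le> norm (N z v)" for z v using z[of v] by (metis mult_1 norm_ge_zero norm_zero)
    then show ?thesis using that[of 1] by auto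
  next
    case False
    have cA: "continuous_on (cball 0 1) A" by (rule hoelder_le_continuous[OF c1_leD(1)[OF A] \<alpha>(1)])
    have cJ: "continuous_on UNIV J0" using linear_J0 by (simp add: linear_continuous_on linear_conv_bounded_linear)
    have "continuous_on (cball 0 1 \<times> sphere 0 1) (\<lambda>p. norm (N (fst p) (snd p)))"
      unfolding N_def
      by (intro continuous_intros bounded_bilinear.continuous_on[OF bil] continuous_on_compose2[OF cA] continuous_on_compose2[OF cJ]) auto
    then obtain p where p: "p \<in> cball 0 1 \<times> sphere (0::'a) 1" "\<And>q. q \<in> cball 0 1 \<times> sphere 0 1 \<Longrightarrow> norm (N (fst p) (snd p)) \<le> norm (N (fst q) (snd q))"
      using continuous_attains_inf[of "cball (0::complex) 1 \<times> sphere (0::'a) 1" "\<lambda>p. norm (N (fst p) (snd p))"] False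
      by (auto simp: compact_Times)
    let ?k = "norm (N (fst p) (snd p))"
    have "?k > 0" using N_inj[of "fst p" "snd p"] p(1) by auto
    moreover have "?k * norm v \<le> norm (N z v)" if z: "z \<in> cball 0 1" for z v
    proof (cases "v = 0")
      case False
      have "?k \<le> norm (N z (v /\<^sub>R norm v))" using p(2)[of "(z, v /\<^sub>R norm v)"] z False by simp
      also have "N z (v /\<^sub>R norm v) = N z v /\<^sub>R norm v" by (rule linear_cmul[OF op_hoelder_leD(2)[OF Nop]])
      finally show ?thesis using False by (simp add: field_simps)
    qed simp
    ultimately show ?thesis by (rule that)
  qed
  obtain R r where Rop: "op_hoelder_le \<alpha> r R" and NR: "\<And>z v. z \<in> cball 0 1 \<Longrightarrow> N z (R z v) = v"
    using op_hoelder_le_inverse[OF Nop \<kappa>] by metis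
  \<comment> \<open>The zeroth-order terms: the derivatives of \<open>A\<close> that arise from
    differentiating \<open>A J0 U\<close>, the one in \<open>y\<close> multiplied once more by
    \<open>A\<close>, and \<open>a\<close> applied to the substituted field.\<close>
  define E where "E z v = (- ap (Ax z) (J0 v) + - ap (A z) (ap (Ay z) (J0 v))) + a z (N z v)" for z v
  obtain e where Eop: "op_hoelder_le \<alpha> e E"
    using op_hoelder_le_add[OF op_hoelder_le_add[OF
        op_hoelder_le_minus[OF op_hoelder_le_compose[OF Aop[OF c1_leD(2)[OF A]] Jop]]
        op_hoelder_le_minus[OF op_hoelder_le_compose[OF Aop[OF c1_leD(1)[OF A]] op_hoelder_le_compose[OF Aop[OF c1_leD(3)[OF A]] Jop]]]]
        op_hoelder_le_compose[OF a Nop]]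
    unfolding E_def[abs_def] by blast
  \<comment> \<open>Multiplication by \<open>R\<close>, the inverse of \<open>N\<close>, turns the
    principal part into the constant-coefficient one and \<open>E\<close> into the perturbation
    \<open>R E\<close>.\<close>
  note REop = op_hoelder_le_compose[OF Rop Eop]
  obtain C where C: "C \<ge> 0" "\<And>g M. hoelder_le \<alpha> M g \<Longrightarrow>
     \<exists>U Ux Uy. c1_le \<alpha> (C * M) U Ux Uy \<and> (\<forall>z\<in>cball 0 1. Ux z + J0 (Uy z) + R z (E z (U z)) = g z)"
    using perturbed_dbar_solvable[OF \<alpha>, of "\<lambda>z v. R z (E z v)" "2 * r * e"] op_hoelder_leD[OF REop] by metis
  have M: "0 \<le> M" using c1_leD(1)[OF A] by (rule hoelder_le_nonneg)
  have r: "0 \<le> r" by (rule op_hoelder_leD(1)[OF Rop])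
  show ?thesis
  \<comment> \<open>The \<open>8\<close> is \<open>4 * 2\<close> from the product with
    \<open>A\<close> and the application of \<open>J0\<close>; \<open>2 * r\<close> is the cost of
    replacing \<open>g\<close> by \<open>R g\<close>.\<close>
  proof (rule that[of "(1 + 8 * M) * (C * (2 * r))"])
    fix g :: "complex \<Rightarrow> 'a" and n assume g: "hoelder_le \<alpha> n g"
    obtain U Ux Uy where U: "c1_le \<alpha> (C * (2 * r * n)) U Ux Uy"
      and eq: "\<And>z. z \<in> cball 0 1 \<Longrightarrow> Ux z + J0 (Uy z) + R z (E z (U z)) = R z (g z)"
      using C(2)[OF op_hoelder_le_apply[OF Rop g]] by blast
    note JU = c1_le_linear[OF linear_J0, of 1, simplified, OF norm_J0 U]
    define Wx where "Wx z = Ux z + - (ap (Ax z) (J0 (U z)) + ap (A z) (J0 (Ux z)))" for z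
    define Wy where "Wy z = Uy z + - (ap (Ay z) (J0 (U z)) + ap (A z) (J0 (Uy z)))" for z
    define W where "W z = U z + - ap (A z) (J0 (U z))" for z
    have "c1_le \<alpha> ((1 + 8 * M) * (C * (2 * r)) * n) W Wx Wy"
      using c1_le_add[OF U c1_le_minus[OF c1_le_bilinear[OF bil K A JU]]]
      unfolding W_def[abs_def] Wx_def[abs_def] Wy_def[abs_def] by (simp add: algebra_simps)
    moreover have "Wx z + ap (A z) (Wy z) + a z (W z) = g z" if z: "z \<in> cball 0 1" for z
    proof -
      have J: "J0 (x + y) = J0 x + J0 y" for x y by (rule linear_add[OF linear_J0])
      have W: "W z = N z (U z)" by (simp add: W_def N_def)
      have "Wx z + ap (A z) (Wy z) + a z (W z) = N z (Ux z + J0 (Uy z)) + E z (U z)"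
        unfolding W by (simp add: Wx_def Wy_def E_def N_def apl sq[OF z] J J0_J0)
      also have "\<dots> = N z (Ux z + J0 (Uy z)) + N z (R z (E z (U z)))" by (simp add: NR[OF z])
      also have "\<dots> = N z (Ux z + J0 (Uy z) + R z (E z (U z)))"
        by (simp only: linear_add[OF op_hoelder_leD(2)[OF Nop]])
      also have "\<dots> = g z" by (simp only: eq[OF z] NR[OF z])
      finally show ?thesis .
    qed
    ultimately show "\<exists>W Wx Wy. c1_le \<alpha> ((1 + 8 * M) * (C * (2 * r)) * n) W Wx Wy \<and> (\<forall>z\<in>cball 0 1. Wx z + ap (A z) (Wy z) + a z (W z) = g z)"
      by blast
  qed (use C M r in auto)
qed

section \<open>Composition with smooth functions\<close>

text \<open>The norm of a matrix is here the Euclidean norm of all its entries, so the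
  Cauchy-Schwarz inequality in each row gives the constant 1 that the bilinear estimates ask
  for.\<close>

lemma norm_matrix_vector_mult: "norm ((A :: real^'n^'m) *v x) \<le> norm A * norm x"
proof -
  have "norm (A *v x) = L2_set (\<lambda>i. \<bar>A $ i \<bullet> x\<bar>) UNIV"
    by (simp add: norm_vec_def matrix_vector_mul_component)
  also have "\<dots> \<le> L2_set (\<lambda>i. norm x * norm (A $ i)) UNIV"
    by (intro L2_set_mono) (simp_all add: Cauchy_Schwarz_ineq2 mult.commute[of "norm x"])
  also have "\<dots> = norm x * L2_set (\<lambda>i. norm (A $ i)) UNIV" by (simp add: L2_set_right_distrib)
  finally show ?thesis by (simp add: norm_vec_def mult.commute)
qed

lemma bounded_bilinear_matrix_vector_mult: "bounded_bilinear ((*v) :: real^'n^'m \<Rightarrow> real^'n \<Rightarrow> real^'m)"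
proof
  show "\<exists>K. \<forall>(A::real^'n^'m) x. norm (A *v x) \<le> norm A * norm x * K"
    by (rule exI[of _ 1]) (simp add: norm_matrix_vector_mult)
qed (auto simp: algebra_simps scaleR_matrix_vector_assoc matrix_vector_mult_scaleR)

lemma has_derivative_vec:
  fixes f :: "'i::finite \<Rightarrow> 'a::real_normed_vector \<Rightarrow> 'b::euclidean_space"
  assumes "\<And>i. (f i has_derivative f' i) F"
  shows "((\<lambda>x. \<chi> i. f i x) has_derivative (\<lambda>h. \<chi> i. f' i h)) F"
proof -
  have eq: "(\<chi> i. y i) = (\<Sum>i\<in>UNIV. axis i (y i))" for y :: "'i \<Rightarrow> 'b"
    by (simp add: vec_eq_iff axis_def if_distrib[of "\<lambda>x. x $ _"] sum.delta cong: if_cong)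
  have "bounded_linear (axis i :: 'b \<Rightarrow> 'b^'i)" for i
    unfolding linear_conv_bounded_linear[symmetric] by (rule linearI) (auto simp: axis_def vec_eq_iff)
  then show ?thesis unfolding eq
    by (intro has_derivative_sum) (rule bounded_linear.has_derivative[OF _ assms])
qed

lemma hoelder_le_vec:
  fixes G :: "complex \<Rightarrow> ('a::real_normed_vector)^'m"
  assumes "\<And>i. hoelder_le \<alpha> M (\<lambda>z. G z $ i)"
  shows "hoelder_le \<alpha> (real CARD('m) * M) G"
proof -
  have le: "norm v \<le> (\<Sum>i\<in>UNIV. norm (v $ i))" for v :: "'a^'m"
    unfolding norm_vec_def by (rule L2_set_le_sum) simp
  show ?thesis
  proof (rule hoelder_leI)
    fix z :: complex assume z: "z \<in> cball 0 1"
    have "norm (G z) \<le> (\<Sum>i\<in>UNIV. norm (G z $ i))" by (rule le)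
    also have "\<dots> \<le> (\<Sum>i\<in>(UNIV::'m set). M)" by (intro sum_mono hoelder_leD(1)[OF assms z])
    finally show "norm (G z) \<le> real CARD('m) * M" by simp
    fix z' :: complex assume z': "z' \<in> cball 0 1"
    have "norm (G z - G z') \<le> (\<Sum>i\<in>UNIV. norm ((G z - G z') $ i))" by (rule le)
    also have "\<dots> \<le> (\<Sum>i\<in>(UNIV::'m set). M * norm (z - z') powr \<alpha>)"
      unfolding vector_minus_component by (intro sum_mono hoelder_leD(2)[OF assms z z'])
    finally show "norm (G z - G z') \<le> real CARD('m) * M * norm (z - z') powr \<alpha>" by simp
  qed
qed

section \<open>Smooth scalar functions on bounded sets\<close>

lemma smooth_scalar_pderiv:
  assumes "smooth_scalar \<phi>" shows "smooth_scalar (pderiv_axis k \<phi>)"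
proof -
  have "h \<in> iter_partials \<phi>" if "h \<in> iter_partials (pderiv_axis k \<phi>)" for h
    using that by induction (auto intro: iter_partials.intros)
  then show ?thesis using assms by (auto simp: smooth_scalar_def)
qed

lemma smooth_scalar_derivative:
  fixes \<phi> :: "real^'m \<Rightarrow> real"
  assumes "smooth_scalar \<phi>"
  shows "(\<phi> has_derivative (\<lambda>h. \<Sum>k\<in>UNIV. h $ k * pderiv_axis k \<phi> x)) (at x)"
proof -
  have "\<phi> differentiable (at x)" using assms iter_partials.base by (auto simp: smooth_scalar_def)
  then have d: "(\<phi> has_derivative frechet_derivative \<phi> (at x)) (at x)" by (simp add: frechet_derivative_works)
  then have lin: "linear (frechet_derivative \<phi> (at x))" by (rule has_derivative_linear)
  have "frechet_derivative \<phi> (at x) h = (\<Sum>k\<in>UNIV. h $ k * pderiv_axis k \<phi> x)" for h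
  proof -
    have "frechet_derivative \<phi> (at x) h = frechet_derivative \<phi> (at x) (\<Sum>k\<in>UNIV. h $ k *\<^sub>R axis k 1)"
      by (simp add: basis_expansion flip: scalar_mult_eq_scaleR)
    also have "\<dots> = (\<Sum>k\<in>UNIV. h $ k * pderiv_axis k \<phi> x)"
      by (simp add: linear_sum[OF lin] linear_cmul[OF lin] pderiv_axis_def)
    finally show ?thesis .
  qed
  then have "frechet_derivative \<phi> (at x) = (\<lambda>h. \<Sum>k\<in>UNIV. h $ k * pderiv_axis k \<phi> x)" by (rule ext)
  then show ?thesis using d by simp
qed

lemma smooth_scalar_continuous: "smooth_scalar \<phi> \<Longrightarrow> continuous_on S \<phi>"
  by (meson continuous_at_imp_continuous_on has_derivative_continuous smooth_scalar_derivative)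

definition lip_bounded :: "real \<Rightarrow> real \<Rightarrow> ('a::real_normed_vector \<Rightarrow> real) \<Rightarrow> bool" where
  "lip_bounded R L \<phi> \<longleftrightarrow> 0 \<le> L \<and> (\<forall>x\<in>cball 0 R. \<bar>\<phi> x\<bar> \<le> L) \<and>
     (\<forall>x\<in>cball 0 R. \<forall>y\<in>cball 0 R. \<bar>\<phi> x - \<phi> y\<bar> \<le> L * norm (x - y))"

lemma lip_boundedD:
  assumes "lip_bounded R L \<phi>"
  shows "0 \<le> L" "x \<in> cball 0 R \<Longrightarrow> \<bar>\<phi> x\<bar> \<le> L"
    "x \<in> cball 0 R \<Longrightarrow> y \<in> cball 0 R \<Longrightarrow> \<bar>\<phi> x - \<phi> y\<bar> \<le> L * norm (x - y)"
  using assms by (auto simp: lip_bounded_def)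

lemma lip_bounded_mono: "lip_bounded R L \<phi> \<Longrightarrow> L \<le> L' \<Longrightarrow> lip_bounded R L' \<phi>"
  unfolding lip_bounded_def by (meson mult_right_mono norm_ge_zero order_trans)

text \<open>The partial derivatives are bounded on the compact ball, and the convexity of the ball
  gives the mean value inequality.\<close>

lemma smooth_scalar_lip_bounded:
  fixes \<phi> :: "real^'m \<Rightarrow> real"
  assumes \<phi>: "smooth_scalar \<phi>"
  shows "\<exists>L. lip_bounded R L \<phi>"
proof -
  have "\<exists>b\<ge>0. \<forall>x\<in>cball 0 R. \<bar>\<psi> x\<bar> \<le> b" if "smooth_scalar \<psi>" for \<psi> :: "real^'m \<Rightarrow> real"
  proof -
    have "bounded (\<psi> ` cball 0 R)"
      by (intro compact_imp_bounded compact_continuous_image smooth_scalar_continuous that compact_cball)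
    then obtain b where "b > 0" "\<forall>y\<in>\<psi> ` cball 0 R. norm y \<le> b" unfolding bounded_pos by blast
    then show ?thesis by (intro exI[of _ b]) auto
  qed
  note bd = this
  obtain b0 where b0: "b0 \<ge> 0" "\<forall>x\<in>cball 0 R. \<bar>\<phi> x\<bar> \<le> b0" using bd[OF \<phi>] by blast
  obtain b where b: "\<And>k. b k \<ge> 0 \<and> (\<forall>x\<in>cball 0 R. \<bar>pderiv_axis k \<phi> x\<bar> \<le> b k)"
    using bd[OF smooth_scalar_pderiv[OF \<phi>]] by metis
  let ?L = "b0 + (\<Sum>k\<in>UNIV. b k)"
  have sb: "0 \<le> (\<Sum>k\<in>UNIV. b k)" using b by (intro sum_nonneg) blast
  have "norm (\<phi> x - \<phi> y) \<le> (\<Sum>k\<in>UNIV. b k) * norm (x - y)" if xy: "x \<in> cball 0 R" "y \<in> cball 0 R" for x y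
  proof (rule differentiable_bound[OF convex_cball])
    fix x assume x: "x \<in> cball (0::real^'m) R"
    show "(\<phi> has_derivative (\<lambda>h. \<Sum>k\<in>UNIV. h $ k * pderiv_axis k \<phi> x)) (at x within cball 0 R)"
      by (rule has_derivative_at_withinI[OF smooth_scalar_derivative[OF \<phi>]])
    show "onorm (\<lambda>h. \<Sum>k\<in>UNIV. h $ k * pderiv_axis k \<phi> x) \<le> (\<Sum>k\<in>UNIV. b k)"
    proof (rule onorm_le)
      fix h :: "real^'m"
      have "norm (\<Sum>k\<in>UNIV. h $ k * pderiv_axis k \<phi> x) \<le> (\<Sum>k\<in>UNIV. norm h * b k)"
        by (rule sum_norm_le) (use b x in \<open>auto simp: abs_mult component_le_norm_cart intro!: mult_mono\<close>)
      then show "norm (\<Sum>k\<in>UNIV. h $ k * pderiv_axis k \<phi> x) \<le> (\<Sum>k\<in>UNIV. b k) * norm h"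
        by (simp add: sum_distrib_left mult.commute)
    qed
  qed (use xy in auto)
  moreover have "(\<Sum>k\<in>UNIV. b k) * norm (x - y) \<le> ?L * norm (x - y)" for x y :: "real^'m"
    by (rule mult_right_mono) (use b0 in auto)
  ultimately have lip: "\<bar>\<phi> x - \<phi> y\<bar> \<le> ?L * norm (x - y)" if "x \<in> cball 0 R" "y \<in> cball 0 R" for x y
    using order_trans that unfolding real_norm_def by blast
  have "\<bar>\<phi> x\<bar> \<le> ?L" if "x \<in> cball 0 R" for x
    using b0(2) that sb by (simp add: add_increasing2)
  then have "lip_bounded R ?L \<phi>" unfolding lip_bounded_def using b0(1) sb lip by (simp add: add_nonneg_nonneg)
  then show ?thesis by blast
qed

lemma finite_family_lip_bounded:
  fixes \<phi> :: "'i::finite \<Rightarrow> 'a::real_normed_vector \<Rightarrow> real"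
  assumes "\<And>i. \<exists>L. lip_bounded R L (\<phi> i)" shows "\<exists>L. \<forall>i. lip_bounded R L (\<phi> i)"
proof -
  obtain L where L: "\<And>i. lip_bounded R (L i) (\<phi> i)" using assms by metis
  have "L i \<le> (\<Sum>i\<in>UNIV. L i)" for i
    by (rule member_le_sum) (use lip_boundedD(1)[OF L] in auto)
  then show ?thesis using lip_bounded_mono[OF L] by blast
qed

section \<open>Mean value estimates along segments\<close>

lemma smooth_scalar_segment:
  fixes \<phi> :: "real^'m \<Rightarrow> real"
  assumes "smooth_scalar \<phi>"
  shows "((\<lambda>\<tau>. \<phi> (a + \<tau> *\<^sub>R z)) has_real_derivative (\<Sum>k\<in>UNIV. z $ k * pderiv_axis k \<phi> (a + \<tau> *\<^sub>R z))) (at \<tau>)"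
proof -
  have "((\<lambda>\<tau>. \<phi> (a + \<tau> *\<^sub>R z)) has_derivative (\<lambda>h. \<Sum>k\<in>UNIV. (h *\<^sub>R z) $ k * pderiv_axis k \<phi> (a + \<tau> *\<^sub>R z))) (at \<tau>)"
    by (rule has_derivative_compose[OF _ smooth_scalar_derivative[OF assms]]) (auto intro!: derivative_eq_intros)
  then show ?thesis
    unfolding has_field_derivative_def by (rule has_derivative_eq_rhs) (auto simp: sum_distrib_left fun_eq_iff mult_ac)
qed

lemma segment_mem_cball:
  fixes a z :: "'a::real_normed_vector"
  assumes "a \<in> cball 0 R" "a + z \<in> cball 0 R" "0 \<le> \<xi>" "\<xi> \<le> 1"
  shows "a + \<xi> *\<^sub>R z \<in> cball 0 R"
proof -
  have "a + \<xi> *\<^sub>R z = (1 - \<xi>) *\<^sub>R a + \<xi> *\<^sub>R (a + z)" by (simp add: scaleR_diff_left scaleR_add_right)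
  then show ?thesis using convexD_alt[OF convex_cball assms] by simp
qed

text \<open>Needed for a Hoelder seminorm of increments that is linear in their size; Lipschitz
  continuity of \<phi> alone would leave a term that does not shrink with \<open>z\<close> and
  \<open>z'\<close>. The mean value theorem is applied to the difference of the two restrictions, so
  one \<open>\<xi>\<close> serves both segments.\<close>

lemma second_difference_bound:
  fixes \<phi> :: "real^'m \<Rightarrow> real"
  assumes \<phi>: "smooth_scalar \<phi>" and L: "\<And>k. lip_bounded R L (pderiv_axis k \<phi>)"
    and m: "a \<in> cball 0 R" "a + z \<in> cball 0 R" "a' \<in> cball 0 R" "a' + z' \<in> cball 0 R"
  shows "\<bar>\<phi> (a + z) - \<phi> a - (\<phi> (a' + z') - \<phi> a')\<bar>
     \<le> real CARD('m) * L * (norm (z - z') + norm z' * (norm (a - a') + norm (z - z')))"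
proof -
  obtain \<xi> where \<xi>: "0 < \<xi>" "\<xi> < 1" and eq: "(\<phi> (a + 1 *\<^sub>R z) - \<phi> (a' + 1 *\<^sub>R z')) - (\<phi> (a + 0 *\<^sub>R z) - \<phi> (a' + 0 *\<^sub>R z'))
      = (1 - 0) * ((\<Sum>k\<in>UNIV. z $ k * pderiv_axis k \<phi> (a + \<xi> *\<^sub>R z)) - (\<Sum>k\<in>UNIV. z' $ k * pderiv_axis k \<phi> (a' + \<xi> *\<^sub>R z')))"
    using MVT2[of 0 1 "\<lambda>\<tau>. \<phi> (a + \<tau> *\<^sub>R z) - \<phi> (a' + \<tau> *\<^sub>R z')"
        "\<lambda>\<tau>. (\<Sum>k\<in>UNIV. z $ k * pderiv_axis k \<phi> (a + \<tau> *\<^sub>R z)) - (\<Sum>k\<in>UNIV. z' $ k * pderiv_axis k \<phi> (a' + \<tau> *\<^sub>R z'))"]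
    using DERIV_diff[OF smooth_scalar_segment[OF \<phi>] smooth_scalar_segment[OF \<phi>]] by force
  let ?x = "a + \<xi> *\<^sub>R z" and ?x' = "a' + \<xi> *\<^sub>R z'"
  have x: "?x \<in> cball 0 R" "?x' \<in> cball 0 R" using m \<xi> by (auto intro!: segment_mem_cball simp del: mem_cball mem_cball_0)
  have L0: "0 \<le> L" using lip_boundedD(1)[OF L] .
  have dx: "norm (?x - ?x') \<le> norm (a - a') + norm (z - z')"
  proof -
    have e: "?x - ?x' = (a - a') + \<xi> *\<^sub>R (z - z')" by (simp add: algebra_simps)
    have "norm (?x - ?x') \<le> norm (a - a') + norm (\<xi> *\<^sub>R (z - z'))" unfolding e by (rule norm_triangle_ineq)
    also have "norm (\<xi> *\<^sub>R (z - z')) \<le> norm (z - z')" using \<xi> by (simp add: mult_left_le_one_le)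
    finally show ?thesis by simp
  qed
  have e: "\<phi> (a + z) - \<phi> a - (\<phi> (a' + z') - \<phi> a') = (\<Sum>k\<in>UNIV. z $ k * pderiv_axis k \<phi> ?x - z' $ k * pderiv_axis k \<phi> ?x')"
    using eq by (simp add: sum_subtractf)
  have "\<bar>\<phi> (a + z) - \<phi> a - (\<phi> (a' + z') - \<phi> a')\<bar> \<le> (\<Sum>k\<in>(UNIV::'m set). L * (norm (z - z') + norm z' * (norm (a - a') + norm (z - z'))))"
    unfolding e
  proof (rule order_trans[OF sum_abs sum_mono])
    fix k
    have e: "z $ k * pderiv_axis k \<phi> ?x - z' $ k * pderiv_axis k \<phi> ?x'
       = (z - z') $ k * pderiv_axis k \<phi> ?x + z' $ k * (pderiv_axis k \<phi> ?x - pderiv_axis k \<phi> ?x')" by (simp add: algebra_simps)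
    have "\<bar>z $ k * pderiv_axis k \<phi> ?x - z' $ k * pderiv_axis k \<phi> ?x'\<bar> \<le> norm (z - z') * L + norm z' * (L * norm (?x - ?x'))"
      unfolding e
      by (rule order_trans[OF abs_triangle_ineq], unfold abs_mult)
         (intro add_mono mult_mono component_le_norm_cart lip_boundedD[OF L] x; simp)
    also have "\<dots> \<le> norm (z - z') * L + norm z' * (L * (norm (a - a') + norm (z - z')))"
      by (intro add_left_mono mult_left_mono dx L0) auto
    finally show "\<bar>z $ k * pderiv_axis k \<phi> ?x - z' $ k * pderiv_axis k \<phi> ?x'\<bar> \<le> L * (norm (z - z') + norm z' * (norm (a - a') + norm (z - z')))"
      by (simp add: algebra_simps)
  qed
  then show ?thesis by (simp add: mult.assoc)
qed

text \<open>The linear part is taken at \<open>p\<close>, not at \<open>p + w\<close>, because the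
  iteration keeps its linearisation at \<open>f\<close>. The mean value theorem produces increments
  of the partial derivatives from \<open>p\<close>, and \<open>second_difference_bound\<close> for
  these partials compares the two base points.\<close>

lemma taylor_difference_bound:
  fixes \<phi> :: "real^'m \<Rightarrow> real"
  defines "N \<equiv> \<lambda>p w z. \<phi> (p + w + z) - \<phi> (p + w) - (\<Sum>k\<in>UNIV. z $ k * pderiv_axis k \<phi> p)"
  assumes \<phi>: "smooth_scalar \<phi>" and L: "\<And>k. lip_bounded R L (pderiv_axis k \<phi>)"
    and L2: "\<And>k l. lip_bounded R L (pderiv_axis l (pderiv_axis k \<phi>))"
    and m: "p \<in> cball 0 R" "p + w \<in> cball 0 R" "p + w + z \<in> cball 0 R" "p' \<in> cball 0 R" "p' + w' \<in> cball 0 R" "p' + w' + z' \<in> cball 0 R"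
  shows "\<bar>N p w z - N p' w' z'\<bar> \<le> real CARD('m) * (L * norm (z - z') * (norm w + norm z)
     + norm z' * (real CARD('m) * L * (norm (w - w') + norm (z - z') + (norm w' + norm z') * (norm (p - p') + (norm (w - w') + norm (z - z'))))))"
proof -
  \<comment> \<open>The linear term carries the factor \<open>\<tau>\<close>, so the change of
    \<open>?g\<close> from \<open>0\<close> to \<open>1\<close> is exactly \<open>N\<close>.\<close>
  let ?g = "\<lambda>p w z \<tau>. \<phi> (p + w + \<tau> *\<^sub>R z) - \<tau> * (\<Sum>k\<in>UNIV. z $ k * pderiv_axis k \<phi> p)"
  let ?g' = "\<lambda>p w z \<tau>. (\<Sum>k\<in>UNIV. z $ k * pderiv_axis k \<phi> (p + w + \<tau> *\<^sub>R z)) - (\<Sum>k\<in>UNIV. z $ k * pderiv_axis k \<phi> p)"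
  have d: "(?g p w z has_real_derivative ?g' p w z \<tau>) (at \<tau>)" for p w z \<tau>
    by (intro DERIV_diff smooth_scalar_segment[OF \<phi>]) (auto intro!: derivative_eq_intros)
  obtain \<xi> where \<xi>: "0 < \<xi>" "\<xi> < 1" and eq: "(?g p w z 1 - ?g p' w' z' 1) - (?g p w z 0 - ?g p' w' z' 0) = (1 - 0) * (?g' p w z \<xi> - ?g' p' w' z' \<xi>)"
    using MVT2[of 0 1 "\<lambda>\<tau>. ?g p w z \<tau> - ?g p' w' z' \<tau>" "\<lambda>\<tau>. ?g' p w z \<tau> - ?g' p' w' z' \<tau>"] DERIV_diff[OF d d] by force
  let ?v = "w + \<xi> *\<^sub>R z" and ?v' = "w' + \<xi> *\<^sub>R z'"
  have x: "p + ?v \<in> cball 0 R" "p' + ?v' \<in> cball 0 R"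
    using segment_mem_cball[OF m(2,3), of \<xi>] segment_mem_cball[OF m(5,6), of \<xi>] \<xi> by (auto simp: add.assoc)
  have L0: "0 \<le> L" using lip_boundedD(1)[OF L] .
  have sc: "\<xi> * norm y \<le> norm y" for y :: "real^'m" using \<xi> by (simp add: mult_left_le_one_le)
  have nv: "norm (w + \<xi> *\<^sub>R z) \<le> norm w + norm z" for w z :: "real^'m"
    using norm_triangle_ineq[of w "\<xi> *\<^sub>R z"] sc[of z] \<xi> by simp
  have dv: "norm (?v - ?v') \<le> norm (w - w') + norm (z - z')"
    using nv[of "w - w'" "z - z'"] by (simp add: algebra_simps)
  let ?D = "\<lambda>k p v. pderiv_axis k \<phi> (p + v) - pderiv_axis k \<phi> p"
  have "N p w z - N p' w' z' = ?g' p w z \<xi> - ?g' p' w' z' \<xi>" using eq by (simp add: N_def)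
  also have "\<dots> = (\<Sum>k\<in>UNIV. z $ k * ?D k p ?v - z' $ k * ?D k p' ?v')"
    by (simp add: sum_subtractf right_diff_distrib add.assoc)
  finally have e: "N p w z - N p' w' z' = (\<Sum>k\<in>UNIV. z $ k * ?D k p ?v - z' $ k * ?D k p' ?v')" .
  have "\<bar>N p w z - N p' w' z'\<bar> \<le> (\<Sum>k\<in>(UNIV::'m set). L * norm (z - z') * (norm w + norm z)
     + norm z' * (real CARD('m) * L * (norm (w - w') + norm (z - z') + (norm w' + norm z') * (norm (p - p') + (norm (w - w') + norm (z - z'))))))"
    unfolding e
  proof (rule order_trans[OF sum_abs sum_mono])
    fix k
    have 1: "\<bar>?D k p ?v\<bar> \<le> L * (norm w + norm z)"
    proof -
      have "\<bar>?D k p ?v\<bar> \<le> L * norm (p + ?v - p)" by (rule lip_boundedD(3)[OF L x(1) m(1)])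
      also have "\<dots> \<le> L * (norm w + norm z)" using nv[of w z] L0 by (intro mult_left_mono) auto
      finally show ?thesis .
    qed
    have 2: "\<bar>?D k p ?v - ?D k p' ?v'\<bar> \<le> real CARD('m) * L * (norm (w - w') + norm (z - z') + (norm w' + norm z') * (norm (p - p') + (norm (w - w') + norm (z - z'))))"
    proof -
      have "\<bar>?D k p ?v - ?D k p' ?v'\<bar> \<le> real CARD('m) * L * (norm (?v - ?v') + norm ?v' * (norm (p - p') + norm (?v - ?v')))"
        by (rule second_difference_bound[OF smooth_scalar_pderiv[OF \<phi>] L2 m(1) x(1) m(4) x(2)])
      also have "\<dots> \<le> real CARD('m) * L * (norm (w - w') + norm (z - z') + (norm w' + norm z') * (norm (p - p') + (norm (w - w') + norm (z - z'))))"
        using L0 by (intro mult_left_mono add_mono mult_mono dv nv order_refl) auto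
      finally show ?thesis .
    qed
    have e: "z $ k * ?D k p ?v - z' $ k * ?D k p' ?v' = (z - z') $ k * ?D k p ?v + z' $ k * (?D k p ?v - ?D k p' ?v')"
      by (simp add: algebra_simps)
    have "\<bar>z $ k * ?D k p ?v - z' $ k * ?D k p' ?v'\<bar> \<le> norm (z - z') * (L * (norm w + norm z)) + norm z' * (real CARD('m) * L * (norm (w - w') + norm (z - z') + (norm w' + norm z') * (norm (p - p') + (norm (w - w') + norm (z - z')))))"
      unfolding e
      by (rule order_trans[OF abs_triangle_ineq], unfold abs_mult)
         (intro add_mono mult_mono component_le_norm_cart 1 2; simp)
    then show "\<bar>z $ k * ?D k p ?v - z' $ k * ?D k p' ?v'\<bar> \<le> L * norm (z - z') * (norm w + norm z)
     + norm z' * (real CARD('m) * L * (norm (w - w') + norm (z - z') + (norm w' + norm z') * (norm (p - p') + (norm (w - w') + norm (z - z')))))"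
      by (simp add: mult_ac)
  qed
  then show ?thesis by simp
qed

text \<open>Since \<open>s\<close> and \<open>t\<close> are at most 1, all arguments stay in the
  ball of radius \<open>K + 2\<close>; its Lipschitz constants make \<open>C\<close> independent of
  \<open>s\<close>, \<open>t\<close> and the maps.\<close>

lemma hoelder_le_increment:
  fixes \<phi> :: "real^'m \<Rightarrow> real" and f :: "complex \<Rightarrow> real^'m"
  assumes \<phi>: "smooth_scalar \<phi>" and f: "hoelder_le \<alpha> K f"
  shows "\<exists>C\<ge>0. \<forall>s t W Z. hoelder_le \<alpha> s W \<longrightarrow> hoelder_le \<alpha> t Z \<longrightarrow> s \<le> 1 \<longrightarrow> t \<le> 1 \<longrightarrow>
     hoelder_le \<alpha> (C * t) (\<lambda>z. \<phi> (f z + W z + Z z) - \<phi> (f z + W z))"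
proof -
  let ?R = "K + 2" and ?m = "real CARD('m)"
  have K: "0 \<le> K" using f by (rule hoelder_le_nonneg)
  obtain L0 where L0: "lip_bounded ?R L0 \<phi>" using smooth_scalar_lip_bounded[OF \<phi>] by blast
  obtain L where L: "\<And>k. lip_bounded ?R L (pderiv_axis k \<phi>)"
    using finite_family_lip_bounded[of ?R "\<lambda>k. pderiv_axis k \<phi>"] smooth_scalar_lip_bounded[OF smooth_scalar_pderiv[OF \<phi>]] by blast
  note Lp = lip_boundedD(1)[OF L] lip_boundedD(1)[OF L0]
  show ?thesis
  proof (intro exI[of _ "L0 + ?m * L * (K + 3)"] conjI allI impI)
    fix s t :: real and W Z :: "complex \<Rightarrow> real^'m"
    assume W: "hoelder_le \<alpha> s W" and Z: "hoelder_le \<alpha> t Z" and st: "s \<le> 1" "t \<le> 1"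
    have st0: "0 \<le> s" "0 \<le> t" using W Z hoelder_le_nonneg by blast+
    have mem: "f z + W z \<in> cball 0 ?R" "f z + W z + Z z \<in> cball 0 ?R" if z: "z \<in> cball 0 1" for z
      using hoelder_leD(1)[OF f z] hoelder_leD(1)[OF W z] hoelder_leD(1)[OF Z z] st
        norm_triangle_ineq[of "f z" "W z"] norm_triangle_ineq[of "f z + W z" "Z z"] by auto
    show "hoelder_le \<alpha> ((L0 + ?m * L * (K + 3)) * t) (\<lambda>z. \<phi> (f z + W z + Z z) - \<phi> (f z + W z))"
    proof (rule hoelder_leI)
      fix z :: complex assume z: "z \<in> cball 0 1"
      have "norm (\<phi> (f z + W z + Z z) - \<phi> (f z + W z)) \<le> L0 * norm (Z z)"
        using lip_boundedD(3)[OF L0 mem(2,1)[OF z]] by simp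
      also have "\<dots> \<le> L0 * t" by (intro mult_left_mono hoelder_leD(1)[OF Z z] Lp)
      also have "\<dots> \<le> (L0 + ?m * L * (K + 3)) * t" using Lp K st0 by (intro mult_right_mono) auto
      finally show "norm (\<phi> (f z + W z + Z z) - \<phi> (f z + W z)) \<le> (L0 + ?m * L * (K + 3)) * t" .
      fix z' :: complex assume z': "z' \<in> cball 0 1"
      define p where "p = norm (z - z') powr \<alpha>"
      have p: "0 \<le> p" by (simp add: p_def)
      have a: "norm (f z + W z - (f z' + W z')) \<le> (K + 1) * p"
        using hoelder_leD(2)[OF hoelder_le_mono[OF hoelder_le_add[OF f W], of "K + 1"] z z'] st by (simp add: p_def)
      have zz: "norm (Z z - Z z') \<le> t * p" using hoelder_leD(2)[OF Z z z'] by (simp add: p_def)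
      have "t * p \<le> 1 * p" by (rule mult_right_mono[OF st(2) p])
      then have tp: "t * p \<le> p" by simp
      have "norm (\<phi> (f z + W z + Z z) - \<phi> (f z + W z) - (\<phi> (f z' + W z' + Z z') - \<phi> (f z' + W z')))
         \<le> ?m * L * (norm (Z z - Z z') + norm (Z z') * (norm (f z + W z - (f z' + W z')) + norm (Z z - Z z')))"
        unfolding real_norm_def by (rule second_difference_bound[OF \<phi> L mem[OF z] mem[OF z']])
      also have "\<dots> \<le> ?m * L * (t * p + t * ((K + 1) * p + p))"
        by (intro mult_left_mono add_mono mult_mono a hoelder_leD(1)[OF Z z'] order_trans[OF zz tp] zz) (use Lp st0 K p in auto)
      also have "\<dots> = (?m * L * (K + 3)) * t * p" by (simp add: algebra_simps)
      also have "\<dots> \<le> (L0 + ?m * L * (K + 3)) * t * p" using Lp st0 p by (intro mult_right_mono) auto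
      finally show "norm (\<phi> (f z + W z + Z z) - \<phi> (f z + W z) - (\<phi> (f z' + W z' + Z z') - \<phi> (f z' + W z')))
         \<le> (L0 + ?m * L * (K + 3)) * t * norm (z - z') powr \<alpha>" by (simp add: p_def)
    qed
  qed (use Lp K in auto)
qed

text \<open>The factor \<open>(s + t) * t\<close> is the quadratic smallness that drives the
  iteration: \<open>s\<close> measures the current iterate, \<open>t\<close> the next
  correction.\<close>

lemma hoelder_le_taylor:
  fixes \<phi> :: "real^'m \<Rightarrow> real" and f :: "complex \<Rightarrow> real^'m"
  assumes \<phi>: "smooth_scalar \<phi>" and f: "hoelder_le \<alpha> K f"
  shows "\<exists>C\<ge>0. \<forall>s t W Z. hoelder_le \<alpha> s W \<longrightarrow> hoelder_le \<alpha> t Z \<longrightarrow> s \<le> 1 \<longrightarrow> t \<le> 1 \<longrightarrow>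
     hoelder_le \<alpha> (C * ((s + t) * t)) (\<lambda>z. \<phi> (f z + W z + Z z) - \<phi> (f z + W z) - (\<Sum>k\<in>UNIV. Z z $ k * pderiv_axis k \<phi> (f z)))"
proof -
  let ?R = "K + 2" and ?m = "real CARD('m)"
  have K: "0 \<le> K" using f by (rule hoelder_le_nonneg)
  obtain L1 where L1: "\<And>k. lip_bounded ?R L1 (pderiv_axis k \<phi>)"
    using finite_family_lip_bounded[of ?R "\<lambda>k. pderiv_axis k \<phi>"] smooth_scalar_lip_bounded[OF smooth_scalar_pderiv[OF \<phi>]] by blast
  obtain L2 where L2: "\<And>i. lip_bounded ?R L2 (pderiv_axis (snd i) (pderiv_axis (fst i) \<phi>))"
    using finite_family_lip_bounded[of ?R "\<lambda>i. pderiv_axis (snd i) (pderiv_axis (fst i) \<phi>)"]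
      smooth_scalar_lip_bounded[OF smooth_scalar_pderiv[OF smooth_scalar_pderiv[OF \<phi>]]] by blast
  define L where "L = max L1 L2"
  have L: "\<And>k. lip_bounded ?R L (pderiv_axis k \<phi>)" by (rule lip_bounded_mono[OF L1]) (simp add: L_def)
  have LL: "\<And>k l. lip_bounded ?R L (pderiv_axis l (pderiv_axis k \<phi>))"
    using lip_bounded_mono[OF L2, of L "(k, l)" for k l] by (simp add: L_def)
  note Lp = lip_boundedD(1)[OF L]
  let ?N = "\<lambda>p w z. \<phi> (p + w + z) - \<phi> (p + w) - (\<Sum>k\<in>UNIV. z $ k * pderiv_axis k \<phi> p)"
  let ?C = "?m * (L + ?m * L * (K + 3))"
  show ?thesis
  proof (intro exI[of _ ?C] conjI allI impI)
    fix s t :: real and W Z :: "complex \<Rightarrow> real^'m"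
    assume W: "hoelder_le \<alpha> s W" and Z: "hoelder_le \<alpha> t Z" and st: "s \<le> 1" "t \<le> 1"
    have st0: "0 \<le> s" "0 \<le> t" using W Z hoelder_le_nonneg by blast+
    have mem: "f z \<in> cball 0 ?R" "f z + W z \<in> cball 0 ?R" "f z + W z + Z z \<in> cball 0 ?R" if z: "z \<in> cball 0 1" for z
      using hoelder_leD(1)[OF f z] hoelder_leD(1)[OF W z] hoelder_leD(1)[OF Z z] st
        norm_triangle_ineq[of "f z" "W z"] norm_triangle_ineq[of "f z + W z" "Z z"] by auto
    show "hoelder_le \<alpha> (?C * ((s + t) * t)) (\<lambda>z. ?N (f z) (W z) (Z z))"
    proof (rule hoelder_leI)
      fix z :: complex assume z: "z \<in> cball 0 1"
      note nW = hoelder_leD(1)[OF W z] and nZ = hoelder_leD(1)[OF Z z]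
      \<comment> \<open>The remainder vanishes for a zero increment, so the pointwise bound is a
        difference estimate at a single base point.\<close>
      have "norm (?N (f z) (W z) (Z z)) = \<bar>?N (f z) (W z) (Z z) - ?N (f z) (W z) 0\<bar>" by simp
      also have "\<dots> \<le> ?m * (L * norm (Z z) * (norm (W z) + norm (Z z)))"
        using taylor_difference_bound[OF \<phi> L LL mem(1,2,3)[OF z] mem(1,2)[OF z], of 0] mem(2)[OF z] by simp
      also have "\<dots> \<le> ?m * (L * t * (s + t))"
        by (intro mult_left_mono mult_mono add_mono nW nZ order_refl) (use Lp st0 in auto)
      also have "\<dots> = ?m * L * ((s + t) * t)" by simp
      also have "\<dots> \<le> ?C * ((s + t) * t)"
        using Lp K st0 by (intro mult_right_mono mult_left_mono) auto
      finally show "norm (?N (f z) (W z) (Z z)) \<le> ?C * ((s + t) * t)" .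
      fix z' :: complex assume z': "z' \<in> cball 0 1"
      define p where "p = norm (z - z') powr \<alpha>"
      have p: "0 \<le> p" by (simp add: p_def)
      have dd: "norm (f z - f z') \<le> K * p" "norm (W z - W z') \<le> s * p" "norm (Z z - Z z') \<le> t * p"
        using hoelder_leD(2)[OF f z z'] hoelder_leD(2)[OF W z z'] hoelder_leD(2)[OF Z z z'] by (simp_all add: p_def)
      note n' = hoelder_leD(1)[OF W z'] hoelder_leD(1)[OF Z z']
      have "norm (?N (f z) (W z) (Z z) - ?N (f z') (W z') (Z z')) \<le> ?m * (L * norm (Z z - Z z') * (norm (W z) + norm (Z z))
         + norm (Z z') * (?m * L * (norm (W z - W z') + norm (Z z - Z z') + (norm (W z') + norm (Z z')) * (norm (f z - f z') + (norm (W z - W z') + norm (Z z - Z z'))))))"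
        unfolding real_norm_def by (rule taylor_difference_bound[OF \<phi> L LL mem[OF z] mem[OF z']])
      also have "\<dots> \<le> ?m * (L * (t * p) * (s + t) + t * (?m * L * (s * p + t * p + (s + t) * (K * p + (s * p + t * p)))))"
        by (intro mult_left_mono mult_mono add_mono nW nZ n' dd order_refl) (use Lp st0 K p in auto)
      also have "\<dots> = ?m * (L + ?m * L * (1 + K + (s + t))) * ((s + t) * t) * p" by (simp add: algebra_simps)
      also have "\<dots> \<le> ?C * ((s + t) * t) * p"
        using Lp st0 p st by (intro mult_right_mono mult_left_mono add_left_mono) auto
      finally show "norm (?N (f z) (W z) (Z z) - ?N (f z') (W z') (Z z')) \<le> ?C * ((s + t) * t) * norm (z - z') powr \<alpha>"
        by (simp add: p_def)
    qed
  qed (use Lp K in auto)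
qed

section \<open>Matrix-valued structures along a disc\<close>

definition matrix_deriv :: "(real^'m \<Rightarrow> real^'m^'m) \<Rightarrow> real^'m \<Rightarrow> real^'m \<Rightarrow> real^'m^'m" where
  "matrix_deriv J x h = (\<chi> i j. \<Sum>k\<in>UNIV. h $ k * pderiv_axis k (\<lambda>z. J z $ i $ j) x)"

text \<open>Links the explicit sum over partial derivatives, whose Hoelder dependence on the base
  point is visible, to the Frechet derivative occurring in the equation of a variation.\<close>

lemma matrix_deriv_derivative:
  assumes "smooth_matrix_fun J" shows "(J has_derivative matrix_deriv J x) (at x)"
proof -
  have "((\<lambda>x. \<chi> i. \<chi> j. J x $ i $ j) has_derivative (\<lambda>h. \<chi> i. \<chi> j. \<Sum>k\<in>UNIV. h $ k * pderiv_axis k (\<lambda>z. J z $ i $ j) x)) (at x)"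
    using assms by (intro has_derivative_vec smooth_scalar_derivative) (simp add: smooth_matrix_fun_def)
  then show ?thesis by (simp add: matrix_deriv_def[abs_def])
qed

lemma linear_dmat: "linear (matrix_deriv J x)"
  by (rule linearI) (simp_all add: matrix_deriv_def vec_eq_iff algebra_simps sum.distrib sum_distrib_left)

lemma norm_matrix_le: "norm (A :: real^'n^'m) \<le> (\<Sum>i\<in>UNIV. \<Sum>j\<in>UNIV. \<bar>A $ i $ j\<bar>)"
proof -
  have "norm A \<le> (\<Sum>i\<in>UNIV. norm (A $ i))" unfolding norm_vec_def[of A] by (rule L2_set_le_sum) simp
  also have "\<dots> \<le> (\<Sum>i\<in>UNIV. \<Sum>j\<in>UNIV. \<bar>A $ i $ j\<bar>)" by (intro sum_mono norm_le_l1_cart)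
  finally show ?thesis .
qed

lemma hoelder_le_uniform:
  fixes G :: "'i::finite \<Rightarrow> complex \<Rightarrow> 'b::real_normed_vector"
  assumes "\<And>i. \<exists>C. hoelder_le \<alpha> C (G i)" shows "\<exists>C\<ge>0. \<forall>i. hoelder_le \<alpha> C (G i)"
proof -
  obtain C where C: "\<And>i. hoelder_le \<alpha> (C i) (G i)" using assms by metis
  have C0: "0 \<le> C i" for i using C by (rule hoelder_le_nonneg)
  have "C i \<le> (\<Sum>i\<in>UNIV. C i)" for i by (rule member_le_sum) (use C0 in auto)
  then show ?thesis using hoelder_le_mono[OF C] C0 by (intro exI[of _ "\<Sum>i\<in>UNIV. C i"]) (auto intro: sum_nonneg)
qed

lemma hoelder_le_matrix_entries:
  fixes G :: "complex \<Rightarrow> real^'n^'m"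
  assumes "\<And>i j. \<exists>C. hoelder_le \<alpha> C (\<lambda>z. G z $ i $ j)" shows "\<exists>C. hoelder_le \<alpha> C G"
proof -
  have "\<exists>C\<ge>0. \<forall>p. hoelder_le \<alpha> C (\<lambda>z. G z $ fst p $ snd p)"
    by (rule hoelder_le_uniform[where G = "\<lambda>p z. G z $ fst p $ snd p"]) (rule assms)
  then obtain C where "\<And>p. hoelder_le \<alpha> C (\<lambda>z. G z $ fst p $ snd p)" by blast
  from this[of "(i, j)" for i j] have "hoelder_le \<alpha> C (\<lambda>z. G z $ i $ j)" for i j by simp
  then show ?thesis by (blast intro: hoelder_le_vec)
qed

lemma hoelder_le_smooth_compose:
  fixes \<phi> :: "real^'m \<Rightarrow> real"
  assumes \<phi>: "smooth_scalar \<phi>" and f: "hoelder_le \<alpha> K f" shows "\<exists>C. hoelder_le \<alpha> C (\<lambda>z. \<phi> (f z))"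
proof -
  obtain L where L: "lip_bounded K L \<phi>" using smooth_scalar_lip_bounded[OF \<phi>] by blast
  have K: "0 \<le> K" using f by (rule hoelder_le_nonneg)
  have mem: "f z \<in> cball 0 K" if "z \<in> cball 0 1" for z using hoelder_leD(1)[OF f that] by simp
  have "hoelder_le \<alpha> (L * (1 + K)) (\<lambda>z. \<phi> (f z))"
  proof (rule hoelder_leI)
    fix z :: complex assume z: "z \<in> cball 0 1"
    have "norm (\<phi> (f z)) \<le> L * 1" using lip_boundedD(2)[OF L mem[OF z]] by simp
    also have "\<dots> \<le> L * (1 + K)" using K lip_boundedD(1)[OF L] by (intro mult_left_mono) auto
    finally show "norm (\<phi> (f z)) \<le> L * (1 + K)" .
    fix z' :: complex assume z': "z' \<in> cball 0 1"
    have "norm (\<phi> (f z) - \<phi> (f z')) \<le> L * norm (f z - f z')" using lip_boundedD(3)[OF L mem[OF z] mem[OF z']] by simp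
    also have "\<dots> \<le> L * (K * norm (z - z') powr \<alpha>)" by (intro mult_left_mono hoelder_leD(2)[OF f z z'] lip_boundedD(1)[OF L])
    also have "\<dots> \<le> L * (1 + K) * norm (z - z') powr \<alpha>" using lip_boundedD(1)[OF L] by (simp add: algebra_simps)
    finally show "norm (\<phi> (f z) - \<phi> (f z')) \<le> L * (1 + K) * norm (z - z') powr \<alpha>" .
  qed
  then show ?thesis by blast
qed

lemma matrix_deriv_op_hoelder:
  fixes J :: "real^'m \<Rightarrow> real^'m^'m"
  assumes J: "smooth_matrix_fun J" and f: "hoelder_le \<alpha> K f"
  shows "\<exists>c. op_hoelder_le \<alpha> c (\<lambda>z. matrix_deriv J (f z))"
proof -
  let ?P = "\<lambda>p z. pderiv_axis (snd (snd p)) (\<lambda>x. J x $ fst p $ fst (snd p)) (f z)"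
  have "\<exists>C\<ge>0. \<forall>p. hoelder_le \<alpha> C (?P p)"
    by (rule hoelder_le_uniform, rule hoelder_le_smooth_compose[OF smooth_scalar_pderiv f])
       (use J in \<open>simp add: smooth_matrix_fun_def\<close>)
  then obtain C where C: "C \<ge> 0" "\<And>p. hoelder_le \<alpha> C (?P p)" by blast
  let ?p = "\<lambda>i j k z. pderiv_axis k (\<lambda>x. J x $ i $ j) (f z)"
  have P: "hoelder_le \<alpha> C (?p i j k)" for i j k using C(2)[of "(i, j, k)"] by simp
  let ?c = "\<Sum>i\<in>(UNIV::'m set). \<Sum>j\<in>(UNIV::'m set). \<Sum>k\<in>(UNIV::'m set). C"
  have est: "norm A \<le> ?c * r * norm v"
    if "\<And>i j. A $ i $ j = (\<Sum>k\<in>UNIV. v $ k * q i j k)" "\<And>i j k. \<bar>q i j k\<bar> \<le> C * r" "0 \<le> r" for A :: "real^'m^'m" and v :: "real^'m" and q r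
  proof -
    have "norm A \<le> (\<Sum>i\<in>UNIV. \<Sum>j\<in>UNIV. \<bar>A $ i $ j\<bar>)" by (rule norm_matrix_le)
    also have "\<dots> \<le> (\<Sum>i\<in>(UNIV::'m set). \<Sum>j\<in>(UNIV::'m set). \<Sum>k\<in>(UNIV::'m set). C * (r * norm v))"
    proof (intro sum_mono)
      fix i j
      show "\<bar>A $ i $ j\<bar> \<le> (\<Sum>k\<in>(UNIV::'m set). C * (r * norm v))" unfolding that(1)
      proof (rule order_trans[OF sum_abs sum_mono])
        fix k
        have "\<bar>v $ k * q i j k\<bar> \<le> norm v * (C * r)"
          unfolding abs_mult by (intro mult_mono component_le_norm_cart that) auto
        then show "\<bar>v $ k * q i j k\<bar> \<le> C * (r * norm v)" by (simp add: mult_ac)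
      qed
    qed
    also have "\<dots> = ?c * r * norm v" by (simp add: mult_ac)
    finally show ?thesis .
  qed
  have "op_hoelder_le \<alpha> ?c (\<lambda>z. matrix_deriv J (f z))"
  proof (rule op_hoelder_leI)
    show "norm (matrix_deriv J (f z) v) \<le> ?c * norm v" if z: "z \<in> cball 0 1" for z v
    proof -
      have "norm (matrix_deriv J (f z) v) \<le> ?c * 1 * norm v"
        by (rule est[where q = "\<lambda>i j k. ?p i j k z"]) (use hoelder_leD(1)[OF P z] in \<open>auto simp: matrix_deriv_def\<close>)
      then show ?thesis by simp
    qed
    show "norm (matrix_deriv J (f z) v - matrix_deriv J (f z') v) \<le> ?c * norm (z - z') powr \<alpha> * norm v"
      if z: "z \<in> cball 0 1" and z': "z' \<in> cball 0 1" for z z' v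
      by (rule est[where q = "\<lambda>i j k. ?p i j k z - ?p i j k z'"])
         (use hoelder_leD(2)[OF P z z'] in \<open>auto simp: matrix_deriv_def sum_subtractf right_diff_distrib\<close>)
  qed (use C(1) linear_dmat in \<open>auto intro!: sum_nonneg\<close>)
  then show ?thesis by blast
qed

text \<open>Supplies the coefficient \<open>A\<close> of the linear theory, namely \<open>J\<close>
  along \<open>f\<close>, together with the derivatives that enter its zeroth-order term.\<close>

lemma smooth_matrix_compose_c1:
  fixes J :: "real^'m \<Rightarrow> real^'m^'m"
  assumes J: "smooth_matrix_fun J" and f: "c1_le \<alpha> K f fx fy"
  shows "\<exists>M. c1_le \<alpha> M (\<lambda>z. J (f z)) (\<lambda>z. matrix_deriv J (f z) (fx z)) (\<lambda>z. matrix_deriv J (f z) (fy z))"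
proof -
  obtain c where c: "op_hoelder_le \<alpha> c (\<lambda>z. matrix_deriv J (f z))" using matrix_deriv_op_hoelder[OF J c1_leD(1)[OF f]] by blast
  obtain C where C: "hoelder_le \<alpha> C (\<lambda>z. J (f z))"
    using hoelder_le_matrix_entries[of \<alpha> "\<lambda>z. J (f z)"] hoelder_le_smooth_compose[OF _ c1_leD(1)[OF f]] J
    unfolding smooth_matrix_fun_def by blast
  note x = op_hoelder_le_apply[OF c c1_leD(2)[OF f]] and y = op_hoelder_le_apply[OF c c1_leD(3)[OF f]]
  let ?M = "max C (2 * c * K)"
  have "((\<lambda>z. J (f z)) has_derivative (\<lambda>h. Re h *\<^sub>R matrix_deriv J (f z) (fx z) + Im h *\<^sub>R matrix_deriv J (f z) (fy z))) (at z within cball 0 1)"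
    if "z \<in> cball 0 1" for z
    by (rule has_derivative_eq_rhs[OF has_derivative_compose[OF c1_leD(4)[OF f that] matrix_deriv_derivative[OF J]]])
       (simp add: linear_add[OF linear_dmat] linear_cmul[OF linear_dmat])
  then have "c1_le \<alpha> ?M (\<lambda>z. J (f z)) (\<lambda>z. matrix_deriv J (f z) (fx z)) (\<lambda>z. matrix_deriv J (f z) (fy z))"
    unfolding c1_le_def using hoelder_le_mono[OF C, of ?M] hoelder_le_mono[OF x, of ?M] hoelder_le_mono[OF y, of ?M] by simp
  then show ?thesis by blast
qed

lemma matrix_increment_bound:
  fixes J :: "real^'m \<Rightarrow> real^'m^'m" and f :: "complex \<Rightarrow> real^'m"
  assumes J: "smooth_matrix_fun J" and f: "hoelder_le \<alpha> K f"
  obtains C where "C \<ge> 0" "\<And>s t W Z. hoelder_le \<alpha> s W \<Longrightarrow> hoelder_le \<alpha> t Z \<Longrightarrow> s \<le> 1 \<Longrightarrow> t \<le> 1 \<Longrightarrow>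
     hoelder_le \<alpha> (C * t) (\<lambda>z. J (f z + W z + Z z) - J (f z + W z))"
    "\<And>s t W Z. hoelder_le \<alpha> s W \<Longrightarrow> hoelder_le \<alpha> t Z \<Longrightarrow> s \<le> 1 \<Longrightarrow> t \<le> 1 \<Longrightarrow>
     hoelder_le \<alpha> (C * ((s + t) * t)) (\<lambda>z. J (f z + W z + Z z) - J (f z + W z) - matrix_deriv J (f z) (Z z))"
proof -
  have sm: "smooth_scalar (\<lambda>x. J x $ i $ j)" for i j using J by (simp add: smooth_matrix_fun_def)
  have "\<exists>C1. \<forall>i j. 0 \<le> C1 i j \<and> (\<forall>s t W Z. hoelder_le \<alpha> s W \<longrightarrow> hoelder_le \<alpha> t Z \<longrightarrow> s \<le> 1 \<longrightarrow> t \<le> 1 \<longrightarrow>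
     hoelder_le \<alpha> (C1 i j * t) (\<lambda>z. J (f z + W z + Z z) $ i $ j - J (f z + W z) $ i $ j))"
    by (rule choice, rule allI, rule choice, rule allI) (rule hoelder_le_increment[OF sm f])
  then obtain C1 where C1: "\<And>i j. C1 i j \<ge> 0" and D1: "\<And>i j s t W Z. hoelder_le \<alpha> s W \<Longrightarrow> hoelder_le \<alpha> t Z \<Longrightarrow> s \<le> 1 \<Longrightarrow> t \<le> 1 \<Longrightarrow>
     hoelder_le \<alpha> (C1 i j * t) (\<lambda>z. J (f z + W z + Z z) $ i $ j - J (f z + W z) $ i $ j)" by blast
  have "\<exists>C2. \<forall>i j. 0 \<le> C2 i j \<and> (\<forall>s t W Z. hoelder_le \<alpha> s W \<longrightarrow> hoelder_le \<alpha> t Z \<longrightarrow> s \<le> 1 \<longrightarrow> t \<le> 1 \<longrightarrow>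
     hoelder_le \<alpha> (C2 i j * ((s + t) * t)) (\<lambda>z. J (f z + W z + Z z) $ i $ j - J (f z + W z) $ i $ j - (\<Sum>k\<in>UNIV. Z z $ k * pderiv_axis k (\<lambda>x. J x $ i $ j) (f z))))"
    by (rule choice, rule allI, rule choice, rule allI) (rule hoelder_le_taylor[OF sm f])
  then obtain C2 where C2: "\<And>i j. C2 i j \<ge> 0" and D2: "\<And>i j s t W Z. hoelder_le \<alpha> s W \<Longrightarrow> hoelder_le \<alpha> t Z \<Longrightarrow> s \<le> 1 \<Longrightarrow> t \<le> 1 \<Longrightarrow>
     hoelder_le \<alpha> (C2 i j * ((s + t) * t)) (\<lambda>z. J (f z + W z + Z z) $ i $ j - J (f z + W z) $ i $ j - (\<Sum>k\<in>UNIV. Z z $ k * pderiv_axis k (\<lambda>x. J x $ i $ j) (f z)))" by blast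
  define C where "C = (\<Sum>i\<in>UNIV. \<Sum>j\<in>UNIV. C1 i j + C2 i j)"
  have le: "C1 i j \<le> C" "C2 i j \<le> C" for i j
  proof -
    have "C1 i j + C2 i j \<le> (\<Sum>j\<in>UNIV. C1 i j + C2 i j)" by (rule member_le_sum) (use C1 C2 in auto)
    also have "\<dots> \<le> C" unfolding C_def by (rule member_le_sum) (use C1 C2 in \<open>auto intro!: sum_nonneg add_nonneg_nonneg\<close>)
    finally show "C1 i j \<le> C" "C2 i j \<le> C" using C1[of i j] C2[of i j] by linarith+
  qed
  have C0: "0 \<le> C" using order_trans[OF C1 le(1)] .
  let ?m = "real CARD('m)"
  show ?thesis
  proof (rule that[of "?m * (?m * C)"])
    fix s t :: real and W Z :: "complex \<Rightarrow> real^'m"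
    assume a: "hoelder_le \<alpha> s W" "hoelder_le \<alpha> t Z" "s \<le> 1" "t \<le> 1"
    have st: "0 \<le> s" "0 \<le> t" using a hoelder_le_nonneg by blast+
    have "hoelder_le \<alpha> (?m * (?m * (C * t))) (\<lambda>z. J (f z + W z + Z z) - J (f z + W z))"
      by (intro hoelder_le_vec, simp only: vector_minus_component) (rule hoelder_le_mono[OF D1[OF a] mult_right_mono[OF le(1) st(2)]])
    then show "hoelder_le \<alpha> (?m * (?m * C) * t) (\<lambda>z. J (f z + W z + Z z) - J (f z + W z))" by (simp add: mult.assoc)
    have "hoelder_le \<alpha> (?m * (?m * (C * ((s + t) * t)))) (\<lambda>z. J (f z + W z + Z z) - J (f z + W z) - matrix_deriv J (f z) (Z z))"
      by (intro hoelder_le_vec, simp only: vector_minus_component matrix_deriv_def vec_lambda_beta)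
         (rule hoelder_le_mono[OF D2[OF a] mult_right_mono[OF le(2)]], use st in simp)
    then show "hoelder_le \<alpha> (?m * (?m * C) * ((s + t) * t)) (\<lambda>z. J (f z + W z + Z z) - J (f z + W z) - matrix_deriv J (f z) (Z z))"
      by (simp add: mult.assoc)
  qed (use C0 in simp)
qed

text \<open>What is left of \<open>J (f + W)\<close> applied to \<open>f_y + W_y\<close> after
  subtracting \<open>J f\<close> applied to \<open>f_y\<close> and the part linear in
  \<open>W\<close> and \<open>W_y\<close>; \<open>p\<close> and \<open>q\<close> stand for
  \<open>f\<close> and \<open>f_y\<close>.\<close>

definition nonlinear_rem :: "(real^'m \<Rightarrow> real^'m^'m) \<Rightarrow> real^'m \<Rightarrow> real^'m \<Rightarrow> real^'m \<Rightarrow> real^'m \<Rightarrow> real^'m" where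
  "nonlinear_rem J p q w wy = (J (p + w) - J p - matrix_deriv J p w) *v q + (J (p + w) - J p) *v wy"

text \<open>The difference splits into three products: the Taylor remainder of \<open>J\<close> with
  \<open>f_y\<close>, the new increment of \<open>J\<close> with the full derivative, and the old
  increment of \<open>J\<close> with the new derivative. Each is of size
  \<open>(s + t) * t\<close>.\<close>

lemma nonlinear_rem_quadratic:
  fixes J :: "real^'m \<Rightarrow> real^'m^'m"
  assumes J: "smooth_matrix_fun J" and f: "hoelder_le \<alpha> K f" and fy: "hoelder_le \<alpha> K fy"
  obtains C where "C \<ge> 0" "\<And>s t W Wy Z Zy. hoelder_le \<alpha> s W \<Longrightarrow> hoelder_le \<alpha> s Wy \<Longrightarrow> hoelder_le \<alpha> t Z \<Longrightarrow> hoelder_le \<alpha> t Zy \<Longrightarrow> s \<le> 1 \<Longrightarrow> t \<le> 1 \<Longrightarrow>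
     hoelder_le \<alpha> (C * ((s + t) * t)) (\<lambda>z. nonlinear_rem J (f z) (fy z) (W z + Z z) (Wy z + Zy z) - nonlinear_rem J (f z) (fy z) (W z) (Wy z))"
proof (rule matrix_increment_bound[OF J f])
  have K: "0 \<le> K" using f by (rule hoelder_le_nonneg)
  fix C assume C: "C \<ge> 0" and C1: "\<And>s t W Z. hoelder_le \<alpha> s W \<Longrightarrow> hoelder_le \<alpha> t Z \<Longrightarrow> s \<le> 1 \<Longrightarrow> t \<le> 1 \<Longrightarrow>
     hoelder_le \<alpha> (C * t) (\<lambda>z. J (f z + W z + Z z) - J (f z + W z))"
   and C2: "\<And>s t W Z. hoelder_le \<alpha> s W \<Longrightarrow> hoelder_le \<alpha> t Z \<Longrightarrow> s \<le> 1 \<Longrightarrow> t \<le> 1 \<Longrightarrow>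
     hoelder_le \<alpha> (C * ((s + t) * t)) (\<lambda>z. J (f z + W z + Z z) - J (f z + W z) - matrix_deriv J (f z) (Z z))"
  show ?thesis
  proof (rule that[of "2 * C * K + 4 * C"])
    fix s t :: real and W Wy Z Zy :: "complex \<Rightarrow> real^'m"
    assume W: "hoelder_le \<alpha> s W" "hoelder_le \<alpha> s Wy" and Z: "hoelder_le \<alpha> t Z" "hoelder_le \<alpha> t Zy" and st: "s \<le> 1" "t \<le> 1"
    have st0: "0 \<le> s" "0 \<le> t" using W(1) Z(1) hoelder_le_nonneg by blast+
    note prod = op_hoelder_le_apply[OF op_hoelder_le_bilinear[OF bounded_bilinear_matrix_vector_mult norm_matrix_vector_mult]]
    have z0: "hoelder_le \<alpha> 0 (\<lambda>z. 0)" by (simp add: hoelder_le_def)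
    \<comment> \<open>The increment bound with zero as current iterate and \<open>W\<close> as
      correction.\<close>
    have J0: "hoelder_le \<alpha> (C * s) (\<lambda>z. J (f z + W z) - J (f z))" using C1[OF z0 W(1)] st by simp
    note sum = hoelder_le_add[OF hoelder_le_add[OF prod[OF C2[OF W(1) Z(1) st] fy] prod[OF C1[OF W(1) Z(1) st] hoelder_le_add[OF W(2) Z(2)]]] prod[OF J0 Z(2)]]
    have eq: "nonlinear_rem J (f z) (fy z) (W z + Z z) (Wy z + Zy z) - nonlinear_rem J (f z) (fy z) (W z) (Wy z) =
       (J (f z + W z + Z z) - J (f z + W z) - matrix_deriv J (f z) (Z z)) *v fy z + (J (f z + W z + Z z) - J (f z + W z)) *v (Wy z + Zy z) + (J (f z + W z) - J (f z)) *v Zy z" for z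
      by (simp add: nonlinear_rem_def linear_add[OF linear_dmat] algebra_simps)
    have "2 * (C * ((s + t) * t)) * K + 2 * (C * t) * (s + t) + 2 * (C * s) * t \<le> (2 * C * K + 4 * C) * ((s + t) * t)"
    proof -
      have "2 * (C * s) * t \<le> 2 * C * ((s + t) * t)" using C st0 by (simp add: algebra_simps)
      then show ?thesis by (simp add: algebra_simps)
    qed
    from hoelder_le_mono[OF sum this]
    show "hoelder_le \<alpha> ((2 * C * K + 4 * C) * ((s + t) * t)) (\<lambda>z. nonlinear_rem J (f z) (fy z) (W z + Z z) (Wy z + Zy z) - nonlinear_rem J (f z) (fy z) (W z) (Wy z))"
      unfolding eq .
  qed (use C K in simp)
qed

section \<open>Newton iteration\<close>

lemma hoelder_le_minus: "hoelder_le \<alpha> M g \<Longrightarrow> hoelder_le \<alpha> M (\<lambda>z. - g z)"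
  by (simp add: hoelder_le_def norm_minus_commute)

lemma c1_le_suminf:
  fixes F :: "nat \<Rightarrow> complex \<Rightarrow> 'a::banach"
  assumes F: "\<And>n. c1_le \<alpha> (A n) (F n) (Fx n) (Fy n)" and A: "summable A"
  shows "c1_le \<alpha> (suminf A) (\<lambda>z. \<Sum>n. F n z) (\<lambda>z. \<Sum>n. Fx n z) (\<lambda>z. \<Sum>n. Fy n z)"
proof -
  note h = hoelder_le_suminf[OF c1_leD(1)[OF F] A] hoelder_le_suminf[OF c1_leD(2)[OF F] A] hoelder_le_suminf[OF c1_leD(3)[OF F] A]
  have tail: "norm ((\<Sum>i<n. G i z) - (\<Sum>i. G i z)) \<le> (\<Sum>i. A (i + n))"
    if G: "\<And>n. hoelder_le \<alpha> (A n) (G n)" and z: "z \<in> cball 0 1" for G :: "nat \<Rightarrow> complex \<Rightarrow> 'a" and z n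
  proof -
    have s: "summable (\<lambda>i. G i z)" using hoelder_le_suminf(1)[OF G A z] .
    have An: "summable (\<lambda>i. A (i + n))" using A by (rule summable_ignore_initial_segment)
    have sn: "summable (\<lambda>i. norm (G (i + n) z))"
      by (rule summable_comparison_test'[OF An, of 0]) (use hoelder_leD(1)[OF G z] in auto)
    have "(\<Sum>i<n. G i z) - (\<Sum>i. G i z) = - (\<Sum>i. G (i + n) z)"
      using suminf_split_initial_segment[OF s, of n] by simp
    then have "norm ((\<Sum>i<n. G i z) - (\<Sum>i. G i z)) \<le> (\<Sum>i. norm (G (i + n) z))" using summable_norm[OF sn] by simp
    also have "\<dots> \<le> (\<Sum>i. A (i + n))" by (rule suminf_le[OF _ sn An]) (rule hoelder_leD(1)[OF G z])
    finally show ?thesis .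
  qed
  let ?d = "\<lambda>n z h. Re h *\<^sub>R Fx n z + Im h *\<^sub>R Fy n z"
  let ?d' = "\<lambda>z h. Re h *\<^sub>R (\<Sum>n. Fx n z) + Im h *\<^sub>R (\<Sum>n. Fy n z)"
  have "\<exists>g. \<forall>z\<in>cball 0 1. (\<lambda>n. F n z) sums g z \<and> (g has_derivative ?d' z) (at z within cball 0 1)"
  proof (rule has_derivative_series[where f' = ?d and x = 0])
    show "(\<lambda>n. F n 0) sums (\<Sum>n. F n 0)" by (rule summable_sums[OF h(1)]) simp
    fix e :: real assume e: "e > 0"
    obtain N where N: "\<And>n. n \<ge> N \<Longrightarrow> norm (\<Sum>i. A (i + n)) < e / 2"
      using suminf_exist_split[OF half_gt_zero[OF e] A] by auto
    show "\<forall>\<^sub>F n in sequentially. \<forall>z\<in>cball 0 1. \<forall>h. norm ((\<Sum>i<n. ?d i z h) - ?d' z h) \<le> e * norm h"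
    proof (rule eventually_sequentiallyI[of N], intro ballI allI)
      fix n and z h :: complex assume n: "N \<le> n" and z: "z \<in> cball 0 1"
      have le: "norm ((\<Sum>i<n. Fx i z) - (\<Sum>i. Fx i z)) \<le> e / 2" "norm ((\<Sum>i<n. Fy i z) - (\<Sum>i. Fy i z)) \<le> e / 2"
        using tail[OF c1_leD(2)[OF F] z, of n] tail[OF c1_leD(3)[OF F] z, of n] N[OF n] by auto
      have e2: "(\<Sum>i<n. ?d i z h) - ?d' z h = Re h *\<^sub>R ((\<Sum>i<n. Fx i z) - (\<Sum>i. Fx i z)) + Im h *\<^sub>R ((\<Sum>i<n. Fy i z) - (\<Sum>i. Fy i z))"
        by (simp only: sum.distrib scaleR_sum_right[symmetric] scaleR_diff_right) (simp only: add_diff_add)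
      have "norm ((\<Sum>i<n. ?d i z h) - ?d' z h) \<le> \<bar>Re h\<bar> * norm ((\<Sum>i<n. Fx i z) - (\<Sum>i. Fx i z)) + \<bar>Im h\<bar> * norm ((\<Sum>i<n. Fy i z) - (\<Sum>i. Fy i z))"
        unfolding e2 by (rule order_trans[OF norm_triangle_ineq]) (simp only: norm_scaleR order_refl)
      also have "\<dots> \<le> norm h * (e / 2) + norm h * (e / 2)"
        by (intro add_mono mult_mono le abs_Re_le_cmod abs_Im_le_cmod) auto
      finally show "norm ((\<Sum>i<n. ?d i z h) - ?d' z h) \<le> e * norm h" by (simp add: mult.commute)
    qed
  qed (use c1_leD(4)[OF F] in auto)
  then obtain g where g: "\<And>z. z \<in> cball 0 1 \<Longrightarrow> (\<lambda>n. F n z) sums g z" "\<And>z. z \<in> cball 0 1 \<Longrightarrow> (g has_derivative ?d' z) (at z within cball 0 1)"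
    by blast
  have "((\<lambda>z. \<Sum>n. F n z) has_derivative ?d' z) (at z within cball 0 1)" if z: "z \<in> cball 0 1" for z
    by (rule has_derivative_transform[OF z _ g(2)[OF z]]) (drule g(1), simp add: sums_iff)
  then show ?thesis unfolding c1_le_def by (intro conjI ballI h(2) h(4) h(6))
qed

text \<open>The linearisation stays frozen at zero, so only the right inverse of \<open>\<l>\<close>
  is used. Starting from \<open>t V\<close>, each correction solves
  \<open>\<l> Z' = - (\<rho> (W + Z) - \<rho> W)\<close>, and these right-hand sides telescope to
  the nonlinear equation. The bounds decay with ratio 1/2, and all corrections after the first are
  of order \<open>t\<^sup>2\<close>.\<close>

lemma newton_iteration:
  fixes V Vx Vy :: "complex \<Rightarrow> 'a::euclidean_space"
    and \<l> :: "complex \<Rightarrow> 'a \<times> 'a \<times> 'a \<Rightarrow> 'a" and \<rho> :: "complex \<Rightarrow> 'a \<Rightarrow> 'a \<Rightarrow> 'a"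
  assumes C: "C \<ge> 0" and solve: "\<And>g N. hoelder_le \<alpha> N g \<Longrightarrow>
      \<exists>W Wx Wy. c1_le \<alpha> (C * N) W Wx Wy \<and> (\<forall>z\<in>cball 0 1. \<l> z (W z, Wx z, Wy z) = g z)"
    and lin: "\<And>z. linear (\<l> z)" and cont: "\<And>z p. isCont (\<lambda>p. \<rho> z (fst p) (snd p)) p" and zero: "\<And>z. \<rho> z 0 0 = 0"
    and Q: "Q \<ge> 0" and quad: "\<And>s t W Wy Z Zy. hoelder_le \<alpha> s W \<Longrightarrow> hoelder_le \<alpha> s Wy \<Longrightarrow> hoelder_le \<alpha> t Z \<Longrightarrow> hoelder_le \<alpha> t Zy \<Longrightarrow> s \<le> 1 \<Longrightarrow> t \<le> 1 \<Longrightarrow>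
     hoelder_le \<alpha> (Q * ((s + t) * t)) (\<lambda>z. \<rho> z (W z + Z z) (Wy z + Zy z) - \<rho> z (W z) (Wy z))"
    and V: "c1_le \<alpha> K V Vx Vy"
  shows "\<exists>t0>0. \<exists>\<kappa>. \<forall>t. \<bar>t\<bar> < t0 \<longrightarrow> (\<exists>M W Wx Wy. c1_le \<alpha> M W Wx Wy \<and> (\<forall>z\<in>cball 0 1. norm (W z - t *\<^sub>R V z) \<le> \<kappa> * t\<^sup>2)
     \<and> (\<forall>z\<in>cball 0 1. \<l> z (W z, Wx z, Wy z) + \<rho> z (W z) (Wy z) = t *\<^sub>R \<l> z (V z, Vx z, Vy z)))"
proof -
  have K: "0 \<le> K" using c1_leD(1)[OF V] by (rule hoelder_le_nonneg)
  \<comment> \<open>The factor \<open>2\<close> is the cost of multiplying by \<open>t\<close> in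
    \<open>c1_le_linear\<close>; the \<open>1\<close> keeps \<open>K'\<close> positive.\<close>
  define K' where "K' = 2 * K + 1"
  have K': "K' > 0" using K by (simp add: K'_def)
  \<comment> \<open>The iterates have size at most \<open>2 * s\<close>, so the quadratic bound
    times \<open>C\<close> is at most \<open>\<gamma> * s\<^sup>2 * (1/2)^n\<close>.\<close>
  define \<gamma> where "\<gamma> = 2 * C * Q"
  have \<gamma>: "\<gamma> \<ge> 0" using C Q by (simp add: \<gamma>_def)
  \<comment> \<open>Ensures \<open>2 * s \<le> 1\<close>, so that the quadratic estimate applies to
    every iterate, and \<open>\<gamma> * s \<le> 1 / 2\<close>, so that the correction bounds
    halve.\<close>
  define t0 where "t0 = 1 / (2 * K' * (1 + \<gamma>))"
  have t0: "t0 > 0" using K' \<gamma> by (simp add: t0_def)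
  have main: "\<exists>M W Wx Wy. c1_le \<alpha> M W Wx Wy \<and> (\<forall>z\<in>cball 0 1. norm (W z - t *\<^sub>R V z) \<le> (2 * \<gamma> * K'\<^sup>2) * t\<^sup>2)
     \<and> (\<forall>z\<in>cball 0 1. \<l> z (W z, Wx z, Wy z) + \<rho> z (W z) (Wy z) = t *\<^sub>R \<l> z (V z, Vx z, Vy z))" if t: "\<bar>t\<bar> < t0" for t
  proof -
    define s where "s = \<bar>t\<bar> * K'"
    have s0: "0 \<le> s" using K' by (simp add: s_def)
    have ss: "s * (2 * (1 + \<gamma>)) \<le> 1"
    proof -
      have "s * (2 * (1 + \<gamma>)) = \<bar>t\<bar> * (2 * K' * (1 + \<gamma>))" by (simp add: s_def)
      also have "\<dots> \<le> t0 * (2 * K' * (1 + \<gamma>))" using t K' \<gamma> by (intro mult_right_mono) auto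
      also have "\<dots> = 1" using K' \<gamma> by (simp add: t0_def)
      finally show ?thesis .
    qed
    have s1: "2 * s \<le> 1" "\<gamma> * s \<le> 1 / 2" using ss mult_nonneg_nonneg[OF \<gamma> s0] s0 by (auto simp: algebra_simps)
    let ?h = "\<lambda>n::nat. (1/2::real) ^ n"
    \<comment> \<open>The factor \<open>2 - 2 * (1/2)^n\<close> is the partial sum of the geometric
      series of correction bounds, so the invariant reproduces itself under addition.\<close>
    define P where "P = (\<lambda>(n::nat) (W :: complex \<Rightarrow> 'a, Wx, Wy, Z :: complex \<Rightarrow> 'a, Zx, Zy). c1_le \<alpha> (s * (2 - 2 * ?h n)) W Wx Wy \<and> c1_le \<alpha> (s * ?h n) Z Zx Zy)"
    define R where "R = (\<lambda>(n::nat) (W :: complex \<Rightarrow> 'a, Wx :: complex \<Rightarrow> 'a, Wy :: complex \<Rightarrow> 'a, Z :: complex \<Rightarrow> 'a, Zx :: complex \<Rightarrow> 'a, Zy :: complex \<Rightarrow> 'a)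
        (W', Wx', Wy', Z', Zx', Zy'). W' = (\<lambda>z. W z + Z z) \<and> Wx' = (\<lambda>z. Wx z + Zx z) \<and> Wy' = (\<lambda>z. Wy z + Zy z)
       \<and> c1_le \<alpha> (\<gamma> * s\<^sup>2 * ?h n) Z' Zx' Zy' \<and> (\<forall>z\<in>cball 0 1. \<l> z (Z' z, Zx' z, Zy' z) = - (\<rho> z (W' z) (Wy' z) - \<rho> z (W z) (Wy z))))"
    have tV: "c1_le \<alpha> s (\<lambda>z. t *\<^sub>R V z) (\<lambda>z. t *\<^sub>R Vx z) (\<lambda>z. t *\<^sub>R Vy z)"
      by (rule c1_le_mono[OF c1_le_linear[OF _ _ _ V, of "\<lambda>v. t *\<^sub>R v" "\<bar>t\<bar>"]])
         (auto simp: s_def K'_def algebra_simps intro: linear_scaleR)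
    define X0 :: "(complex \<Rightarrow> 'a) \<times> (complex \<Rightarrow> 'a) \<times> (complex \<Rightarrow> 'a) \<times> (complex \<Rightarrow> 'a) \<times> (complex \<Rightarrow> 'a) \<times> (complex \<Rightarrow> 'a)"
      where "X0 = (\<lambda>z. 0, \<lambda>z. 0, \<lambda>z. 0, \<lambda>z. t *\<^sub>R V z, \<lambda>z. t *\<^sub>R Vx z, \<lambda>z. t *\<^sub>R Vy z)"
      \<comment> \<open>The solvability hypothesis gives existence only, hence dependent choice; the
        clause for \<open>n = 0\<close> pins the initial state.\<close>
      have "\<exists>X. \<forall>n. (P n (X n) \<and> (n = 0 \<longrightarrow> X n = X0)) \<and> R n (X n) (X (Suc n))"
      proof (rule dependent_nat_choice)
        show "\<exists>x. P 0 x \<and> (0 = (0::nat) \<longrightarrow> x = X0)"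
          by (rule exI[of _ X0]) (use tV in \<open>simp add: P_def X0_def c1_le_def hoelder_le_def\<close>)
        fix X n assume X: "P n X \<and> (n = 0 \<longrightarrow> X = X0)"
        obtain W Wx Wy Z Zx Zy where Xeq: "X = (W, Wx, Wy, Z, Zx, Zy)" by (cases X) auto
        have W: "c1_le \<alpha> (s * (2 - 2 * ?h n)) W Wx Wy" and Z: "c1_le \<alpha> (s * ?h n) Z Zx Zy" using X by (auto simp: Xeq P_def)
        have h01: "0 \<le> ?h n" "?h n \<le> 1" by (auto simp: power_le_one)
        have le1: "s * (2 - 2 * ?h n) \<le> 1" "s * ?h n \<le> 1"
        proof -
          have "s * (2 - 2 * ?h n) \<le> s * 2" using h01 s0 by (intro mult_left_mono) auto
          then show "s * (2 - 2 * ?h n) \<le> 1" using s1 by linarith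
          have "s * ?h n \<le> s * 1" using h01 s0 by (intro mult_left_mono) auto
          then show "s * ?h n \<le> 1" using s1 s0 by linarith
        qed
        let ?g = "\<lambda>z. \<rho> z (W z + Z z) (Wy z + Zy z) - \<rho> z (W z) (Wy z)"
        let ?q = "(s * (2 - 2 * ?h n) + s * ?h n) * (s * ?h n)"
        have "hoelder_le \<alpha> (Q * ?q) ?g"
          by (rule quad) (use c1_leD[OF W] c1_leD[OF Z] le1 in auto)
        then have "hoelder_le \<alpha> (Q * ?q) (\<lambda>z. - ?g z)" by (rule hoelder_le_minus)
        from solve[OF this] obtain Z' Zx' Zy' where Z': "c1_le \<alpha> (C * (Q * ?q)) Z' Zx' Zy'" "\<And>z. z \<in> cball 0 1 \<Longrightarrow> \<l> z (Z' z, Zx' z, Zy' z) = - ?g z"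
          by blast
        have "?q \<le> (s * 2) * (s * ?h n)"
          using h01 s0 by (intro mult_right_mono) (auto simp: algebra_simps)
        then have "C * (Q * ?q) \<le> C * (Q * ((s * 2) * (s * ?h n)))" using C Q by (intro mult_left_mono)
        also have "\<dots> = \<gamma> * s\<^sup>2 * ?h n" by (simp add: \<gamma>_def power2_eq_square)
        finally have Zq: "c1_le \<alpha> (\<gamma> * s\<^sup>2 * ?h n) Z' Zx' Zy'" by (rule c1_le_mono[OF Z'(1)])
        have "\<gamma> * s\<^sup>2 * ?h n = (\<gamma> * s) * (s * ?h n)" by (simp add: power2_eq_square)
        also have "\<dots> \<le> (1/2) * (s * ?h n)" using s1 s0 h01 by (intro mult_right_mono) auto
        finally have Zs: "c1_le \<alpha> (s * ?h (Suc n)) Z' Zx' Zy'" by (intro c1_le_mono[OF Zq]) simp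
        have "s * (2 - 2 * ?h n) + s * ?h n = s * (2 - 2 * ?h (Suc n))" by (simp add: algebra_simps)
        with c1_le_add[OF W Z] have W': "c1_le \<alpha> (s * (2 - 2 * ?h (Suc n))) (\<lambda>z. W z + Z z) (\<lambda>z. Wx z + Zx z) (\<lambda>z. Wy z + Zy z)" by simp
        show "\<exists>Y. (P (Suc n) Y \<and> (Suc n = 0 \<longrightarrow> Y = X0)) \<and> R n X Y"
          unfolding Xeq
          by (rule exI[of _ "(\<lambda>z. W z + Z z, \<lambda>z. Wx z + Zx z, \<lambda>z. Wy z + Zy z, Z', Zx', Zy')"])
             (use W' Zs Zq Z'(2) in \<open>simp add: P_def R_def\<close>)
      qed
    then obtain X where X: "\<And>n. P n (X n)" "\<And>n. R n (X n) (X (Suc n))" "X 0 = X0" by blast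
    define W where "W n = fst (X n)" for n
    define Wy where "Wy n = fst (snd (snd (X n)))" for n
    define Z where "Z n = fst (snd (snd (snd (X n))))" for n
    define Zx where "Zx n = fst (snd (snd (snd (snd (X n)))))" for n
    define Zy where "Zy n = snd (snd (snd (snd (snd (X n)))))" for n
    note defs = W_def Wy_def Z_def Zx_def Zy_def
    have ZP: "c1_le \<alpha> (s * ?h n) (Z n) (Zx n) (Zy n)" for n using X(1)[of n] by (simp add: defs P_def split_def)
    have WS: "W (Suc n) = (\<lambda>z. W n z + Z n z)" "Wy (Suc n) = (\<lambda>z. Wy n z + Zy n z)"
      and ZS: "c1_le \<alpha> (\<gamma> * s\<^sup>2 * ?h n) (Z (Suc n)) (Zx (Suc n)) (Zy (Suc n))"
      and leq: "\<And>z. z \<in> cball 0 1 \<Longrightarrow> \<l> z (Z (Suc n) z, Zx (Suc n) z, Zy (Suc n) z) = - (\<rho> z (W (Suc n) z) (Wy (Suc n) z) - \<rho> z (W n z) (Wy n z))" for n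
      using X(2)[of n] by (simp_all add: defs R_def split_def)
    have init: "W 0 = (\<lambda>z. 0)" "Wy 0 = (\<lambda>z. 0)" "Z 0 = (\<lambda>z. t *\<^sub>R V z)" "Zx 0 = (\<lambda>z. t *\<^sub>R Vx z)" "Zy 0 = (\<lambda>z. t *\<^sub>R Vy z)"
      by (simp_all add: defs X(3) X0_def)
    have Wsum: "W n z = (\<Sum>k<n. Z k z)" "Wy n z = (\<Sum>k<n. Zy k z)" for n z
      by (induction n) (simp_all add: init WS)
    have hs: "?h sums 2" using geometric_sums[of "1/2::real"] by simp
    have summ: "summable (\<lambda>n. c * ?h n)" "(\<Sum>n. c * ?h n) = c * 2" for c
      using sums_mult[OF hs, of c] by (auto simp: sums_iff)
    let ?W = "\<lambda>z. \<Sum>n. Z n z" and ?Wx = "\<lambda>z. \<Sum>n. Zx n z" and ?Wy = "\<lambda>z. \<Sum>n. Zy n z"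
    have c1: "c1_le \<alpha> (s * 2) ?W ?Wx ?Wy" using c1_le_suminf[OF ZP summ(1)] by (simp only: summ(2))
    have sm: "summable (\<lambda>n. Z n z)" "summable (\<lambda>n. Zx n z)" "summable (\<lambda>n. Zy n z)" if "z \<in> cball 0 1" for z
      using hoelder_le_suminf(1)[OF c1_leD(1)[OF ZP] summ(1) that] hoelder_le_suminf(1)[OF c1_leD(2)[OF ZP] summ(1) that]
        hoelder_le_suminf(1)[OF c1_leD(3)[OF ZP] summ(1) that] by auto
    have err: "norm (?W z - t *\<^sub>R V z) \<le> (2 * \<gamma> * K'\<^sup>2) * t\<^sup>2" if z: "z \<in> cball 0 1" for z
    proof -
      \<comment> \<open>The first term of the series is \<open>t V\<close>; the others obey the
        bound with \<open>s\<^sup>2\<close> that \<open>R\<close> records beside the halving bound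
        of \<open>P\<close>.\<close>
      have "?W z - t *\<^sub>R V z = (\<Sum>n. Z (Suc n) z)" using suminf_split_head[OF sm(1)[OF z]] by (simp add: init)
      moreover have "hoelder_le \<alpha> (\<gamma> * s\<^sup>2 * 2) (\<lambda>z. \<Sum>n. Z (Suc n) z)"
        using hoelder_le_suminf(2)[OF c1_leD(1)[OF ZS] summ(1)] by (simp only: summ(2))
      ultimately have "norm (?W z - t *\<^sub>R V z) \<le> \<gamma> * s\<^sup>2 * 2" using hoelder_leD(1)[OF _ z] by (simp only:)
      then show ?thesis by (simp add: s_def power_mult_distrib mult_ac)
    qed
    have eqn: "\<l> z (?W z, ?Wx z, ?Wy z) + \<rho> z (?W z) (?Wy z) = t *\<^sub>R \<l> z (V z, Vx z, Vy z)" if z: "z \<in> cball 0 1" for z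
    proof -
      have bl: "bounded_linear (\<l> z)" using lin by (simp add: linear_conv_bounded_linear)
      have "(\<lambda>n. (Z n z, Zx n z, Zy n z)) sums (?W z, ?Wx z, ?Wy z)"
        unfolding sums_def sum_prod
        by (intro tendsto_Pair) (use sm[OF z, THEN summable_LIMSEQ] in auto)
      from bounded_linear.sums[OF bl this]
      have "(\<lambda>n. \<l> z (Z n z, Zx n z, Zy n z)) sums \<l> z (?W z, ?Wx z, ?Wy z)" .
      then have 1: "(\<lambda>n. \<l> z (Z (Suc n) z, Zx (Suc n) z, Zy (Suc n) z)) sums (\<l> z (?W z, ?Wx z, ?Wy z) - \<l> z (Z 0 z, Zx 0 z, Zy 0 z))"
        unfolding sums_Suc_iff[of "\<lambda>n. \<l> z (Z n z, Zx n z, Zy n z)"] by simp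
      have "(\<lambda>n. (W n z, Wy n z)) \<longlonglongrightarrow> (?W z, ?Wy z)"
        unfolding Wsum by (intro tendsto_Pair summable_LIMSEQ sm z)
      from isCont_tendsto_compose[OF cont this]
      have "(\<lambda>n. \<rho> z (W n z) (Wy n z)) \<longlonglongrightarrow> \<rho> z (?W z) (?Wy z)" by simp
      \<comment> \<open>The right-hand sides of the correction equations telescope. Comparison with
        the sum of their left-hand sides, which lacks the term for \<open>Z 0\<close>, gives the
        nonlinear equation.\<close>
      from telescope_sums[OF this]
      have "(\<lambda>n. - (\<rho> z (W (Suc n) z) (Wy (Suc n) z) - \<rho> z (W n z) (Wy n z))) sums - (\<rho> z (?W z) (?Wy z) - \<rho> z (W 0 z) (Wy 0 z))"
        by (rule sums_minus)
      with 1 have "\<l> z (?W z, ?Wx z, ?Wy z) - \<l> z (Z 0 z, Zx 0 z, Zy 0 z) = - (\<rho> z (?W z) (?Wy z) - \<rho> z (W 0 z) (Wy 0 z))"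
        unfolding leq[OF z] by (rule sums_unique2)
      moreover have "\<l> z (Z 0 z, Zx 0 z, Zy 0 z) = t *\<^sub>R \<l> z (V z, Vx z, Vy z)"
        using linear_cmul[OF lin, of z t "(V z, Vx z, Vy z)"] by (simp add: init)
      ultimately show ?thesis by (simp add: init zero algebra_simps)
    qed
    show ?thesis using c1 err eqn by blast
  qed
  then show ?thesis using t0 by blast
qed

section \<open>Families of discs\<close>

lemma sum_UNIV_Plus:
  "(\<Sum>i\<in>UNIV. g i) = (\<Sum>l\<in>UNIV. g (Inl (l :: 'a::finite))) + (\<Sum>l\<in>UNIV. g (Inr (l :: 'b::finite)))"
  by (subst UNIV_Plus_UNIV[symmetric], subst sum.Plus) auto

lemma Jst_components:
  fixes v :: "'n::finite R2n"
  shows "(Jst *v v) $ Inl k = - v $ Inr k" "(Jst *v v) $ Inr k = v $ Inl k"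
  by (simp_all add: matrix_vector_mult_def Jst_def sum_UNIV_Plus if_distrib[of "\<lambda>x. x * _"] sum.delta cong: if_cong)

lemma Jst_Jst: "Jst *v (Jst *v v) = - (v :: 'n::finite R2n)"
proof -
  have "(Jst *v (Jst *v v)) $ i = (- v) $ i" for i
    by (cases i) (simp_all add: Jst_components)
  then show ?thesis by (simp add: vec_eq_iff)
qed

lemma norm_Jst: "norm (Jst *v v) = norm (v :: 'n::finite R2n)"
  by (simp add: norm_vec_def L2_set_def sum_UNIV_Plus Jst_components add.commute)

text \<open>The Hoelder condition bounds differences only; compactness of the closed disc adds the
  supremum bound that \<open>hoelder_le\<close> includes.\<close>

lemma C1alpha_closed_disc_iff:
  assumes "0 < \<alpha>"
  shows "C1alpha_closed_disc \<alpha> f \<longleftrightarrow> (\<exists>M fx fy. c1_le \<alpha> M f fx fy)"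
proof
  assume "C1alpha_closed_disc \<alpha> f"
  then obtain fx fy where d: "\<And>z. z \<in> cball 0 1 \<Longrightarrow> (f has_derivative (\<lambda>h. Re h *\<^sub>R fx z + Im h *\<^sub>R fy z)) (at z within cball 0 1)"
    and c: "continuous_on (cball 0 1) fx" "continuous_on (cball 0 1) fy"
    and h: "holder_on \<alpha> (cball 0 1) f" "holder_on \<alpha> (cball 0 1) fx" "holder_on \<alpha> (cball 0 1) fy"
    unfolding C1alpha_closed_disc_def by blast
  have c0: "continuous_on (cball 0 1) f" using d by (meson continuous_on_eq_continuous_within has_derivative_continuous)
  have ex: "\<exists>M. hoelder_le \<alpha> M g" if c: "continuous_on (cball 0 1) g" and h: "holder_on \<alpha> (cball 0 1) g" for g :: "complex \<Rightarrow> 'a"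
  proof -
    obtain C where C: "\<And>x y. x \<in> cball 0 1 \<Longrightarrow> y \<in> cball 0 1 \<Longrightarrow> norm (g x - g y) \<le> C * dist x y powr \<alpha>"
      using h unfolding holder_on_def by blast
    have "bounded (g ` cball 0 1)" by (intro compact_imp_bounded compact_continuous_image c compact_cball)
    then obtain b where b: "b > 0" "\<And>x. x \<in> cball 0 1 \<Longrightarrow> norm (g x) \<le> b" unfolding bounded_pos by blast
    have "hoelder_le \<alpha> (b + \<bar>C\<bar>) g"
    proof (rule hoelder_leI)
      show "norm (g z) \<le> b + \<bar>C\<bar>" if "z \<in> cball 0 1" for z using b(2)[OF that] by linarith
      fix z z' :: complex assume z: "z \<in> cball 0 1" "z' \<in> cball 0 1"
      have "norm (g z - g z') \<le> C * norm (z - z') powr \<alpha>" using C[OF z] by (simp add: dist_norm)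
      also have "\<dots> \<le> (b + \<bar>C\<bar>) * norm (z - z') powr \<alpha>" using b(1) by (intro mult_right_mono) auto
      finally show "norm (g z - g z') \<le> (b + \<bar>C\<bar>) * norm (z - z') powr \<alpha>" .
    qed
    then show ?thesis by blast
  qed
  obtain M0 M1 M2 where M: "hoelder_le \<alpha> M0 f" "hoelder_le \<alpha> M1 fx" "hoelder_le \<alpha> M2 fy"
    using ex[OF c0 h(1)] ex[OF c(1) h(2)] ex[OF c(2) h(3)] by blast
  have "c1_le \<alpha> (max M0 (max M1 M2)) f fx fy"
    unfolding c1_le_def
    by (intro conjI ballI hoelder_le_mono[OF M(1)] hoelder_le_mono[OF M(2)] hoelder_le_mono[OF M(3)] d) auto
  then show "\<exists>M fx fy. c1_le \<alpha> M f fx fy" by blast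
next
  assume "\<exists>M fx fy. c1_le \<alpha> M f fx fy"
  then obtain M fx fy where f: "c1_le \<alpha> M f fx fy" by blast
  have h: "holder_on \<alpha> (cball 0 1) g" if "hoelder_le \<alpha> M g" for g :: "complex \<Rightarrow> 'a"
    using that unfolding hoelder_le_def holder_on_def dist_norm by blast
  then show "C1alpha_closed_disc \<alpha> f"
    unfolding C1alpha_closed_disc_def
    by (intro exI[of _ fx] exI[of _ fy] conjI ballI c1_leD(4)[OF f] hoelder_le_continuous[OF c1_leD(2)[OF f] assms]
        hoelder_le_continuous[OF c1_leD(3)[OF f] assms] h c1_leD(1)[OF f] c1_leD(2)[OF f] c1_leD(3)[OF f])
qed

text \<open>At interior points the derivative within the closed disc is the full derivative, hence
  unique; so the existentially given \<open>fx\<close> and \<open>fy\<close> agree there with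
  \<open>px f\<close> and \<open>py f\<close>.\<close>

lemma c1_le_interior:
  assumes f: "c1_le \<alpha> M f fx fy" and \<alpha>: "0 < \<alpha>"
  shows "C1_disc f" "z \<in> ball 0 1 \<Longrightarrow> px f z = fx z" "z \<in> ball 0 1 \<Longrightarrow> py f z = fy z"
proof -
  have d: "(f has_derivative (\<lambda>h. Re h *\<^sub>R fx z + Im h *\<^sub>R fy z)) (at z)" if z: "z \<in> ball 0 1" for z
  proof -
    have "(f has_derivative (\<lambda>h. Re h *\<^sub>R fx z + Im h *\<^sub>R fy z)) (at z within ball 0 1)"
      by (rule has_derivative_subset[OF c1_leD(4)[OF f]]) (use z in auto)
    then show ?thesis unfolding at_within_open[OF z open_ball] .
  qed
  show p: "px f z = fx z" "py f z = fy z" if "z \<in> ball 0 1" for z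
    using frechet_derivative_at[OF d[OF that], symmetric] by (simp_all add: px_def py_def)
  have c: "continuous_on (ball 0 1) g" if "hoelder_le \<alpha> M g" for g :: "complex \<Rightarrow> 'a"
    by (rule continuous_on_subset[OF hoelder_le_continuous[OF that \<alpha>]]) auto
  have "f differentiable_on ball 0 1"
    unfolding differentiable_on_def differentiable_def using d has_derivative_at_withinI by blast
  moreover have "continuous_on (ball 0 1) (px f)" "continuous_on (ball 0 1) (py f)"
    by (rule continuous_on_eq[OF c[OF c1_leD(2)[OF f]]], simp add: p)
       (rule continuous_on_eq[OF c[OF c1_leD(3)[OF f]]], simp add: p)
  ultimately show "C1_disc f" unfolding C1_disc_def by blast
qed

text \<open>The left-hand side of the equation for \<open>f + W\<close> is that for \<open>f\<close>
  plus \<open>\<l> W + \<rho> W\<close>. The iteration makes this sum equal to \<open>t\<close>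
  times \<open>\<l> V\<close> on the closed disc, and \<open>\<l> V\<close> vanishes on the open
  disc because \<open>V\<close> is a variation.\<close>

lemma disc_family_along_variation:
  fixes J :: "('n::finite) R2n \<Rightarrow> 'n mat2n"
  assumes J: "almost_complex_structure J" and inv: "\<forall>z. det (J z + Jst) \<noteq> 0" and \<alpha>: "0 < \<alpha>" "\<alpha> < 1"
    and f: "c1_le \<alpha> K f fx fy" and V: "c1_le \<alpha> K' V Vx Vy"
    and fJ: "\<And>z. z \<in> ball 0 1 \<Longrightarrow> fx z + J (f z) *v fy z = 0"
    and VJ: "\<And>z. z \<in> ball 0 1 \<Longrightarrow> Vx z + J (f z) *v Vy z + matrix_deriv J (f z) (V z) *v fy z = 0"
  shows "\<exists>t0>0. \<exists>\<kappa>. \<forall>t. \<bar>t\<bar> < t0 \<longrightarrow> (\<exists>M W Wx Wy. c1_le \<alpha> M W Wx Wy \<and>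
     (\<forall>z\<in>cball 0 1. norm (W z - t *\<^sub>R V z) \<le> \<kappa> * t\<^sup>2) \<and>
     (\<forall>z\<in>ball 0 1. (fx z + Wx z) + J (f z + W z) *v (fy z + Wy z) = 0))"
proof -
  have sm: "smooth_matrix_fun J" and JJ: "\<And>z. J z ** J z = - mat 1" using J by (auto simp: almost_complex_structure_def)
  have sq: "J x *v (J x *v v) = - v" for x v
    by (simp add: matrix_vector_mul_assoc JJ bounded_bilinear.minus_left[OF bounded_bilinear_matrix_vector_mult])
  interpret T: linear_complex_structure "(*v) (Jst :: 'n mat2n)"
    by unfold_locales (simp_all add: Jst_Jst norm_Jst matrix_vector_right_distrib matrix_vector_mult_scaleR)
  have inj: "v = 0" if "J x *v v + Jst *v v = 0" for x v
  proof -
    have "(J x + Jst) *v v = 0" using that by (simp add: matrix_vector_mult_add_rdistrib)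
    moreover have "inj ((*v) (J x + Jst))" using inv by (simp add: inj_matrix_vector_mult invertible_det_nz)
    ultimately show ?thesis by (metis injD matrix_vector_mult_0_right)
  qed
  obtain M where A: "c1_le \<alpha> M (\<lambda>z. J (f z)) (\<lambda>z. matrix_deriv J (f z) (fx z)) (\<lambda>z. matrix_deriv J (f z) (fy z))"
    using smooth_matrix_compose_c1[OF sm f] by blast
  obtain c where c: "op_hoelder_le \<alpha> c (\<lambda>z. matrix_deriv J (f z))" using matrix_deriv_op_hoelder[OF sm c1_leD(1)[OF f]] by blast
  have a: "op_hoelder_le \<alpha> (2 * K * c) (\<lambda>z v. matrix_deriv J (f z) v *v fy z)"
    by (rule op_hoelder_le_bilinear_left[OF bounded_bilinear_matrix_vector_mult norm_matrix_vector_mult c c1_leD(3)[OF f]])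
  have "\<exists>C\<ge>0. \<forall>g N. hoelder_le \<alpha> N g \<longrightarrow>
     (\<exists>W Wx Wy. c1_le \<alpha> (C * N) W Wx Wy \<and> (\<forall>z\<in>cball 0 1. Wx z + J (f z) *v Wy z + matrix_deriv J (f z) (W z) *v fy z = g z))"
  proof (rule T.variable_structure_solvable[OF \<alpha> bounded_bilinear_matrix_vector_mult norm_matrix_vector_mult A sq inj a], goal_cases)
    case (2 C)
    then show ?case by (intro exI[of _ C] conjI allI impI)
  qed
  then obtain C where C: "C \<ge> 0" "\<And>g N. hoelder_le \<alpha> N g \<Longrightarrow>
     \<exists>W Wx Wy. c1_le \<alpha> (C * N) W Wx Wy \<and> (\<forall>z\<in>cball 0 1. Wx z + J (f z) *v Wy z + matrix_deriv J (f z) (W z) *v fy z = g z)" by blast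
  have "\<exists>Q\<ge>0. \<forall>s t W Wy Z Zy. hoelder_le \<alpha> s W \<longrightarrow> hoelder_le \<alpha> s Wy \<longrightarrow> hoelder_le \<alpha> t Z \<longrightarrow> hoelder_le \<alpha> t Zy \<longrightarrow> s \<le> 1 \<longrightarrow> t \<le> 1 \<longrightarrow>
     hoelder_le \<alpha> (Q * ((s + t) * t)) (\<lambda>z. nonlinear_rem J (f z) (fy z) (W z + Z z) (Wy z + Zy z) - nonlinear_rem J (f z) (fy z) (W z) (Wy z))"
  proof (rule nonlinear_rem_quadratic[OF sm c1_leD(1)[OF f] c1_leD(3)[OF f]], goal_cases)
    case (1 C)
    then show ?case by (intro exI[of _ C] conjI allI impI)
  qed
  then obtain Q where Q: "Q \<ge> 0" "\<And>s t W Wy Z Zy. hoelder_le \<alpha> s W \<Longrightarrow> hoelder_le \<alpha> s Wy \<Longrightarrow> hoelder_le \<alpha> t Z \<Longrightarrow> hoelder_le \<alpha> t Zy \<Longrightarrow> s \<le> 1 \<Longrightarrow> t \<le> 1 \<Longrightarrow>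
     hoelder_le \<alpha> (Q * ((s + t) * t)) (\<lambda>z. nonlinear_rem J (f z) (fy z) (W z + Z z) (Wy z + Zy z) - nonlinear_rem J (f z) (fy z) (W z) (Wy z))" by blast
  define \<l> where "\<l> z p = fst (snd p) + J (f z) *v snd (snd p) + matrix_deriv J (f z) (fst p) *v fy z" for z and p :: "'n R2n \<times> 'n R2n \<times> 'n R2n"
  define \<rho> where "\<rho> z w wy = nonlinear_rem J (f z) (fy z) w wy" for z w wy
  have l: "linear (\<l> z)" for z
    by (rule linearI) (simp_all add: \<l>_def linear_add[OF linear_dmat] linear_cmul[OF linear_dmat] algebra_simps
        matrix_vector_mult_scaleR scaleR_matrix_vector_assoc)
  have "\<exists>t0>0. \<exists>\<kappa>. \<forall>t. \<bar>t\<bar> < t0 \<longrightarrow> (\<exists>M W Wx Wy. c1_le \<alpha> M W Wx Wy \<and> (\<forall>z\<in>cball 0 1. norm (W z - t *\<^sub>R V z) \<le> \<kappa> * t\<^sup>2)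
     \<and> (\<forall>z\<in>cball 0 1. \<l> z (W z, Wx z, Wy z) + \<rho> z (W z) (Wy z) = t *\<^sub>R \<l> z (V z, Vx z, Vy z)))"
  proof (rule newton_iteration[OF C(1) _ l _ _ Q(1) _ V])
    show "\<exists>W Wx Wy. c1_le \<alpha> (C * N) W Wx Wy \<and> (\<forall>z\<in>cball 0 1. \<l> z (W z, Wx z, Wy z) = g z)" if "hoelder_le \<alpha> N g" for g N
      using C(2)[OF that] by (simp add: \<l>_def)
    show "isCont (\<lambda>p. \<rho> z (fst p) (snd p)) p" for z p
    proof -
      have J: "isCont J x" for x using has_derivative_continuous[OF matrix_deriv_derivative[OF sm]] .
      have d: "isCont (matrix_deriv J x) y" for x y
        by (rule linear_continuous_at) (simp add: linear_dmat flip: linear_conv_bounded_linear)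
      show ?thesis unfolding \<rho>_def nonlinear_rem_def
        by (intro continuous_intros bounded_bilinear.continuous[OF bounded_bilinear_matrix_vector_mult]
            isCont_o2[OF _ J] isCont_o2[OF _ d])
    qed
    show "\<rho> z 0 0 = 0" for z by (simp add: \<rho>_def nonlinear_rem_def linear_0[OF linear_dmat])
  qed (use Q(2) in \<open>simp add: \<rho>_def\<close>)
  moreover have "(fx z + Wx z) + J (f z + W z) *v (fy z + Wy z) = 0"
    if z: "z \<in> ball 0 1" and e: "\<l> z (W z, Wx z, Wy z) + \<rho> z (W z) (Wy z) = t *\<^sub>R \<l> z (V z, Vx z, Vy z)" for z t W Wx Wy
  proof -
    have "\<l> z (V z, Vx z, Vy z) = 0" using VJ[OF z] by (simp add: \<l>_def)
    then have "\<l> z (W z, Wx z, Wy z) + \<rho> z (W z) (Wy z) = 0" using e by simp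
    moreover have "(fx z + Wx z) + J (f z + W z) *v (fy z + Wy z) = (fx z + J (f z) *v fy z) + (\<l> z (W z, Wx z, Wy z) + \<rho> z (W z) (Wy z))"
      by (simp add: \<l>_def \<rho>_def nonlinear_rem_def algebra_simps)
    ultimately show ?thesis using fJ[OF z] by simp
  qed
  ultimately show ?thesis by (meson ball_subset_cball subsetD)
qed

theorem theorem1:
  fixes J :: "('n::finite) R2n \<Rightarrow> 'n mat2n"
    and f V :: "complex \<Rightarrow> 'n R2n"
    and \<alpha> :: real
  assumes "almost_complex_structure J"
    and "\<forall>z. det (J z + Jst) \<noteq> 0"
    and "0 < \<alpha>" and "\<alpha> < 1"
    and "C1alpha_closed_disc \<alpha> f" and "J_hol_disc J f"
    and "C1alpha_closed_disc \<alpha> V" and "J_hol_variation J f V"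
  shows "\<exists>t0 > 0. \<exists>F :: real \<Rightarrow> complex \<Rightarrow> 'n R2n.
           (\<forall>t. \<bar>t\<bar> < t0 \<longrightarrow> C1alpha_closed_disc \<alpha> (F t) \<and> J_hol_disc J (F t)) \<and>
           F 0 = f \<and>
           (\<forall>\<zeta>\<in>cball 0 1. ((\<lambda>t. F t \<zeta>) has_vector_derivative V \<zeta>) (at 0))"
proof -
  note \<alpha> = assms(3,4)
  obtain K fx fy where f: "c1_le \<alpha> K f fx fy" using assms(5) C1alpha_closed_disc_iff[OF \<alpha>(1)] by blast
  obtain K' Vx Vy where V: "c1_le \<alpha> K' V Vx Vy" using assms(7) C1alpha_closed_disc_iff[OF \<alpha>(1)] by blast
  have sm: "smooth_matrix_fun J" using assms(1) by (simp add: almost_complex_structure_def)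
  note dJ = frechet_derivative_at[OF matrix_deriv_derivative[OF sm], symmetric]
  have fJ: "fx z + J (f z) *v fy z = 0" if "z \<in> ball 0 1" for z
  proof -
    have "px f z + J (f z) *v py f z = 0" using assms(6) that unfolding J_hol_disc_def by blast
    then show ?thesis using c1_le_interior(2,3)[OF f \<alpha>(1) that] by simp
  qed
  have VJ: "Vx z + J (f z) *v Vy z + matrix_deriv J (f z) (V z) *v fy z = 0" if "z \<in> ball 0 1" for z
  proof -
    have "px V z + J (f z) *v py V z + frechet_derivative J (at (f z)) (V z) *v py f z = 0"
      using assms(8) that unfolding J_hol_variation_def by blast
    then show ?thesis using c1_le_interior(2,3)[OF f \<alpha>(1) that] c1_le_interior(2,3)[OF V \<alpha>(1) that] by (simp add: dJ)
  qed
  obtain t0 \<kappa> where t0: "t0 > 0" and fam: "\<And>t. \<bar>t\<bar> < t0 \<Longrightarrow> \<exists>M W Wx Wy. c1_le \<alpha> M W Wx Wy \<and>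
     (\<forall>z\<in>cball 0 1. norm (W z - t *\<^sub>R V z) \<le> \<kappa> * t\<^sup>2) \<and>
     (\<forall>z\<in>ball 0 1. (fx z + Wx z) + J (f z + W z) *v (fy z + Wy z) = 0)"
    using disc_family_along_variation[OF assms(1,2) \<alpha> f V fJ VJ] by blast
  have "\<exists>G. (C1alpha_closed_disc \<alpha> G \<and> J_hol_disc J G) \<and> (\<forall>z\<in>cball 0 1. norm (G z - f z - t *\<^sub>R V z) \<le> \<kappa> * t\<^sup>2)"
    if t: "\<bar>t\<bar> < t0" for t
  proof -
    obtain M W Wx Wy where W: "c1_le \<alpha> M W Wx Wy" and err: "\<forall>z\<in>cball 0 1. norm (W z - t *\<^sub>R V z) \<le> \<kappa> * t\<^sup>2"
      and eq: "\<forall>z\<in>ball 0 1. (fx z + Wx z) + J (f z + W z) *v (fy z + Wy z) = 0" using fam[OF t] by blast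
    note G = c1_le_add[OF f W]
    have "C1alpha_closed_disc \<alpha> (\<lambda>z. f z + W z)" using G C1alpha_closed_disc_iff[OF \<alpha>(1)] by blast
    moreover have "J_hol_disc J (\<lambda>z. f z + W z)"
      using c1_le_interior[OF G \<alpha>(1)] eq by (simp add: J_hol_disc_def)
    ultimately show ?thesis using err by (intro exI[of _ "\<lambda>z. f z + W z"]) simp
  qed
  then obtain G where G: "\<And>t. \<bar>t\<bar> < t0 \<Longrightarrow> C1alpha_closed_disc \<alpha> (G t) \<and> J_hol_disc J (G t)"
    "\<And>t z. \<bar>t\<bar> < t0 \<Longrightarrow> z \<in> cball 0 1 \<Longrightarrow> norm (G t z - f z - t *\<^sub>R V z) \<le> \<kappa> * t\<^sup>2" by metis
  \<comment> \<open>The estimate at \<open>t = 0\<close> forces \<open>G 0 = f\<close> on the closed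
    disc only; inserting \<open>f\<close> itself yields equality of functions on the whole
    plane.\<close>
  define F where "F t = (if t = 0 then f else G t)" for t
  have "((\<lambda>t. F t z) has_vector_derivative V z) (at 0)" if z: "z \<in> cball 0 1" for z
  proof -
    have "((\<lambda>t. norm (F t z - f z - t *\<^sub>R V z) / norm t) \<longlongrightarrow> 0) (at 0)"
    proof (rule Lim_null_comparison)
      show "\<forall>\<^sub>F t in at 0. norm (norm (F t z - f z - t *\<^sub>R V z) / norm t) \<le> \<kappa> * \<bar>t\<bar>"
      proof (rule eventually_at_topological[THEN iffD2], intro exI conjI ballI impI)
        show "open (ball (0::real) t0)" "0 \<in> ball (0::real) t0" using t0 by auto
        fix t :: real assume "t \<in> ball 0 t0" "t \<noteq> 0"
        then have "norm (F t z - f z - t *\<^sub>R V z) \<le> (\<kappa> * \<bar>t\<bar>) * \<bar>t\<bar>" using G(2)[of t z] z by (simp add: F_def power2_eq_square mult.assoc)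
        then show "norm (norm (F t z - f z - t *\<^sub>R V z) / norm t) \<le> \<kappa> * \<bar>t\<bar>" using \<open>t \<noteq> 0\<close> by (simp add: pos_divide_le_eq)
      qed
      show "((\<lambda>t. \<kappa> * \<bar>t\<bar>) \<longlongrightarrow> 0) (at 0)" by (intro tendsto_eq_intros) auto
    qed
    moreover have "F 0 = f" by (simp add: F_def)
    ultimately show ?thesis by (simp add: has_vector_derivative_def has_derivative_at bounded_linear_scaleR_left)
  qed
  then show ?thesis using t0 G(1) assms(5,6) by (intro exI[of _ t0] conjI exI[of _ F]) (auto simp: F_def)
qed

end
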